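(* Let $b\ge0$, $\beta,\gamma\in(0,1]$, $\lambda>0$. The density $h(x,t)=\Pr\{\mathfrak{H}_t\in dx\}/dx$ of the hitting time $$\mathfrak{H}_t=\inf\{s\ge0:\ N(\mathfrak{A}^\gamma_s)+b\,\mathfrak{A}^\beta_s>t\},\qquad t\ge0,$$ is the solution to the equation $$b^\beta\mathcal{D}^\beta_tu+\lambda^\gamma(I-K)^\gamma u=-\frac{\partial u}{\partial x},\qquad x>0,\ t>0,$$ with initial and boundary conditions $$u(x,0)=\delta(x),\qquad u(0,t)=-\frac{\gamma\lambda^\gamma}{\Gamma(1-\gamma)}\sum_{k=0}^\infty\frac{\Gamma(k-\gamma)}{k!}H(t-k),$$ where $H$ is the Heaviside step function and $K$ is the unit shift operator in the variable $t$, $Ku(x,t)=u(x,t-1)$ (that is, $K=e^{-\partial_t}$ if $b>0$, and $K=B$, the backward shift, if $b=0$).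
   Context: $N$ is a homogeneous Poisson process of rate $\lambda$. For $\nu\in(0,1)$, $\mathfrak{A}^\nu$ is a $\nu$-stable subordinator with $\mathbb{E}e^{-\xi\mathfrak{A}^\nu_t}=e^{-t\xi^\nu}$, and $\mathfrak{A}^1_t=t$; the processes $N,\mathfrak{A}^\gamma,\mathfrak{A}^\beta$ are independent. $\delta$ is the Dirac delta. $\mathcal{D}^\beta_tu=\partial^\beta_tu-u(0^+)\frac{t^{-\beta}}{\Gamma(1-\beta)}$ is the Dzhrbashyan–Caputo fractional derivative, with $\partial_t^\beta u=\frac1{\Gamma(1-\beta)}\frac{\partial}{\partial t}\int_0^t\frac{u(s)\,ds}{(t-s)^\beta}$ the Riemann–Liouville derivative (for $\beta=1$, $\mathcal D^1_t=\partial_t$). $(I-K)^\gamma=\sum_{j\ge0}(-1)^j\binom{\gamma}{j}K^j$. For $\gamma=1$ the boundary condition is read as $u(0,t)=\lambda[H(t)-H(t-1)]$.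
   Formalization: Equation and boundary condition hold weakly in x, as the pointwise trace differs if b>0, β<1; u(x,0)=δ(x) is imposed only for b>0 (at b=0, H_0 is exponential); a density is claimed only if b=0 or β<1 (else H_t has an atom); uniqueness is among bounded, weakly right-continuous measure families. *)

theory Defs
  imports "HOL-Probability.Probability"
begin

section \<open>The processes\<close>

text \<open>Time runs over \<open>{0..}\<close>; values of a process at negative times are irrelevant.\<close>

definition independent_increments :: "'a measure \<Rightarrow> (real \<Rightarrow> 'a \<Rightarrow> real) \<Rightarrow> bool" where
  "independent_increments M X \<longleftrightarrow>
     (\<forall>n (t :: nat \<Rightarrow> real). 0 \<le> t 0 \<and> (\<forall>i. t i \<le> t (Suc i)) \<longrightarrow>
        prob_space.indep_vars M (\<lambda>_. borel) (\<lambda>i \<omega>. X (t (Suc i)) \<omega> - X (t i) \<omega>) {..<n})"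

definition right_continuous_paths :: "'a measure \<Rightarrow> (real \<Rightarrow> 'a \<Rightarrow> real) \<Rightarrow> bool" where
  "right_continuous_paths M X \<longleftrightarrow>
     (\<forall>\<omega>\<in>space M. \<forall>t\<ge>0. continuous (at_right t) (\<lambda>s. X s \<omega>))"

definition nondecreasing_paths :: "'a measure \<Rightarrow> (real \<Rightarrow> 'a \<Rightarrow> real) \<Rightarrow> bool" where
  "nondecreasing_paths M X \<longleftrightarrow> (\<forall>\<omega>\<in>space M. mono_on {0..} (\<lambda>s. X s \<omega>))"

definition poisson_process :: "'a measure \<Rightarrow> real \<Rightarrow> (real \<Rightarrow> 'a \<Rightarrow> nat) \<Rightarrow> bool" where
  "poisson_process M rate N \<longleftrightarrow>
     (\<forall>t\<ge>0. N t \<in> measurable M (count_space UNIV)) \<and>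
     (\<forall>\<omega>\<in>space M. N 0 \<omega> = 0) \<and>
     right_continuous_paths M (\<lambda>t \<omega>. real (N t \<omega>)) \<and>
     nondecreasing_paths M (\<lambda>t \<omega>. real (N t \<omega>)) \<and>
     independent_increments M (\<lambda>t \<omega>. real (N t \<omega>)) \<and>
     (\<forall>s t. 0 \<le> s \<and> s < t \<longrightarrow>
        distr M (count_space UNIV) (\<lambda>\<omega>. N t \<omega> - N s \<omega>)
          = measure_pmf (poisson_pmf (rate * (t - s))))"

text \<open>The index \<open>\<nu> = 1\<close> is the degenerate case of pure unit drift.\<close>

definition stable_subordinator :: "'a measure \<Rightarrow> real \<Rightarrow> (real \<Rightarrow> 'a \<Rightarrow> real) \<Rightarrow> bool" where
  "stable_subordinator M \<nu> S \<longleftrightarrow>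
     (if \<nu> = 1 then (\<forall>t\<ge>0. \<forall>\<omega>\<in>space M. S t \<omega> = t)
      else (\<forall>t\<ge>0. S t \<in> borel_measurable M) \<and>
        (\<forall>\<omega>\<in>space M. S 0 \<omega> = 0) \<and>
        right_continuous_paths M S \<and>
        nondecreasing_paths M S \<and>
        independent_increments M S \<and>
        (\<forall>s t \<xi>. 0 \<le> s \<and> s < t \<and> 0 \<le> \<xi> \<longrightarrow>
           (\<integral>\<omega>. exp (- \<xi> * (S t \<omega> - S s \<omega>)) \<partial>M) = exp (- (t - s) * \<xi> powr \<nu>)))"

text \<open>Independence of whole processes: the paths are regarded as random elements of
  the product space over all times.\<close>

definition independent_processes :: "'a measure \<Rightarrow> (real \<Rightarrow> 'a \<Rightarrow> real) list \<Rightarrow> bool" where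
  "independent_processes M Xs \<longleftrightarrow>
     prob_space.indep_vars M (\<lambda>_. PiM {0..} (\<lambda>_. borel))
       (\<lambda>i \<omega>. \<lambda>t\<in>{0..}. (Xs ! i) t \<omega>) {..<length Xs}"

definition hitting_time ::
    "(real \<Rightarrow> 'a \<Rightarrow> nat) \<Rightarrow> (real \<Rightarrow> 'a \<Rightarrow> real) \<Rightarrow> real \<Rightarrow> (real \<Rightarrow> 'a \<Rightarrow> real)
     \<Rightarrow> real \<Rightarrow> 'a \<Rightarrow> real" where
  "hitting_time N A b B t \<omega> = Inf {s. 0 \<le> s \<and> real (N (A s \<omega>) \<omega>) + b * B s \<omega> > t}"


section \<open>The operators in the time variable\<close>

definition heaviside :: "real \<Rightarrow> real" where
  "heaviside t = (if t \<ge> 0 then 1 else 0)"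

definition frac_integral :: "real \<Rightarrow> (real \<Rightarrow> real) \<Rightarrow> real \<Rightarrow> real" where
  "frac_integral \<beta> U t = 1 / Gamma (1 - \<beta>) * (LBINT s:{0..t}. U s / (t - s) powr \<beta>)"

definition riemann_liouville :: "real \<Rightarrow> (real \<Rightarrow> real) \<Rightarrow> real \<Rightarrow> real" where
  "riemann_liouville \<beta> U t = deriv (frac_integral \<beta> U) t"

definition caputo :: "real \<Rightarrow> (real \<Rightarrow> real) \<Rightarrow> real \<Rightarrow> real" where
  "caputo \<beta> U t =
     (if \<beta> = 1 then deriv U t
      else riemann_liouville \<beta> U t - Lim (at_right 0) U * (t powr (- \<beta>) / Gamma (1 - \<beta>)))"

text \<open>\<^const>\<open>deriv\<close> is total, so the existence of the derivative is a separate condition.\<close>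

definition caputo_differentiable :: "real \<Rightarrow> (real \<Rightarrow> real) \<Rightarrow> real \<Rightarrow> bool" where
  "caputo_differentiable \<beta> U t \<longleftrightarrow>
     (if \<beta> = 1 then U differentiable (at t) else frac_integral \<beta> U differentiable (at t))"

definition unit_shift :: "(real \<Rightarrow> real) \<Rightarrow> real \<Rightarrow> real" where
  "unit_shift U t = U (t - 1)"

definition frac_difference :: "real \<Rightarrow> (real \<Rightarrow> real) \<Rightarrow> real \<Rightarrow> real" where
  "frac_difference \<gamma> U t = (\<Sum>j. (-1) ^ j * (\<gamma> gchoose j) * (unit_shift ^^ j) U t)"


section \<open>The initial-boundary value problem\<close>

text \<open>The solution is sought as a density \<open>u(\<cdot>,t)\<close> on \<open>[0,\<infinity>)\<close>.  As the initial value is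
  a Dirac mass (and for \<open>\<beta> = 1\<close>, \<open>b > 0\<close> such a mass travels along the line \<open>x = t/b\<close>),
  \<open>u(\<cdot>,t)\<close> is a generalised density, that is a measure \<open>u t\<close>; the equation is understood
  pointwise in \<open>t\<close> and in the sense of distributions in \<open>x\<close>.\<close>

definition test_function :: "(real \<Rightarrow> real) \<Rightarrow> bool" where
  "test_function f \<longleftrightarrow> f C1_differentiable_on UNIV \<and> compact (closure {x. f x \<noteq> 0})"

text \<open>The shift looks back to negative times, where \<open>u\<close> vanishes.\<close>

definition pairing :: "(real \<Rightarrow> real measure) \<Rightarrow> (real \<Rightarrow> real) \<Rightarrow> real \<Rightarrow> real" where
  "pairing u f t = (if t < 0 then 0 else (\<integral>x. f x \<partial>(u t)))"

text \<open>The functional \<open>f \<mapsto> \<integral>\<^sub>0\<^sup>\<infinity> f (- \<partial>u/\<partial>x) dx\<close>, integrated by parts, with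
  \<open>g t\<close> in place of the boundary value \<open>u(0,t)\<close>.  Test functions need not vanish at 0,
  so that this is how the boundary condition is imposed.  Since the initial mass \<open>\<delta>(x)\<close>
  itself sits at the boundary point \<open>x = 0\<close>, the boundary condition cannot be read as a
  pointwise trace: for \<open>b > 0\<close>, \<open>\<beta> < 1\<close> the limit of the density at \<open>x = 0+\<close> is \<open>g t\<close> plus
  \<open>b powr \<beta> * t powr (-\<beta>) / Gamma (1 - \<beta>)\<close>, the latter being the contribution of
  \<open>u(x,0+) = \<delta>(x)\<close> in the Caputo derivative.\<close>

definition minus_dx_pairing ::
    "(real \<Rightarrow> real) \<Rightarrow> (real \<Rightarrow> real measure) \<Rightarrow> (real \<Rightarrow> real) \<Rightarrow> real \<Rightarrow> real" where
  "minus_dx_pairing g u f t = g t * f 0 + pairing u (deriv f) t"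

definition boundary_value :: "real \<Rightarrow> real \<Rightarrow> real \<Rightarrow> real" where
  "boundary_value \<gamma> rate t =
     (if \<gamma> = 1 then rate * (heaviside t - heaviside (t - 1))
      else - (\<gamma> * rate powr \<gamma> / Gamma (1 - \<gamma>)) *
             (\<Sum>k. Gamma (real k - \<gamma>) / fact k * heaviside (t - real k)))"

definition density_family :: "(real \<Rightarrow> real measure) \<Rightarrow> bool" where
  "density_family u \<longleftrightarrow>
     (\<forall>t\<ge>0. finite_measure (u t) \<and> sets (u t) = sets borel \<and> emeasure (u t) {..<0} = 0) \<and>
     (\<exists>C. \<forall>t\<ge>0. measure (u t) UNIV \<le> C) \<and>
     (\<forall>f. test_function f \<longrightarrow> (\<forall>t\<ge>0. continuous (at_right t) (pairing u f)))"

text \<open>For \<open>b = 0\<close> the equation contains no derivative in time, and no initial value is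
  prescribed: \<open>u(\<cdot>,0)\<close> is then determined by the equation and the boundary value (and it
  is an exponential density, not \<open>\<delta>\<close>).  Note that \<open>0 powr \<beta> = 0\<close>.\<close>

definition ibvp_solution ::
    "real \<Rightarrow> real \<Rightarrow> real \<Rightarrow> real \<Rightarrow> real measure \<Rightarrow> (real \<Rightarrow> real)
     \<Rightarrow> (real \<Rightarrow> real measure) \<Rightarrow> bool" where
  "ibvp_solution b \<beta> \<gamma> rate u0 g u \<longleftrightarrow>
     density_family u \<and>
     (b > 0 \<longrightarrow> u 0 = u0) \<and>
     (\<forall>f t. test_function f \<and> t > 0 \<longrightarrow>
        (b > 0 \<longrightarrow> caputo_differentiable \<beta> (pairing u f) t) \<and>
        b powr \<beta> * caputo \<beta> (pairing u f) t
          + rate powr \<gamma> * frac_difference \<gamma> (pairing u f) t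
        = minus_dx_pairing g u f t)"

end

theory Submission
  imports Defs
begin

text \<open>Write \<open>Y s = N (A s) + b * B s\<close>.  Independence gives
  \<open>E exp (- \<xi> * Y s) = exp (- s * \<Phi> \<xi>)\<close> with
  \<open>\<Phi> \<xi> = b powr \<beta> * \<xi> powr \<beta> + rate powr \<gamma> * (1 - exp (- \<xi>)) powr \<gamma>\<close>, and as \<open>H t > x\<close> is, up to
  the boundary, the event \<open>Y x \<le> t\<close>, the hitting time at an independent exponential time of
  parameter \<open>\<xi>\<close> is exponential of parameter \<open>\<Phi> \<xi>\<close>.  On the other side, a Laplace transform in \<open>t\<close> turns
  the problem, tested with \<open>f\<close>, into \<open>\<Phi> \<xi> * (u\<^sub>\<xi> f - f 0 / \<xi>) = u\<^sub>\<xi> f'\<close>.  The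
  exponential law satisfies this identity, and uniqueness of Laplace transforms of
  right-continuous functions leads back to the equation at every \<open>t > 0\<close>.  The identity determines the
  transform \<open>u\<^sub>\<xi>\<close>, because every test function agrees on \<open>[0,\<infinity>)\<close> with \<open>h' - \<Phi> \<xi> * h\<close> for
  some test function \<open>h\<close>; hence the solution is unique.

  For the density, the probability that \<open>H t\<close> lies in a short interval is at most the probability that
  \<open>N (A s)\<close> jumps in it, which is of the order of its length, plus a finite sum of
  probabilities for inverse stable subordinators, whose laws are absolutely continuous.\<close>

section \<open>Right-continuous functions\<close>

text \<open>The initial mass sits on the boundary point \<open>x = 0\<close>, so initial and
  boundary value interfere in every tested equation. They can be treated together because the
  prescribed boundary value is \<open>rate powr \<gamma>\<close> times the
  \<open>\<gamma>\<close>-th fractional difference of the Heaviside function: passing from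
  \<open>pairing u f\<close> to \<open>pairing u f - f 0 * heaviside\<close> absorbs the boundary
  term and, for \<open>b > 0\<close>, makes the initial value zero. This is the origin of
  \<open>f 0 / \<xi>\<close> in the transformed identity. The equation is required at every
  \<open>t > 0\<close>, including the existence of the derivative, so transforms alone do not
  suffice. For \<open>b > 0\<close> the missing regularity is the path continuity of the hitting
  time, which holds because \<open>B\<close>, and with it \<open>Y\<close>, increases strictly; for
  \<open>b = 0\<close> no derivative occurs and right continuity is enough. As \<open>Y\<close>
  jumps, \<open>Y x \<le> t\<close> and \<open>x \<le> H t\<close> may disagree when
  \<open>x = H t\<close>; all comparisons are made with room for this case. For \<open>b > 0\<close>
  and \<open>\<beta> = 1\<close> there is no density: \<open>B\<close> is a pure drift, and the
  event that \<open>N (A s)\<close> has not jumped up to \<open>s = t / b\<close> leaves an atom at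
  \<open>t / b\<close>.\<close>

lemma right_cont_tendsto:
  fixes F :: "real \<Rightarrow> real"
  assumes "continuous (at_right t) F" and "X \<longlonglongrightarrow> t" and "\<And>n. t < X n"
  shows "(\<lambda>n. F (X n)) \<longlonglongrightarrow> F t"
proof -
  have "filterlim X (at_right t) sequentially"
    using assms(2,3) by (auto simp: filterlim_at less_imp_neq[symmetric] intro!: always_eventually)
  thus ?thesis
    using assms(1) unfolding continuous_within
    by (rule filterlim_compose[rotated])
qed

text \<open>The next point strictly to the right of \<open>t\<close> on the grid of mesh
  \<open>1 / (n + 1)\<close>. It is floor plus one rather than a ceiling: a grid point must move as
  well, since right limits only see strictly larger times.\<close>

definition up_approx :: "nat \<Rightarrow> real \<Rightarrow> real" where
  "up_approx n t = (of_int \<lfloor>real (Suc n) * t\<rfloor> + 1) / real (Suc n)"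

lemma up_approx_gt: "t < up_approx n t"
proof -
  have "real (Suc n) * t < of_int \<lfloor>real (Suc n) * t\<rfloor> + 1" by linarith
  thus ?thesis unfolding up_approx_def
    by (subst pos_less_divide_eq) (simp_all del: of_nat_Suc add: mult.commute)
qed

lemma up_approx_le: "up_approx n t \<le> t + 1 / real (Suc n)"
proof -
  have "of_int \<lfloor>real (Suc n) * t\<rfloor> \<le> real (Suc n) * t" by linarith
  thus ?thesis unfolding up_approx_def
    by (simp del: of_nat_Suc add: add_divide_distrib pos_divide_le_eq mult.commute)
qed

lemma up_approx_tendsto: "(\<lambda>n. up_approx n t) \<longlonglongrightarrow> t"
proof (rule tendsto_sandwich[where f = "\<lambda>_. t" and h = "\<lambda>n. t + 1 / real (Suc n)"])
  show "(\<lambda>n. t + 1 / real (Suc n)) \<longlonglongrightarrow> t"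
    using tendsto_add[OF tendsto_const[of t] LIMSEQ_inverse_real_of_nat] by (simp add: field_simps)
  show "\<forall>\<^sub>F n in sequentially. up_approx n t \<le> t + 1 / real (Suc n)"
    by (intro always_eventually allI up_approx_le)
qed (auto intro!: always_eventually less_imp_le up_approx_gt)

text \<open>For fixed \<open>n\<close> the time is frozen on countably many Borel cells, and on each
  cell the process is a single random variable; right continuity lets \<open>n\<close> tend to
  infinity. The \<open>max 0\<close> keeps the time in the half-line of which the hypotheses
  speak.\<close>

lemma right_continuous_joint_measurable:
  fixes X :: "real \<Rightarrow> 'a \<Rightarrow> real"
  assumes [measurable]: "\<And>t. t \<ge> 0 \<Longrightarrow> X t \<in> borel_measurable M"
    and rc: "\<And>\<omega> t. \<omega> \<in> space M \<Longrightarrow> t \<ge> 0 \<Longrightarrow> continuous (at_right t) (\<lambda>s. X s \<omega>)"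
  shows "(\<lambda>(t, \<omega>). X (max 0 t) \<omega>) \<in> borel_measurable (borel \<Otimes>\<^sub>M M)"
proof (rule borel_measurable_LIMSEQ_real)
  define idx where "idx n t = \<lfloor>real (Suc n) * max 0 t\<rfloor>" for n :: nat and t :: real
  have idx_meas: "(\<lambda>z. idx n (fst z)) \<in> measurable (borel \<Otimes>\<^sub>M M) (count_space UNIV)" for n
    unfolding idx_def by measurable
  show "(\<lambda>z. X (max 0 (up_approx n (max 0 (fst z)))) (snd z)) \<in> borel_measurable (borel \<Otimes>\<^sub>M M)" for n
  proof -
    have "(\<lambda>z. X (max 0 ((of_int (idx n (fst z)) + 1) / real (Suc n))) (snd z))
        \<in> borel_measurable (borel \<Otimes>\<^sub>M M)"
      by (rule measurable_compose_countable[OF _ idx_meas]) measurable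
    thus ?thesis by (simp add: idx_def up_approx_def)
  qed
  show "(\<lambda>n. X (max 0 (up_approx n (max 0 (fst z)))) (snd z)) \<longlonglongrightarrow> (case z of (t, \<omega>) \<Rightarrow> X (max 0 t) \<omega>)"
    if "z \<in> space (borel \<Otimes>\<^sub>M M)" for z
  proof -
    have "snd z \<in> space M" using that by (auto simp: space_pair_measure)
    moreover have "max 0 (up_approx n (max 0 (fst z))) = up_approx n (max 0 (fst z))" for n
      using up_approx_gt[of "max 0 (fst z)" n] by linarith
    ultimately show ?thesis
      using right_cont_tendsto[OF rc[of "snd z" "max 0 (fst z)"] up_approx_tendsto up_approx_gt]
      by (simp add: split_def)
  qed
qed

text \<open>This is the joint statement over a sample space with one point.\<close>

lemma right_continuous_measurable:
  fixes F :: "real \<Rightarrow> real"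
  assumes "\<And>t. t \<ge> 0 \<Longrightarrow> continuous (at_right t) F" and "\<And>t. t < 0 \<Longrightarrow> F t = 0"
  shows "F \<in> borel_measurable borel"
proof -
  have "(\<lambda>(t, \<omega>). F (max 0 t)) \<in> borel_measurable (borel \<Otimes>\<^sub>M count_space {()})"
    by (rule right_continuous_joint_measurable) (use assms in auto)
  moreover have "(\<lambda>t. (t, ())) \<in> measurable borel (borel \<Otimes>\<^sub>M count_space {()})"
    by (intro measurable_Pair) auto
  ultimately have [measurable]: "(\<lambda>t. F (max 0 t)) \<in> borel_measurable borel"
    using measurable_compose by fastforce
  have "(\<lambda>t. if t < 0 then 0 else F (max 0 t)) \<in> borel_measurable borel"
    by measurable
  also have "(\<lambda>t. if t < 0 then 0 else F (max 0 t)) = F"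
    using assms(2) by (auto simp: fun_eq_iff max_def)
  finally show ?thesis .
qed

lemma continuous_at_rightI_sequentially:
  fixes F :: "real \<Rightarrow> real"
  assumes "\<And>X. (\<And>n. t < X n) \<Longrightarrow> X \<longlonglongrightarrow> t \<Longrightarrow> (\<lambda>n. F (X n)) \<longlonglongrightarrow> F t"
  shows "continuous (at_right t) F"
  unfolding continuous_within
  by (rule tendsto_at_right_sequentially[of t "t + 1"]) (use assms in auto)

section \<open>Laplace transforms\<close>

text \<open>Substituting \<open>x = exp (- t)\<close> turns the integer values of the transforms
  into moments on \<open>{0..1}\<close>. Equal moments give equal integrals of polynomials, hence of
  continuous functions by Bernstein approximation, hence equal distribution functions.\<close>

lemma laplace_unique_measure:
  fixes \<mu> \<nu> :: "real measure"
  assumes \<mu>: "finite_measure \<mu>" "sets \<mu> = sets borel" "AE t in \<mu>. 0 \<le> t"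
    and \<nu>: "finite_measure \<nu>" "sets \<nu> = sets borel" "AE t in \<nu>. 0 \<le> t"
    and eq: "\<And>n::nat. (\<integral>t. exp (- real n * t) \<partial>\<mu>) = (\<integral>t. exp (- real n * t) \<partial>\<nu>)"
  shows "\<mu> = \<nu>"
proof -
  interpret \<mu>: finite_measure \<mu> by fact
  interpret \<nu>: finite_measure \<nu> by fact
  note [measurable_cong] = \<mu>(2) \<nu>(2)
  have space: "space \<mu> = UNIV" "space \<nu> = UNIV"
    using sets_eq_imp_space_eq[OF \<mu>(2)] sets_eq_imp_space_eq[OF \<nu>(2)] by simp_all
  \<comment> \<open>The truncation at 1 keeps the values in \<open>{0..1}\<close> also on the null
    set of negative \<open>t\<close>, so that the polynomial approximation holds at every
    point.\<close>
  define E :: "real \<Rightarrow> real" where "E t = min 1 (exp (- t))" for t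
  have [measurable]: "E \<in> borel_measurable borel" unfolding E_def by measurable
  have E01: "E t \<in> {0..1}" for t by (auto simp: E_def)
  have E_eq: "t \<ge> 0 \<Longrightarrow> E t = exp (- t)" for t by (auto simp: E_def)
  have pow: "(\<integral>t. E t ^ n \<partial>\<mu>) = (\<integral>t. E t ^ n \<partial>\<nu>)" for n
  proof -
    have "(\<integral>t. E t ^ n \<partial>\<mu>) = (\<integral>t. exp (- real n * t) \<partial>\<mu>)"
      using \<mu>(3) by (intro integral_cong_AE) (auto simp: E_eq exp_of_nat_mult[symmetric] elim!: eventually_mono)
    also have "\<dots> = (\<integral>t. exp (- real n * t) \<partial>\<nu>)" by (rule eq)
    also have "\<dots> = (\<integral>t. E t ^ n \<partial>\<nu>)"
      using \<nu>(3) by (intro integral_cong_AE) (auto simp: E_eq exp_of_nat_mult[symmetric] elim!: eventually_mono)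
    finally show ?thesis .
  qed
  have E_pow_bound: "norm (E t ^ n) \<le> 1" for t n
    using E01[of t] by (auto simp: power_le_one)
  have int_pow: "integrable \<mu> (\<lambda>t. E t ^ n)" "integrable \<nu> (\<lambda>t. E t ^ n)" for n
    by (auto intro!: \<mu>.integrable_const_bound[of _ 1] \<nu>.integrable_const_bound[of _ 1] AE_I2 E_pow_bound)
  have poly: "(\<integral>t. poly p (E t) \<partial>\<mu>) = (\<integral>t. poly p (E t) \<partial>\<nu>)"
       "integrable \<mu> (\<lambda>t. poly p (E t))" "integrable \<nu> (\<lambda>t. poly p (E t))" for p
    unfolding poly_altdef using pow by (auto simp: int_pow)
  have cont: "(\<integral>t. f (E t) \<partial>\<mu>) = (\<integral>t. f (E t) \<partial>\<nu>)"
    if f: "continuous_on {0..1} f" and [measurable]: "f \<in> borel_measurable borel" for f :: "real \<Rightarrow> real"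
  proof -
    have "\<exists>p. \<forall>x\<in>{0..1}. \<bar>f x - poly p x\<bar> < e" if "e > 0" for e
    proof -
      obtain N where N: "\<And>x. x \<in> {0..1} \<Longrightarrow> \<bar>f x - (\<Sum>k\<le>N. f(k/N) * Bernstein N k x)\<bar> < e"
        using Bernstein_Weierstrass[OF f \<open>e > 0\<close>] by blast
      define p where "p = (\<Sum>k\<le>N. smult (f (k/N) * (N choose k)) ([:0,1:]^k * [:1,-1:]^(N-k)))"
      have "poly p x = (\<Sum>k\<le>N. f(k/N) * Bernstein N k x)" for x
        unfolding p_def poly_sum by (intro sum.cong) (auto simp: Bernstein_def mult_ac)
      with N show ?thesis by (metis (no_types, lifting))
    qed
    hence "\<forall>n. \<exists>p. \<forall>x\<in>{0..1}. \<bar>f x - poly p x\<bar> < 1 / real (Suc n)"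
      by simp
    then obtain p where p: "\<And>n x. x \<in> {0..1} \<Longrightarrow> \<bar>f x - poly (p n) x\<bar> < 1 / real (Suc n)"
      by metis
    obtain C where C: "\<And>x. x \<in> {0..1} \<Longrightarrow> \<bar>f x\<bar> \<le> C"
      using compact_imp_bounded[OF compact_continuous_image[OF f compact_Icc]]
      unfolding bounded_iff by (auto simp del: atLeastAtMost_iff)
    have lim: "(\<lambda>n. poly (p n) (E t)) \<longlonglongrightarrow> f (E t)" for t
    proof (rule LIM_zero_cancel, rule Lim_null_comparison[OF always_eventually LIMSEQ_inverse_real_of_nat], intro allI)
      show "norm (poly (p n) (E t) - f (E t)) \<le> inverse (real (Suc n))" for n
        using p[of "E t" n] E01[of t] by (simp add: abs_minus_commute field_simps)
    qed
    have bd: "norm (poly (p n) (E t)) \<le> C + 1" for n t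
    proof -
      have "1 / real (Suc n) \<le> 1" by simp
      thus ?thesis using p[OF E01, of t n] C[OF E01, of t] unfolding real_norm_def by linarith
    qed
    have "(\<lambda>n. \<integral>t. poly (p n) (E t) \<partial>\<mu>) \<longlonglongrightarrow> (\<integral>t. f (E t) \<partial>\<mu>)"
      by (rule integral_dominated_convergence[where w = "\<lambda>_. C + 1"])
        (use lim bd poly(2) in \<open>auto simp: borel_measurable_integrable\<close>)
    moreover have "(\<lambda>n. \<integral>t. poly (p n) (E t) \<partial>\<nu>) \<longlonglongrightarrow> (\<integral>t. f (E t) \<partial>\<nu>)"
      by (rule integral_dominated_convergence[where w = "\<lambda>_. C + 1"])
        (use lim bd poly(3) in \<open>auto simp: borel_measurable_integrable\<close>)
    ultimately show ?thesis
      unfolding poly(1) using LIMSEQ_unique by blast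
  qed
  have tail: "measure \<mu> {..a} = measure \<nu> {..a}" if a: "a \<ge> 0" for a
  proof -
    \<comment> \<open>A ramp in \<open>x = exp (- t)\<close> that equals 1 from
      \<open>exp (- a)\<close> on; its limit is therefore the indicator of the closed half-line
      \<open>t \<le> a\<close>, as the distribution function demands.\<close>
    define f where "f n x = min 1 (max 0 (1 + real n * (x - exp (- a))))" for n :: nat and x :: real
    have [measurable]: "f n \<in> borel_measurable borel" for n unfolding f_def by measurable
    have lim: "(\<lambda>n. f n (E t)) \<longlonglongrightarrow> indicator {..a} t" for t
    proof (cases "t \<le> a")
      case True
      hence "E t \<ge> exp (- a)" using a by (auto simp: E_def)
      hence "f n (E t) = 1" for n unfolding f_def by simp
      thus ?thesis using True by simp
    next
      case False
      hence "E t < exp (- a)" using a by (auto simp: E_def)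
      then obtain n0 :: nat where n0: "real n0 * (exp (- a) - E t) > 1"
        using reals_Archimedean3[of "exp (-a) - E t"] by (auto simp: algebra_simps)
      have "f n (E t) = 0" if "n \<ge> n0" for n
      proof -
        have "real n0 * (exp (- a) - E t) \<le> real n * (exp (- a) - E t)"
          using that \<open>E t < exp (- a)\<close> by (intro mult_right_mono) auto
        hence "1 + real n * (E t - exp (- a)) \<le> 0" using n0 by (simp add: algebra_simps)
        thus ?thesis unfolding f_def by simp
      qed
      hence "eventually (\<lambda>n. f n (E t) = 0) sequentially" by (auto simp: eventually_sequentially)
      thus ?thesis using False by (auto intro: tendsto_eventually)
    qed
    have "(\<lambda>n. \<integral>t. f n (E t) \<partial>\<mu>) \<longlonglongrightarrow> (\<integral>t. indicator {..a} t \<partial>\<mu>)"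
      by (rule integral_dominated_convergence[where w = "\<lambda>_. 1"]) (use lim in \<open>auto simp: f_def\<close>)
    moreover have "(\<lambda>n. \<integral>t. f n (E t) \<partial>\<nu>) \<longlonglongrightarrow> (\<integral>t. indicator {..a} t \<partial>\<nu>)"
      by (rule integral_dominated_convergence[where w = "\<lambda>_. 1"]) (use lim in \<open>auto simp: f_def\<close>)
    moreover have "(\<integral>t. f n (E t) \<partial>\<mu>) = (\<integral>t. f n (E t) \<partial>\<nu>)" for n
      by (rule cont) (auto simp: f_def intro!: continuous_intros)
    ultimately have "(\<integral>t. indicat_real {..a} t \<partial>\<mu>) = (\<integral>t. indicat_real {..a} t \<partial>\<nu>)"
      using LIMSEQ_unique[of "\<lambda>n. \<integral>t. f n (E t) \<partial>\<nu>"] by (simp only: )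
    thus ?thesis by (simp add: space)
  qed
  have neg: "measure \<mu> {..a} = 0" "measure \<nu> {..a} = 0" if "a < 0" for a
  proof -
    have "emeasure \<mu> {t\<in>space \<mu>. t \<le> a} = 0"
      by (rule emeasure_eq_0_AE, rule eventually_mono[OF \<mu>(3)]) (use that in auto)
    moreover have "emeasure \<nu> {t\<in>space \<nu>. t \<le> a} = 0"
      by (rule emeasure_eq_0_AE, rule eventually_mono[OF \<nu>(3)]) (use that in auto)
    ultimately have "emeasure \<mu> {..a} = 0" "emeasure \<nu> {..a} = 0"
      by (simp_all add: space atMost_def)
    thus "measure \<mu> {..a} = 0" "measure \<nu> {..a} = 0" by (auto simp: measure_def)
  qed
  show ?thesis
  proof (rule cdf_unique')
    show "finite_borel_measure \<mu>" "finite_borel_measure \<nu>"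
      by (auto intro!: finite_borel_measure.intro finite_borel_measure_axioms.intro \<mu> \<nu>)
    show "cdf \<mu> = cdf \<nu>"
      using tail neg by (auto simp: cdf_def fun_eq_iff) (metis not_le)
  qed
qed

section \<open>Transforms of causal functions\<close>

definition laplace :: "(real \<Rightarrow> real) \<Rightarrow> real \<Rightarrow> real" where
  "laplace F \<xi> = (\<integral>t. exp (- \<xi> * t) * F t \<partial>lborel)"

text \<open>Causality is built in so that transforms, shifts and convolutions can be taken over the
  whole line. Convergence is asked for at \<open>\<xi> > 0\<close> only, so bounded measurable
  causal functions qualify although they need not be integrable.\<close>

definition has_laplace :: "(real \<Rightarrow> real) \<Rightarrow> bool" where
  "has_laplace F \<longleftrightarrow> (\<forall>t<0. F t = 0) \<and> (\<forall>\<xi>>0. integrable lborel (\<lambda>t. exp (- \<xi> * t) * F t))"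

lemma has_laplaceD:
  assumes "has_laplace F"
  shows "t < 0 \<Longrightarrow> F t = 0" and "\<xi> > 0 \<Longrightarrow> integrable lborel (\<lambda>t. exp (- \<xi> * t) * F t)"
  using assms by (auto simp: has_laplace_def)

lemma has_laplace_measurable [measurable_dest]:
  assumes "has_laplace F"
  shows "F \<in> borel_measurable borel"
proof -
  have "(\<lambda>t. exp (- 1 * t) * F t) \<in> borel_measurable borel"
    using borel_measurable_integrable[OF has_laplaceD(2)[OF assms zero_less_one]] by simp
  hence "(\<lambda>t. exp t * (exp (- 1 * t) * F t)) \<in> borel_measurable borel" by measurable
  thus ?thesis by (simp add: mult.assoc[symmetric] exp_add[symmetric])
qed

lemma has_laplace_diff:
  assumes "has_laplace F" "has_laplace G"
  shows "has_laplace (\<lambda>t. F t - G t)"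
    and "\<xi> > 0 \<Longrightarrow> laplace (\<lambda>t. F t - G t) \<xi> = laplace F \<xi> - laplace G \<xi>"
  using assms by (auto simp: has_laplace_def laplace_def right_diff_distrib)

lemma has_laplace_cmult:
  assumes "has_laplace F"
  shows "has_laplace (\<lambda>t. c * F t)"
    and "laplace (\<lambda>t. c * F t) \<xi> = c * laplace F \<xi>"
  using assms by (auto simp: has_laplace_def laplace_def mult.left_commute[of _ c])

lemma heaviside_measurable [measurable]: "heaviside \<in> borel_measurable borel"
  unfolding heaviside_def[abs_def] by measurable

lemma has_bochner_integral_exponential_density:
  assumes "l > 0"
  shows "has_bochner_integral lborel (exponential_density l) 1"
  using nn_integral_erlang_ith_moment[OF assms, of 0 0] assms
  by (intro has_bochner_integral_nn_integral) (auto simp: erlang_density_def)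

lemma laplace_heaviside:
  assumes "\<xi> > 0"
  shows "integrable lborel (\<lambda>t. exp (- \<xi> * t) * heaviside t)" and "laplace heaviside \<xi> = 1 / \<xi>"
proof -
  have "has_bochner_integral lborel (\<lambda>t. 1 / \<xi> * exponential_density \<xi> t) (1 / \<xi> * 1)"
    by (intro has_bochner_integral_mult_right has_bochner_integral_exponential_density assms)
  moreover have "1 / \<xi> * exponential_density \<xi> t = exp (- \<xi> * t) * heaviside t" for t
    using assms by (auto simp: exponential_density_def heaviside_def mult.commute)
  ultimately have "has_bochner_integral lborel (\<lambda>t. exp (- \<xi> * t) * heaviside t) (1 / \<xi>)"
    by simp
  thus "integrable lborel (\<lambda>t. exp (- \<xi> * t) * heaviside t)" and "laplace heaviside \<xi> = 1 / \<xi>"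
    unfolding laplace_def by (auto simp: has_bochner_integral_iff)
qed

lemma has_laplace_bounded:
  assumes [measurable]: "F \<in> borel_measurable borel" and "\<And>t. t < 0 \<Longrightarrow> F t = 0" and "\<And>t. t \<ge> 0 \<Longrightarrow> \<bar>F t\<bar> \<le> C"
  shows "has_laplace F"
  unfolding has_laplace_def
proof (intro conjI allI impI assms(2))
  fix \<xi> :: real assume "\<xi> > 0"
  hence "integrable lborel (\<lambda>t. C * (exp (- \<xi> * t) * heaviside t))"
    using laplace_heaviside(1) by simp
  thus "integrable lborel (\<lambda>t. exp (- \<xi> * t) * F t)"
    by (rule Bochner_Integration.integrable_bound)
      (use assms(2,3) in \<open>auto simp: heaviside_def abs_mult mult.commute
        intro!: AE_I2 order_trans[OF _ abs_ge_self]\<close>)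
qed

lemma has_laplace_heaviside: "has_laplace heaviside"
  by (rule has_laplace_bounded[of _ 1]) (auto simp: heaviside_def)

text \<open>The positive and negative parts of \<open>exp (- t) * F t\<close> are densities of
  finite measures whose transforms at \<open>n\<close> differ by
  \<open>laplace F (n + 1) = 0\<close>. So \<open>F\<close> vanishes almost everywhere, and right
  continuity upgrades this to every \<open>t \<ge> 0\<close>.\<close>

lemma laplace_unique:
  assumes F: "has_laplace F" and rc: "\<And>t. t \<ge> 0 \<Longrightarrow> continuous (at_right t) F"
    and zero: "\<And>\<xi>. \<xi> > 0 \<Longrightarrow> laplace F \<xi> = 0" and t: "t \<ge> 0"
  shows "F t = 0"
proof -
  note [measurable] = has_laplace_measurable[OF F]
  \<comment> \<open>\<open>c = 1\<close> and \<open>c = -1\<close> select the positive and the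
    negative part. The factor \<open>exp (- t)\<close> makes the measures finite, since
    \<open>F\<close> itself need not be integrable.\<close>
  define P where "P c t = exp (- t) * max 0 (c * F t)" for c t
  have [measurable]: "P c \<in> borel_measurable borel" for c unfolding P_def by measurable
  have P_nonneg: "P c t \<ge> 0" for c t by (simp add: P_def)
  have P_int: "integrable lborel (\<lambda>t. exp (- real n * t) * P c t)" if "\<bar>c\<bar> \<le> 1" for n c
  proof (rule Bochner_Integration.integrable_bound)
    show "integrable lborel (\<lambda>t. exp (- (real n + 1) * t) * F t)"
      using has_laplaceD(2)[OF F, of "real n + 1"] by simp
    show "AE t in lborel. norm (exp (- real n * t) * P c t) \<le> norm (exp (- (real n + 1) * t) * F t)"
    proof (intro AE_I2)
      fix t
      have "\<bar>c * F t\<bar> \<le> 1 * \<bar>F t\<bar>" unfolding abs_mult using that by (intro mult_right_mono) auto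
      hence "max 0 (c * F t) \<le> \<bar>F t\<bar>" by linarith
      moreover have "exp (- real n * t) * exp (- t) = exp (- (real n + 1) * t)"
        by (simp add: exp_add[symmetric] algebra_simps)
      ultimately show "norm (exp (- real n * t) * P c t) \<le> norm (exp (- (real n + 1) * t) * F t)"
        by (simp only: P_def norm_mult mult.assoc[symmetric]) (simp add: mult_left_mono)
    qed
  qed auto
  have P_fin: "finite_measure (density lborel (P c))" if "\<bar>c\<bar> \<le> 1" for c
    using P_int[OF that, of 0] P_nonneg
    by (intro finite_measureI) (auto simp: emeasure_density nn_integral_eq_integral)
  have P_pos: "AE t in density lborel (P c). 0 \<le> t" for c
    using F by (subst AE_density) (auto simp: P_def has_laplace_def not_le intro!: AE_I2 leI)
  have "density lborel (P 1) = density lborel (P (-1))"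
  proof (rule laplace_unique_measure)
    fix n :: nat
    have "(\<integral>t. exp (- real n * t) \<partial>density lborel (P 1)) - (\<integral>t. exp (- real n * t) \<partial>density lborel (P (-1)))
       = (\<integral>t. exp (- real n * t) * P 1 t \<partial>lborel) - (\<integral>t. exp (- real n * t) * P (-1) t \<partial>lborel)"
      by (simp add: integral_density P_nonneg mult.commute)
    also have "\<dots> = (\<integral>t. exp (- real n * t) * P 1 t - exp (- real n * t) * P (-1) t \<partial>lborel)"
      by (rule Bochner_Integration.integral_diff[symmetric]; rule P_int) simp_all
    also have "\<dots> = laplace F (real n + 1)"
    proof -
      have "exp (- (real n + 1) * t) = exp (- real n * t) * exp (- t)" for t
        by (simp add: exp_add[symmetric] algebra_simps)
      moreover have "P 1 t - P (-1) t = exp (- t) * F t" for t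
        by (auto simp: P_def max_def)
      ultimately show ?thesis
        unfolding laplace_def by (simp only: right_diff_distrib[symmetric] mult.assoc)
    qed
    also have "\<dots> = 0" by (rule zero) simp
    finally show "(\<integral>t. exp (- real n * t) \<partial>density lborel (P 1)) = (\<integral>t. exp (- real n * t) \<partial>density lborel (P (-1)))"
      by simp
  qed (auto intro!: P_fin P_pos)
  hence "AE t in lborel. ennreal (P 1 t) = ennreal (P (-1) t)"
    by (intro sigma_finite_measure.density_unique) (auto intro: sigma_finite_lborel)
  hence ae: "AE t in lborel. F t = 0"
    by eventually_elim (auto simp: P_nonneg P_def max_def split: if_splits)
  \<comment> \<open>A set of zeros of full measure meets every interval to the right of
    \<open>t\<close>.\<close>
  have "\<exists>x. t < x \<and> x < t + 1 / real (Suc n) \<and> F x = 0" for n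
  proof (rule ccontr)
    assume "\<not> ?thesis"
    hence "AE x in lborel. x \<notin> {t<..<t + 1 / real (Suc n)}"
      using ae by (auto elim!: eventually_mono)
    moreover have "{x \<in> space lborel. \<not> x \<notin> {t<..<t + 1 / real (Suc n)}} = {t<..<t + 1 / real (Suc n)}"
      by auto
    ultimately have "emeasure lborel {t<..<t + 1 / real (Suc n)} = 0"
      using AE_iff_measurable[of "{t<..<t + 1 / real (Suc n)}" lborel "\<lambda>x. x \<notin> {t<..<t + 1 / real (Suc n)}"]
      by simp
    thus False by (subst (asm) emeasure_lborel_Ioo) (auto simp: ennreal_eq_0_iff)
  qed
  then obtain X where X: "\<And>n. t < X n" "\<And>n. X n < t + 1 / real (Suc n)" "\<And>n. F (X n) = 0"
    by metis
  have "X \<longlonglongrightarrow> t"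
    by (rule tendsto_sandwich[where f = "\<lambda>_. t" and h = "\<lambda>n. t + 1 / real (Suc n)"])
      (use X(1,2) LIMSEQ_inverse_real_of_nat_add[of t] in \<open>auto simp: less_imp_le inverse_eq_divide\<close>)
  from right_cont_tendsto[OF rc[OF t] this X(1)] X(3) show ?thesis
    by (simp add: LIMSEQ_const_iff)
qed

section \<open>Convolution and the fractional kernel\<close>

lemma convolution_integral:
  fixes f g :: "real \<Rightarrow> real"
  assumes f: "integrable lborel f" and g: "integrable lborel g"
  shows "integrable lborel (\<lambda>t. \<integral>s. f s * g (t - s) \<partial>lborel)"
    and "(\<integral>t. (\<integral>s. f s * g (t - s) \<partial>lborel) \<partial>lborel) = (\<integral>s. f s \<partial>lborel) * (\<integral>s. g s \<partial>lborel)"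
proof -
  have [measurable]: "f \<in> borel_measurable borel" "g \<in> borel_measurable borel"
    using f g by (auto dest: borel_measurable_integrable)
  have shift: "integrable lborel (\<lambda>t. h (t - s)) \<and> (\<integral>t. h (t - s) \<partial>lborel) = (\<integral>t. h t \<partial>lborel)"
    if "integrable lborel h" for h :: "real \<Rightarrow> real" and s
    using lborel_integrable_real_affine[OF that, of 1 "-s"] lborel_integral_real_affine[of 1 h "-s"]
    by (simp add: algebra_simps)
  have int: "integrable (lborel \<Otimes>\<^sub>M lborel) (\<lambda>(s, t). f s * g (t - s))"
  proof (rule lborel_pair.Fubini_integrable)
    show "integrable lborel (\<lambda>s. \<integral>t. norm (case (s, t) of (s, t) \<Rightarrow> f s * g (t - s)) \<partial>lborel)"
      using f shift[OF integrable_norm[OF g]] by (simp add: abs_mult)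
    show "AE s in lborel. integrable lborel (\<lambda>t. case (s, t) of (s, t) \<Rightarrow> f s * g (t - s))"
      using shift[OF g] by simp
  qed measurable
  from lborel_pair.integrable_snd[OF int]
  show "integrable lborel (\<lambda>t. \<integral>s. f s * g (t - s) \<partial>lborel)" .
  have "(\<integral>t. (\<integral>s. f s * g (t - s) \<partial>lborel) \<partial>lborel) = (\<integral>s. (\<integral>t. f s * g (t - s) \<partial>lborel) \<partial>lborel)"
    by (rule lborel_pair.Fubini_integral[OF int])
  also have "\<dots> = (\<integral>s. f s \<partial>lborel) * (\<integral>s. g s \<partial>lborel)"
    using shift[OF g] by simp
  finally show "(\<integral>t. (\<integral>s. f s * g (t - s) \<partial>lborel) \<partial>lborel) = (\<integral>s. f s \<partial>lborel) * (\<integral>s. g s \<partial>lborel)" .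
qed

definition conv :: "(real \<Rightarrow> real) \<Rightarrow> (real \<Rightarrow> real) \<Rightarrow> real \<Rightarrow> real" where
  "conv F G t = (\<integral>s. F s * G (t - s) \<partial>lborel)"

text \<open>The exponential weight factors over \<open>s\<close> and \<open>t - s\<close>, so a
  weighted convolution is the convolution of the weighted functions.\<close>

lemma has_laplace_conv:
  assumes F: "has_laplace F" and G: "has_laplace G"
  shows "has_laplace (conv F G)"
    and "\<xi> > 0 \<Longrightarrow> laplace (conv F G) \<xi> = laplace F \<xi> * laplace G \<xi>"
proof -
  have *: "exp (- \<xi> * t) * conv F G t
      = (\<integral>s. (exp (- \<xi> * s) * F s) * (exp (- \<xi> * (t - s)) * G (t - s)) \<partial>lborel)" for \<xi> t
  proof -
    have "exp (- \<xi> * t) = exp (- \<xi> * s) * exp (- \<xi> * (t - s))" for s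
      by (simp add: exp_add[symmetric] algebra_simps)
    hence "exp (- \<xi> * t) * (F s * G (t - s)) = (exp (- \<xi> * s) * F s) * (exp (- \<xi> * (t - s)) * G (t - s))" for s
      by simp
    thus ?thesis unfolding conv_def integral_mult_right_zero[symmetric] by (simp only:)
  qed
  have "F s * G (t - s) = 0" if "t < 0" for s t
    using has_laplaceD(1)[OF F, of s] has_laplaceD(1)[OF G, of "t - s"] that by (cases "s < 0") auto
  hence "conv F G t = 0" if "t < 0" for t
    using that by (simp only: conv_def Bochner_Integration.integral_zero)
  thus "has_laplace (conv F G)"
    unfolding has_laplace_def *
    by (intro conjI allI impI
      convolution_integral(1)[of "\<lambda>s. exp (- _ * s) * F s" "\<lambda>s. exp (- _ * s) * G s"]
      has_laplaceD(2)[OF F] has_laplaceD(2)[OF G]) auto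
  show "laplace (conv F G) \<xi> = laplace F \<xi> * laplace G \<xi>" if "\<xi> > 0"
    unfolding laplace_def * using that
    by (intro convolution_integral(2)[of "\<lambda>s. exp (- \<xi> * s) * F s" "\<lambda>s. exp (- \<xi> * s) * G s"]
        has_laplaceD(2)[OF F] has_laplaceD(2)[OF G])
qed

text \<open>Convolution with it is fractional integration of order \<open>1 - \<beta>\<close>. At
  index \<open>\<beta> - 1\<close> it equals
  \<open>t powr (1 - \<beta>) / Gamma (2 - \<beta>)\<close> for \<open>t > 0\<close>, the primitive
  of the kernel of index \<open>\<beta>\<close>.\<close>

definition frac_kernel :: "real \<Rightarrow> real \<Rightarrow> real" where
  "frac_kernel \<beta> s = (if s > 0 then s powr (- \<beta>) / Gamma (1 - \<beta>) else 0)"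

lemma frac_kernel_measurable [measurable]: "frac_kernel \<beta> \<in> borel_measurable borel"
  unfolding frac_kernel_def[abs_def] by measurable

lemma frac_kernel_nonneg: "\<beta> < 1 \<Longrightarrow> frac_kernel \<beta> s \<ge> 0"
  by (auto simp: frac_kernel_def intro!: divide_nonneg_nonneg less_imp_le[OF Gamma_real_pos])

text \<open>Euler's integral for \<open>Gamma (1 - \<beta>)\<close> after replacing \<open>t\<close>
  by \<open>\<xi> * t\<close>. The form with a nonnegative integral serves both the absolutely
  convergent transform and the later computations in which integrals are exchanged.\<close>

lemma nn_integral_frac_kernel:
  assumes \<beta>: "\<beta> < 1" and \<xi>: "\<xi> > 0"
  shows "(\<integral>\<^sup>+ t. ennreal (exp (- \<xi> * t) * frac_kernel \<beta> t) \<partial>lborel) = ennreal (\<xi> powr (\<beta> - 1))"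
proof -
  have G: "Gamma (1 - \<beta>) > 0" using \<beta> by (intro Gamma_real_pos) simp
  have "ennreal (Gamma (1 - \<beta>)) = (\<integral>\<^sup>+ t. ennreal (indicator {0..} t * t powr ((1 - \<beta>) - 1) / exp t) \<partial>lborel)"
    using Gamma_conv_nn_integral_real[of "1 - \<beta>"] \<beta> by simp
  also have "\<dots> = ennreal \<bar>\<xi>\<bar> * (\<integral>\<^sup>+ t. ennreal (indicator {0..} (0 + \<xi> * t) * (0 + \<xi> * t) powr ((1 - \<beta>) - 1) / exp (0 + \<xi> * t)) \<partial>lborel)"
    using \<xi> by (subst nn_integral_real_affine[where c = \<xi> and t = 0]) auto
  also have "\<dots> = ennreal \<xi> * (\<integral>\<^sup>+ t. ennreal (\<xi> powr (- \<beta>) * Gamma (1 - \<beta>)) * ennreal (exp (- \<xi> * t) * frac_kernel \<beta> t) \<partial>lborel)"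
  proof -
    have "ennreal (indicator {0..} (0 + \<xi> * t) * (0 + \<xi> * t) powr ((1 - \<beta>) - 1) / exp (0 + \<xi> * t))
       = ennreal (\<xi> powr (- \<beta>) * Gamma (1 - \<beta>)) * ennreal (exp (- \<xi> * t) * frac_kernel \<beta> t)" for t
      using \<xi> \<beta> G frac_kernel_nonneg[OF \<beta>, of t] less_imp_neq[OF G, symmetric]
      by (subst ennreal_mult[symmetric]) (auto simp: frac_kernel_def powr_mult exp_minus field_simps
        indicator_def zero_le_mult_iff)
    thus ?thesis using \<xi> by simp
  qed
  also have "\<dots> = ennreal (\<xi> * (\<xi> powr (- \<beta>) * Gamma (1 - \<beta>))) * (\<integral>\<^sup>+ t. ennreal (exp (- \<xi> * t) * frac_kernel \<beta> t) \<partial>lborel)"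
    using \<xi> G by (subst nn_integral_cmult) (auto simp: ennreal_mult mult.assoc)
  finally have *: "ennreal (Gamma (1 - \<beta>)) = ennreal (\<xi> * (\<xi> powr (- \<beta>) * Gamma (1 - \<beta>))) * (\<integral>\<^sup>+ t. ennreal (exp (- \<xi> * t) * frac_kernel \<beta> t) \<partial>lborel)" .
  have "ennreal (\<xi> powr (\<beta> - 1)) = ennreal (1 / (\<xi> * (\<xi> powr (- \<beta>) * Gamma (1 - \<beta>)))) * ennreal (Gamma (1 - \<beta>))"
    using \<xi> G by (subst ennreal_mult[symmetric]) (auto simp: powr_diff powr_minus field_simps)
  also have "\<dots> = ennreal (1 / (\<xi> * (\<xi> powr (- \<beta>) * Gamma (1 - \<beta>))) * (\<xi> * (\<xi> powr (- \<beta>) * Gamma (1 - \<beta>)))) * (\<integral>\<^sup>+ t. ennreal (exp (- \<xi> * t) * frac_kernel \<beta> t) \<partial>lborel)"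
    using \<xi> G by (subst *, subst ennreal_mult) (auto simp: mult.assoc)
  also have "1 / (\<xi> * (\<xi> powr (- \<beta>) * Gamma (1 - \<beta>))) * (\<xi> * (\<xi> powr (- \<beta>) * Gamma (1 - \<beta>))) = 1"
    using \<xi> G by simp
  finally show ?thesis by simp
qed

lemma has_laplace_frac_kernel:
  assumes \<beta>: "\<beta> < 1"
  shows "has_laplace (frac_kernel \<beta>)" and "\<xi> > 0 \<Longrightarrow> laplace (frac_kernel \<beta>) \<xi> = \<xi> powr (\<beta> - 1)"
proof -
  have *: "has_bochner_integral lborel (\<lambda>t. exp (- \<xi> * t) * frac_kernel \<beta> t) (\<xi> powr (\<beta> - 1))" if "\<xi> > 0" for \<xi>
    by (rule has_bochner_integral_nn_integral)
      (use nn_integral_frac_kernel[OF \<beta> that] in \<open>auto intro!: AE_I2 mult_nonneg_nonneg frac_kernel_nonneg \<beta>\<close>)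
  thus "has_laplace (frac_kernel \<beta>)" "\<xi> > 0 \<Longrightarrow> laplace (frac_kernel \<beta>) \<xi> = \<xi> powr (\<beta> - 1)"
    by (auto simp: has_laplace_def laplace_def has_bochner_integral_iff frac_kernel_def)
qed

text \<open>Reflection of \<open>s\<close> to \<open>t - s\<close>. At the singular endpoint both
  integrands take the value 0: by division by zero in the fractional integral, by definition of the
  kernel in the convolution.\<close>

lemma frac_integral_eq_conv:
  assumes "\<And>t. t < 0 \<Longrightarrow> U t = 0"
  shows "frac_integral \<beta> U = conv (frac_kernel \<beta>) U"
proof
  fix t
  have "frac_integral \<beta> U t = 1 / Gamma (1 - \<beta>) * (\<integral>s. indicator {0..t} s * (U s / (t - s) powr \<beta>) \<partial>lborel)"
    by (simp add: frac_integral_def set_lebesgue_integral_def)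
  also have "\<dots> = 1 / Gamma (1 - \<beta>) * (\<integral>s. (indicator {0..t} (t + (-1) * s) * (U (t + (-1) * s) / (t - (t + (-1) * s)) powr \<beta>)) \<partial>lborel)"
    by (subst lborel_integral_real_affine[of "-1" _ t]) auto
  also have "\<dots> = conv (frac_kernel \<beta>) U t"
    unfolding conv_def integral_mult_right_zero[symmetric]
    by (intro Bochner_Integration.integral_cong)
      (auto simp: frac_kernel_def indicator_def assms powr_minus field_simps)
  finally show "frac_integral \<beta> U t = conv (frac_kernel \<beta>) U t" .
qed

section \<open>Fractional differences of causal functions\<close>

lemma unit_shift_funpow: "(unit_shift ^^ j) U t = U (t - real j)"
  by (induction j arbitrary: t) (auto simp: unit_shift_def algebra_simps)

text \<open>Causality cuts the series off at \<open>j > t\<close>. There is no question of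
  convergence, and one and the same finite sum represents the difference at all times below
  \<open>n\<close>, which makes continuity a matter of finite sums.\<close>

lemma frac_difference_eq_sum:
  assumes "\<And>t. t < 0 \<Longrightarrow> U t = 0" and "t < real n"
  shows "frac_difference \<gamma> U t = (\<Sum>j<n. (-1) ^ j * (\<gamma> gchoose j) * U (t - real j))"
  unfolding frac_difference_def unit_shift_funpow
  by (rule suminf_finite) (use assms in auto)

lemma frac_difference_diff:
  assumes "\<And>t. t < 0 \<Longrightarrow> U t = 0" and "\<And>t. t < 0 \<Longrightarrow> V t = 0"
  shows "frac_difference \<gamma> (\<lambda>t. U t - c * V t) t = frac_difference \<gamma> U t - c * frac_difference \<gamma> V t"
proof -
  obtain n :: nat where "t < real n" using reals_Archimedean2 by blast
  thus ?thesis
    using assms by (simp add: frac_difference_eq_sum[where n = n] algebra_simps sum_subtractf sum_distrib_left)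
qed

text \<open>A delay by \<open>j\<close> multiplies the transform by
  \<open>exp (- \<xi>) ^ j\<close>, and what remains is the binomial series of
  \<open>(1 - exp (- \<xi>)) powr \<gamma>\<close>. Its absolute convergence allows sum and integral
  to be exchanged.\<close>

lemma has_laplace_frac_difference:
  assumes U: "has_laplace U"
  shows "has_laplace (frac_difference \<gamma> U)"
    and "\<xi> > 0 \<Longrightarrow> laplace (frac_difference \<gamma> U) \<xi> = (1 - exp (- \<xi>)) powr \<gamma> * laplace U \<xi>"
proof -
  note causal = has_laplaceD(1)[OF U]
  define c where "c j = (-1) ^ j * (\<gamma> gchoose j)" for j :: nat
  have main: "integrable lborel (\<lambda>t. exp (- \<xi> * t) * frac_difference \<gamma> U t) \<and>
      (\<integral>t. exp (- \<xi> * t) * frac_difference \<gamma> U t \<partial>lborel) = (1 - exp (- \<xi>)) powr \<gamma> * laplace U \<xi>"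
    if \<xi>: "\<xi> > 0" for \<xi>
  proof -
    define I where "I = (\<integral>t. norm (exp (- \<xi> * t) * U t) \<partial>lborel)"
    define f where "f j t = c j * exp (- \<xi> * real j) * (exp (- \<xi> * (t - real j)) * U (t - real j))" for j t
    have f_eq: "f j t = exp (- \<xi> * t) * (c j * U (t - real j))" for j t
      by (simp add: f_def right_diff_distrib exp_diff exp_minus field_simps)
    have int: "integrable lborel (f j)" "(\<integral>t. f j t \<partial>lborel) = c j * exp (- \<xi>) ^ j * laplace U \<xi>"
      "(\<integral>t. norm (f j t) \<partial>lborel) = norm (c j * exp (- \<xi>) ^ j) * I" for j
    proof -
      have e: "exp (- \<xi> * real j) = exp (- \<xi>) ^ j"
        by (simp add: exp_of_nat_mult[symmetric] mult.commute)
      note aff = lborel_integrable_real_affine[OF has_laplaceD(2)[OF U \<xi>], of 1 "- real j"]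
        lborel_integral_real_affine[of 1 "\<lambda>t. exp (- \<xi> * t) * U t" "- real j"]
        lborel_integral_real_affine[of 1 "\<lambda>t. norm (exp (- \<xi> * t) * U t)" "- real j"]
      have aff': "integrable lborel (\<lambda>t. exp (- \<xi> * (t - real j)) * U (t - real j))"
        "(\<integral>t. exp (- \<xi> * (t - real j)) * U (t - real j) \<partial>lborel) = laplace U \<xi>"
        "(\<integral>t. norm (exp (- \<xi> * (t - real j)) * U (t - real j)) \<partial>lborel) = I"
        using aff unfolding laplace_def I_def by simp_all
      show "integrable lborel (f j)" unfolding f_def using aff'(1) by (rule integrable_mult_right)
      show "(\<integral>t. f j t \<partial>lborel) = c j * exp (- \<xi>) ^ j * laplace U \<xi>"
        unfolding f_def by (simp only: integral_mult_right_zero aff'(2) e)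
      show "(\<integral>t. norm (f j t) \<partial>lborel) = norm (c j * exp (- \<xi>) ^ j) * I"
        unfolding f_def norm_mult[of "c j * _"] by (simp only: integral_mult_right_zero aff'(3) e)
    qed
    have binom: "(\<lambda>j. c j * z ^ j) sums (1 - z) powr \<gamma>" if "\<bar>z\<bar> < 1" for z
      using gen_binomial_real[of "- z" \<gamma>] that
      by (simp add: c_def power_minus[of z] mult_ac)
    \<comment> \<open>The binomial series converges at \<open>z\<close>, hence absolutely at the
      smaller point \<open>exp (- \<xi>)\<close>.\<close>
    obtain z where z: "exp (- \<xi>) < z" "z < 1"
      using dense[of "exp (- \<xi>)" 1] \<xi> by auto
    have "0 < z" using z(1) less_trans[OF exp_gt_zero] by blast
    hence "summable (\<lambda>j. norm (c j * exp (- \<xi>) ^ j))"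
      using powser_insidea[OF sums_summable[OF binom[of z]], of "exp (- \<xi>)"] z by simp
    hence summ: "summable (\<lambda>j. \<integral>t. norm (f j t) \<partial>lborel)"
      unfolding int(3) by (rule summable_mult2)
    have summ_pt: "summable (\<lambda>j. norm (f j t))" for t
    proof -
      obtain n :: nat where n: "t < real n" using reals_Archimedean2 by blast
      have "norm (f j t) = 0" if "j \<ge> n" for j
        unfolding f_eq using causal[of "t - real j"] that n by simp
      thus ?thesis by (intro summable_finite[of "{..<n}"]) auto
    qed
    have suminf_f: "(\<Sum>j. f j t) = exp (- \<xi> * t) * frac_difference \<gamma> U t" for t
    proof -
      have "summable (\<lambda>j. f j t)" using summ_pt by (rule summable_norm_cancel)
      hence "summable (\<lambda>j. exp (\<xi> * t) * f j t)" by (rule summable_mult)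
      hence "summable (\<lambda>j. c j * U (t - real j))"
        unfolding f_eq by (simp add: mult.assoc[symmetric] exp_add[symmetric])
      thus ?thesis
        unfolding f_eq frac_difference_def unit_shift_funpow c_def by (rule suminf_mult)
    qed
    have "integrable lborel (\<lambda>t. \<Sum>j. f j t)"
      by (rule integrable_suminf) (use int(1) summ summ_pt in auto)
    moreover have "(\<lambda>j. \<integral>t. f j t \<partial>lborel) sums (\<integral>t. (\<Sum>j. f j t) \<partial>lborel)"
      by (rule sums_integral) (use int(1) summ summ_pt in auto)
    moreover have "(\<lambda>j. \<integral>t. f j t \<partial>lborel) sums ((1 - exp (- \<xi>)) powr \<gamma> * laplace U \<xi>)"
      unfolding int(2) using \<xi> by (intro sums_mult2 binom) simp
    ultimately show ?thesis
      unfolding suminf_f using sums_unique2 by blast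
  qed
  have "frac_difference \<gamma> U t = 0" if "t < 0" for t
    using frac_difference_eq_sum[of U t 0 \<gamma>] causal that by simp
  thus "has_laplace (frac_difference \<gamma> U)"
    "\<xi> > 0 \<Longrightarrow> laplace (frac_difference \<gamma> U) \<xi> = (1 - exp (- \<xi>)) powr \<gamma> * laplace U \<xi>"
    using main by (auto simp: has_laplace_def laplace_def)
qed

lemma frac_difference_continuous:
  assumes "\<And>t. t < 0 \<Longrightarrow> U t = 0" and "continuous_on UNIV U"
  shows "continuous_on UNIV (frac_difference \<gamma> U)"
proof -
  have "isCont (frac_difference \<gamma> U) t" for t
  proof -
    obtain n :: nat where n: "t < real n" using reals_Archimedean2 by blast
    have [simp]: "isCont U s" for s using assms(2) by (simp add: continuous_on_eq_continuous_at)
    have "isCont (\<lambda>t. \<Sum>j<n. (-1) ^ j * (\<gamma> gchoose j) * U (t - real j)) t"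
      by (intro continuous_intros isCont_o2[of _ "\<lambda>t. t - real _" U]) auto
    moreover have "eventually (\<lambda>s. s < real n) (nhds t)"
      using eventually_nhds_in_open[of "{..<real n}" t] n by simp
    hence "eventually (\<lambda>s. frac_difference \<gamma> U s = (\<Sum>j<n. (-1) ^ j * (\<gamma> gchoose j) * U (s - real j))) (nhds t)"
      by eventually_elim (rule frac_difference_eq_sum, use assms in auto)
    ultimately show ?thesis by (simp add: isCont_cong)
  qed
  thus ?thesis by (simp add: continuous_on_eq_continuous_at)
qed

lemma right_continuous_shift:
  fixes U :: "real \<Rightarrow> real"
  assumes causal: "\<And>t. t < 0 \<Longrightarrow> U t = 0" and rc: "\<And>t. t \<ge> 0 \<Longrightarrow> continuous (at_right t) U"
    and X: "\<And>n. t < X n" "X \<longlonglongrightarrow> t"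
  shows "(\<lambda>k. U (X k - s)) \<longlonglongrightarrow> U (t - s)"
proof (cases "t - s \<ge> 0")
  case True
  show ?thesis
    by (rule right_cont_tendsto[OF rc[OF True]]) (use X in \<open>auto intro!: tendsto_intros\<close>)
next
  case False
  hence "eventually (\<lambda>k. X k < s) sequentially"
    using order_tendstoD(2)[OF X(2)] by simp
  hence "eventually (\<lambda>k. U (X k - s) = U (t - s)) sequentially"
    by eventually_elim (use False causal in auto)
  thus ?thesis by (rule tendsto_eventually)
qed

lemma frac_difference_right_continuous:
  assumes causal: "\<And>t. t < 0 \<Longrightarrow> U t = 0" and rc: "\<And>t. t \<ge> 0 \<Longrightarrow> continuous (at_right t) U"
  shows "continuous (at_right t) (frac_difference \<gamma> U)"
proof (rule continuous_at_rightI_sequentially)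
  fix X assume X: "\<And>n. t < X n" "X \<longlonglongrightarrow> t"
  obtain n :: nat where n: "t < real n" using reals_Archimedean2 by blast
  have "(\<lambda>k. U (X k - s)) \<longlonglongrightarrow> U (t - s)" for s
    by (rule right_continuous_shift[OF causal rc X])
  hence "(\<lambda>k. \<Sum>j<n. (-1) ^ j * (\<gamma> gchoose j) * U (X k - real j))
      \<longlonglongrightarrow> (\<Sum>j<n. (-1) ^ j * (\<gamma> gchoose j) * U (t - real j))"
    by (intro tendsto_intros)
  moreover have "eventually (\<lambda>k. X k < real n) sequentially"
    using order_tendstoD(2)[OF X(2) n] .
  hence "eventually (\<lambda>k. (\<Sum>j<n. (-1) ^ j * (\<gamma> gchoose j) * U (X k - real j)) = frac_difference \<gamma> U (X k)) sequentially"
    by eventually_elim (rule frac_difference_eq_sum[symmetric], use causal in auto)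
  ultimately have "(\<lambda>k. frac_difference \<gamma> U (X k))
      \<longlonglongrightarrow> (\<Sum>j<n. (-1) ^ j * (\<gamma> gchoose j) * U (t - real j))"
    by (rule Lim_transform_eventually)
  also have "(\<Sum>j<n. (-1) ^ j * (\<gamma> gchoose j) * U (t - real j)) = frac_difference \<gamma> U t"
    by (rule frac_difference_eq_sum[symmetric]) (use causal n in auto)
  finally show "(\<lambda>k. frac_difference \<gamma> U (X k)) \<longlonglongrightarrow> frac_difference \<gamma> U t" .
qed

text \<open>The prescribed series is the binomial series of the fractional difference applied to the
  Heaviside function: \<open>Gamma (1 - \<gamma>) = - \<gamma> * Gamma (- \<gamma>)\<close>, and
  \<open>Gamma (k - \<gamma>) / Gamma (- \<gamma>)\<close> is a Pochhammer symbol, so the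
  coefficients become \<open>(-1) ^ k * (\<gamma> gchoose k)\<close>. For
  \<open>\<gamma> = 1\<close> only two of them survive.\<close>

lemma boundary_value_eq_frac_difference:
  assumes \<gamma>: "0 < \<gamma>" "\<gamma> \<le> 1"
  shows "rate > 0 \<Longrightarrow> boundary_value \<gamma> rate t = rate powr \<gamma> * frac_difference \<gamma> heaviside t"
proof (cases "\<gamma> = 1")
  case True
  assume "rate > 0"
  obtain n :: nat where "t < real n" using reals_Archimedean2 by blast
  \<comment> \<open>Two terms are guaranteed, so that \<open>j = 0\<close> and \<open>j = 1\<close>
    can be split off.\<close>
  hence n: "t < real (Suc (Suc n))" by simp
  have "(1::real) gchoose (Suc (Suc j)) = 0" for j
    using binomial_gbinomial[of 1 "Suc (Suc j)", where 'a = real] by (simp add: binomial_eq_0)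
  hence "frac_difference 1 heaviside t = heaviside t - heaviside (t - 1)"
    by (subst frac_difference_eq_sum[OF _ n])
      (auto simp: heaviside_def sum.lessThan_Suc_shift simp del: sum.lessThan_Suc)
  thus ?thesis using True \<open>rate > 0\<close> by (simp add: boundary_value_def)
next
  case False
  hence \<gamma>': "0 < \<gamma>" "\<gamma> < 1" using \<gamma> by auto
  obtain n :: nat where n: "t < real n" using reals_Archimedean2 by blast
  \<comment> \<open>\<open>- \<gamma>\<close> is negative but lies strictly between -1 and 0, away
    from the poles of \<open>Gamma\<close>.\<close>
  have nz: "- \<gamma> \<notin> \<int>\<^sub>\<le>\<^sub>0" "1 - \<gamma> \<notin> \<int>\<^sub>\<le>\<^sub>0"
  proof -
    have "False" if "- \<gamma> = real_of_int n" for n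
    proof -
      have "real_of_int (- 1) < real_of_int n" "real_of_int n < real_of_int 0"
        using \<gamma>' that by simp_all
      thus False unfolding of_int_less_iff by simp
    qed
    thus "- \<gamma> \<notin> \<int>\<^sub>\<le>\<^sub>0" by (auto elim!: nonpos_Ints_cases)
    show "1 - \<gamma> \<notin> \<int>\<^sub>\<le>\<^sub>0" using \<gamma>' by (auto elim!: nonpos_Ints_cases)
  qed
  have coeff: "- (\<gamma> / Gamma (1 - \<gamma>)) * (Gamma (real k - \<gamma>) / fact k) = (-1) ^ k * (\<gamma> gchoose k)" for k
  proof -
    have "Gamma (1 - \<gamma>) = - \<gamma> * Gamma (- \<gamma>)"
      using Gamma_plus1[of "- \<gamma>"] nz(1) by (simp add: add.commute)
    moreover have "Gamma (1 - \<gamma>) \<noteq> 0" using nz(2) by (simp add: Gamma_eq_zero_iff)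
    moreover have "(-1) ^ k * (\<gamma> gchoose k) = pochhammer (- \<gamma>) k / fact k"
      by (simp add: gbinomial_pochhammer mult.assoc[symmetric] power_mult_distrib[symmetric])
    moreover have "pochhammer (- \<gamma>) k = Gamma (- \<gamma> + real k) / Gamma (- \<gamma>)"
      using pochhammer_Gamma[of "- \<gamma>" k] nz(1) by simp
    ultimately show ?thesis using \<gamma>' by (simp add: field_simps)
  qed
  have "(\<Sum>k. Gamma (real k - \<gamma>) / fact k * heaviside (t - real k)) = (\<Sum>k<n. Gamma (real k - \<gamma>) / fact k * heaviside (t - real k))"
    by (rule suminf_finite) (use n in \<open>auto simp: heaviside_def\<close>)
  hence "boundary_value \<gamma> rate t = rate powr \<gamma> * (\<Sum>k<n. - (\<gamma> / Gamma (1 - \<gamma>)) * (Gamma (real k - \<gamma>) / fact k) * heaviside (t - real k))"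
    using False by (simp add: boundary_value_def sum_distrib_left mult_ac)
  also have "\<dots> = rate powr \<gamma> * frac_difference \<gamma> heaviside t"
    unfolding coeff by (subst frac_difference_eq_sum[OF _ n]) (auto simp: heaviside_def)
  finally show ?thesis .
qed

section \<open>Test functions\<close>

lemma test_functionI:
  assumes "\<And>x. (f has_real_derivative f' x) (at x)" and "continuous_on UNIV f'"
    and "\<And>x. \<bar>x\<bar> > R \<Longrightarrow> f x = 0"
  shows "test_function f"
  unfolding test_function_def
proof
  show "f C1_differentiable_on UNIV"
    unfolding C1_differentiable_on_def
    using assms(1,2) by (auto simp: has_real_derivative_iff_has_vector_derivative)
  have "{x. f x \<noteq> 0} \<subseteq> {-R..R}"
    using assms(3) by (force simp: abs_le_iff not_less[symmetric])
  hence "bounded {x. f x \<noteq> 0}" by (rule bounded_subset[OF bounded_closed_interval])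
  thus "compact (closure {x. f x \<noteq> 0})" by (simp add: compact_closure)
qed

lemma test_functionD:
  assumes "test_function f"
  shows "(f has_real_derivative deriv f x) (at x)" and "continuous_on UNIV (deriv f)"
proof -
  obtain D where D: "\<And>x. (f has_real_derivative D x) (at x)" "continuous_on UNIV D"
    using assms unfolding test_function_def C1_differentiable_on_def
    by (auto simp: has_real_derivative_iff_has_vector_derivative)
  hence "deriv f = D" by (auto intro: DERIV_imp_deriv)
  with D show "(f has_real_derivative deriv f x) (at x)" "continuous_on UNIV (deriv f)" by auto
qed

lemma test_function_support:
  assumes "test_function f"
  obtains R where "R > 0" "\<And>x. \<bar>x\<bar> > R \<Longrightarrow> f x = 0"
proof -
  have "bounded {x. f x \<noteq> 0}"
    using assms by (auto simp: test_function_def compact_closure)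
  then obtain R where "\<And>x. f x \<noteq> 0 \<Longrightarrow> \<bar>x\<bar> \<le> R" by (auto simp: bounded_iff)
  thus ?thesis by (intro that[of "\<bar>R\<bar> + 1"]) force+
qed

lemma test_function_continuous: "test_function f \<Longrightarrow> continuous_on UNIV f"
  by (meson DERIV_continuous_on UNIV_I test_functionD(1) DERIV_subset subset_UNIV)

lemma test_function_measurable [measurable_dest]: "test_function f \<Longrightarrow> f \<in> borel_measurable borel"
  by (intro borel_measurable_continuous_onI test_function_continuous)

lemma deriv_test_function_measurable: "test_function f \<Longrightarrow> deriv f \<in> borel_measurable borel"
  by (intro borel_measurable_continuous_onI test_functionD(2))

lemma test_function_bounded:
  assumes f: "test_function f"
  shows "\<exists>K>0. (\<forall>x. \<bar>f x\<bar> \<le> K) \<and> (\<forall>x. \<bar>deriv f x\<bar> \<le> K)"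
proof -
  obtain R where R: "R > 0" "\<And>x. \<bar>x\<bar> > R \<Longrightarrow> f x = 0" using test_function_support[OF f] by blast
  have R': "deriv f x = 0" if "\<bar>x\<bar> > R" for x
  proof -
    have "(f has_real_derivative 0) (at x) \<longleftrightarrow> ((\<lambda>_. 0) has_real_derivative 0) (at x)"
    proof (rule DERIV_cong_ev[OF refl _ refl])
      have "open {x. \<bar>x\<bar> > R}" by (intro open_Collect_less continuous_intros)
      thus "\<forall>\<^sub>F y in nhds x. f y = 0"
        using that R(2) by (auto simp: eventually_nhds)
    qed
    thus ?thesis by (auto intro: DERIV_imp_deriv)
  qed
  have "\<exists>K. \<forall>x. \<bar>k x\<bar> \<le> K" if "continuous_on UNIV k" "\<And>x. \<bar>x\<bar> > R \<Longrightarrow> k x = 0" for k :: "real \<Rightarrow> real"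
  proof -
    have "bounded (k ` {-R..R})"
      by (intro compact_imp_bounded compact_continuous_image continuous_on_subset[OF that(1)]) auto
    then obtain K where "\<And>x. x \<in> {-R..R} \<Longrightarrow> \<bar>k x\<bar> \<le> K"
      by (auto simp: bounded_iff simp del: atLeastAtMost_iff)
    hence "\<bar>k x\<bar> \<le> \<bar>K\<bar>" if "\<bar>x\<bar> \<le> R" for x
      by (rule order_trans[OF _ abs_ge_self]) (use that in \<open>auto simp: abs_le_iff\<close>)
    hence "\<bar>k x\<bar> \<le> \<bar>K\<bar>" for x using that(2)[of x] by (cases "\<bar>x\<bar> > R") auto
    thus ?thesis by blast
  qed
  from this[OF test_function_continuous[OF f] R(2)] this[OF test_functionD(2)[OF f] R']
  obtain K1 K2 where K: "\<And>x. \<bar>f x\<bar> \<le> K1" "\<And>x. \<bar>deriv f x\<bar> \<le> K2" by auto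
  have "\<bar>f x\<bar> \<le> \<bar>K1\<bar> + \<bar>K2\<bar> + 1" "\<bar>deriv f x\<bar> \<le> \<bar>K1\<bar> + \<bar>K2\<bar> + 1" for x
    using K[of x] by linarith+
  thus ?thesis by (intro exI[of _ "\<bar>K1\<bar> + \<bar>K2\<bar> + 1"]) auto
qed

text \<open>Serves to approximate \<open>deriv f\<close>, which is continuous but need not be a test
  function.\<close>

lemma test_function_difference_quotient:
  assumes f: "test_function f"
  shows "test_function (\<lambda>x. c * (f (x + d) - f x))"
proof -
  obtain R where R: "R > 0" "\<And>x. \<bar>x\<bar> > R \<Longrightarrow> f x = 0" using test_function_support[OF f] by blast
  show ?thesis
  proof (rule test_functionI[where R = "R + \<bar>d\<bar>"])
    show "((\<lambda>x. c * (f (x + d) - f x)) has_real_derivative c * (deriv f (x + d) - deriv f x)) (at x)" for x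
      by (auto intro!: derivative_eq_intros test_functionD(1)[OF f] DERIV_chain2[OF test_functionD(1)[OF f]])
    show "continuous_on UNIV (\<lambda>x. c * (deriv f (x + d) - deriv f x))"
      by (intro continuous_intros continuous_on_compose2[OF test_functionD(2)[OF f]]) auto
  qed (use R in auto)
qed

text \<open>The squared positive part is continuously differentiable across 0; the explicit cut-off
  functions below are built from it.\<close>

lemma has_derivative_max_0_sq: "((\<lambda>x::real. (max 0 x)\<^sup>2) has_real_derivative 2 * max 0 x) (at x)"
proof (cases x "0::real" rule: linorder_cases)
  case less
  have "((\<lambda>x::real. (max 0 x)\<^sup>2) has_real_derivative 0) (at x) \<longleftrightarrow> ((\<lambda>_::real. 0) has_real_derivative 0) (at x)"
    by (rule DERIV_cong_ev[OF refl _ refl])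
      (use less eventually_nhds_in_open[of "{..<0}" x] in \<open>auto elim!: eventually_mono\<close>)
  thus ?thesis using less by simp
next
  case greater
  have "((\<lambda>x::real. (max 0 x)\<^sup>2) has_real_derivative 2 * x) (at x) \<longleftrightarrow> ((\<lambda>x::real. x\<^sup>2) has_real_derivative 2 * x) (at x)"
    by (rule DERIV_cong_ev[OF refl _ refl])
      (use greater eventually_nhds_in_open[of "{0<..}" x] in \<open>auto elim!: eventually_mono\<close>)
  moreover have "((\<lambda>x::real. x\<^sup>2) has_real_derivative 2 * x) (at x)"
    by (auto intro!: derivative_eq_intros)
  ultimately show ?thesis using greater by simp
next
  case equal
  have "((\<lambda>h. (max 0 h)\<^sup>2 / h) \<longlongrightarrow> 0) (at (0::real))"
  proof (rule Lim_null_comparison[where g = "\<lambda>h. \<bar>h\<bar>"])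
    show "\<forall>\<^sub>F h in at (0::real). norm ((max 0 h)\<^sup>2 / h) \<le> \<bar>h\<bar>"
      by (intro always_eventually) (auto simp: max_def power2_eq_square)
    show "((\<lambda>h. \<bar>h\<bar>) \<longlongrightarrow> 0) (at (0::real))"
      using tendsto_rabs[OF tendsto_ident_at, of "0::real" UNIV] by simp
  qed
  thus ?thesis using equal by (simp add: DERIV_def)
qed

text \<open>The indicator of a half-line is a bounded pointwise limit of test functions, and the
  values on half-lines determine a finite measure.\<close>

lemma measure_eq_by_test_functions:
  fixes \<mu> \<nu> :: "real measure"
  assumes \<mu>: "finite_measure \<mu>" "sets \<mu> = sets borel" and \<nu>: "finite_measure \<nu>" "sets \<nu> = sets borel"
    and eq: "\<And>f. test_function f \<Longrightarrow> (\<integral>x. f x \<partial>\<mu>) = (\<integral>x. f x \<partial>\<nu>)"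
  shows "\<mu> = \<nu>"
proof (rule measure_eqI_lessThan[OF \<mu>(2) \<nu>(2)])
  interpret \<mu>: finite_measure \<mu> by fact
  interpret \<nu>: finite_measure \<nu> by fact
  note [measurable_cong] = \<mu>(2) \<nu>(2)
  have space: "space \<mu> = UNIV" "space \<nu> = UNIV"
    using sets_eq_imp_space_eq[OF \<mu>(2)] sets_eq_imp_space_eq[OF \<nu>(2)] by simp_all
  fix a :: real
  show "emeasure \<mu> {a<..} < \<infinity>" by (simp add: less_top[symmetric])
  \<comment> \<open>\<open>w n\<close> is positive exactly on \<open>{a<..<a + n}\<close>, so
    \<open>q n\<close> is continuously differentiable with compact support. The function
    \<open>f n = q n / (1 + q n)\<close> inherits this, stays in \<open>{0..1}\<close>, and tends to
    1 where \<open>q n\<close> tends to infinity.\<close>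
  define w where "w n x = (x - a) * (a + real n - x)" for n x
  define q where "q n x = real n * (max 0 (w n x))\<^sup>2" for n x
  define f where "f n x = 1 - 1 / (1 + q n x)" for n x
  have q_nonneg: "q n x \<ge> 0" for n x by (simp add: q_def)
  have [measurable]: "f n \<in> borel_measurable borel" for n
    unfolding f_def[abs_def] q_def w_def by measurable
  have test: "test_function (f n)" for n
  proof (rule test_functionI[where R = "\<bar>a\<bar> + real n"])
    define q' where "q' x = real n * (2 * max 0 (w n x) * (2 * a + real n - 2 * x))" for x
    have "(w n has_real_derivative 2 * a + real n - 2 * x) (at x)" for x
      unfolding w_def[abs_def] by (auto intro!: derivative_eq_intros)
    hence "(q n has_real_derivative q' x) (at x)" for x
      unfolding q_def[abs_def] q'_def
      by (intro DERIV_cmult DERIV_chain2[OF has_derivative_max_0_sq])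
    hence "(f n has_real_derivative q' x / (1 + q n x)\<^sup>2) (at x)" for x
      unfolding f_def[abs_def] using q_nonneg[of n x]
      by (auto intro!: derivative_eq_intros simp: power2_eq_square add_nonneg_eq_0_iff)
    thus "(f n has_real_derivative q' x / (1 + q n x)\<^sup>2) (at x)" for x .
    have "1 + q n x \<noteq> 0" for x using q_nonneg[of n x] by linarith
    thus "continuous_on UNIV (\<lambda>x. q' x / (1 + q n x)\<^sup>2)"
      unfolding q'_def q_def w_def by (intro continuous_intros) auto
    show "f n x = 0" if "\<bar>x\<bar> > \<bar>a\<bar> + real n" for x
    proof -
      have "w n x \<le> 0"
      proof (cases "x \<ge> 0")
        case True
        hence "0 \<le> x - a" "a + real n - x \<le> 0" using that by linarith+
        thus ?thesis unfolding w_def by (rule mult_nonneg_nonpos)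
      next
        case False
        hence "x - a \<le> 0" "0 \<le> a + real n - x" using that by linarith+
        thus ?thesis unfolding w_def by (rule mult_nonpos_nonneg)
      qed
      thus ?thesis by (simp add: f_def q_def)
    qed
  qed
  have lim: "(\<lambda>n. f n x) \<longlonglongrightarrow> indicat_real {a<..} x" for x
  proof (cases "x > a")
    case False
    hence "w n x \<le> 0" for n unfolding w_def by (intro mult_nonpos_nonneg) auto
    hence "f n x = 0" for n by (simp add: f_def q_def)
    thus ?thesis using False by simp
  next
    case True
    have "filterlim (\<lambda>n. q n x) at_top sequentially"
    proof (rule filterlim_at_top_mono[where f = "\<lambda>n. (x - a)\<^sup>2 * real n"])
      show "filterlim (\<lambda>n. (x - a)\<^sup>2 * real n) at_top sequentially"
        using True by (intro filterlim_tendsto_pos_mult_at_top[OF tendsto_const] filterlim_real_sequentially) auto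
      show "\<forall>\<^sub>F n in sequentially. (x - a)\<^sup>2 * real n \<le> q n x"
        using eventually_ge_at_top[of "nat \<lceil>x - a + 1\<rceil>"]
      proof eventually_elim
        case (elim n)
        hence "1 \<le> a + real n - x" by linarith
        hence "(x - a) * 1 \<le> w n x" unfolding w_def using True by (intro mult_left_mono) auto
        hence "(x - a)\<^sup>2 \<le> (max 0 (w n x))\<^sup>2" using True by (intro power_mono) auto
        thus ?case unfolding q_def by (simp add: mult.commute mult_left_mono)
      qed
    qed
    hence "filterlim (\<lambda>n. 1 + q n x) at_infinity sequentially"
      by (intro filterlim_at_top_imp_at_infinity filterlim_tendsto_add_at_top[OF tendsto_const])
    hence "(\<lambda>n. 1 / (1 + q n x)) \<longlonglongrightarrow> 0"
      by (intro tendsto_divide_0[OF tendsto_const])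
    hence "(\<lambda>n. 1 - 1 / (1 + q n x)) \<longlonglongrightarrow> 1 - 0" by (intro tendsto_intros)
    thus ?thesis using True by (simp add: f_def)
  qed
  have bd: "norm (f n x) \<le> 1" for n x
    using q_nonneg[of n x] by (auto simp: f_def field_simps)
  have "(\<lambda>n. \<integral>x. f n x \<partial>\<mu>) \<longlonglongrightarrow> (\<integral>x. indicat_real {a<..} x \<partial>\<mu>)"
    by (rule integral_dominated_convergence[where w = "\<lambda>_. 1"]) (use lim bd in auto)
  moreover have "(\<lambda>n. \<integral>x. f n x \<partial>\<nu>) \<longlonglongrightarrow> (\<integral>x. indicat_real {a<..} x \<partial>\<nu>)"
    by (rule integral_dominated_convergence[where w = "\<lambda>_. 1"]) (use lim bd in auto)
  ultimately have "(\<integral>x. indicat_real {a<..} x \<partial>\<mu>) = (\<integral>x. indicat_real {a<..} x \<partial>\<nu>)"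
    unfolding eq[OF test] by (rule LIMSEQ_unique)
  thus "emeasure \<mu> {a<..} = emeasure \<nu> {a<..}"
    by (simp add: space \<mu>.emeasure_eq_measure \<nu>.emeasure_eq_measure)
qed

text \<open>The solution of \<open>h' - c * h = f\<close> that vanishes beyond the support of
  \<open>f\<close> is \<open>- exp (c * x)\<close> times the integral of
  \<open>exp (- c * y) * f y\<close> over \<open>y > x\<close>. To the left it need not have compact
  support, so it is cut off there; only \<open>x \<ge> 0\<close> counts, because the measures in
  question live on the half-line.\<close>

lemma test_function_resolvent:
  fixes c :: real
  assumes f: "test_function f"
  obtains h where "test_function h" "\<And>x. x \<ge> 0 \<Longrightarrow> f x = deriv h x - c * h x"
proof -
  obtain R where R: "R > 0" "\<And>x. \<bar>x\<bar> > R \<Longrightarrow> f x = 0" using test_function_support[OF f] by blast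
  define k where "k y = exp (- c * y) * f y" for y
  have k_cont: "continuous_on S k" for S
    unfolding k_def using continuous_on_subset[OF test_function_continuous[OF f], of S]
    by (intro continuous_intros) auto
  \<comment> \<open>The base point -2 lies below -1, where the cut-off has already reached 0. This
    leaves an open overlap between the region \<open>x > -2\<close>, on which \<open>G\<close> is a
    primitive, and the region on which \<open>h\<close> vanishes.\<close>
  define G where "G x = integral {-2..x} k" for x
  have G: "(G has_real_derivative k x) (at x)" if "x > -2" for x
  proof -
    have "(G has_real_derivative k x) (at x within {-2..x+1})"
      unfolding G_def by (rule integral_has_real_derivative[OF k_cont]) (use that in auto)
    thus ?thesis using that by (simp add: at_within_Icc_at)
  qed
  have G_const: "G x = G R" if "x \<ge> R" for x
  proof -
    have "integral {-2..R} k + integral {R..x} k = integral {-2..x} k"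
      by (rule Henstock_Kurzweil_Integration.integral_combine)
        (use that R(1) in \<open>auto intro!: integrable_continuous_real k_cont\<close>)
    moreover have "integral {R..x} k = integral {R..x} (\<lambda>_. 0)"
      by (rule integral_spike[of "{R}"]) (use R in \<open>auto simp: k_def\<close>)
    ultimately show ?thesis by (simp add: G_def)
  qed
  \<comment> \<open>The quotient \<open>p / r\<close> is the cut-off: it is 0 for
    \<open>x \<le> -1\<close> and 1 for \<open>x \<ge> 0\<close>, and the two squares in
    \<open>r\<close> have no common zero.\<close>
  define p where "p x = (max 0 (x + 1))\<^sup>2" for x :: real
  define r where "r x = p x + (max 0 (- x))\<^sup>2" for x :: real
  have r_pos: "r x > 0" for x
    unfolding r_def p_def by (cases "x > -1") (auto intro: add_pos_nonneg)
  define e where "e x = exp (c * x) * (G x - G R)" for x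
  define h where "h x = p x / r x * e x" for x
  define p' where "p' x = 2 * max 0 (x + 1)" for x :: real
  define r' where "r' x = p' x - 2 * max 0 (- x)" for x :: real
  have "((\<lambda>x. (max 0 (x + 1))\<^sup>2) has_real_derivative 2 * max 0 (x + 1) * 1) (at x)" for x :: real
    by (rule DERIV_chain2[OF has_derivative_max_0_sq]) (auto intro!: derivative_eq_intros)
  hence p: "(p has_real_derivative p' x) (at x)" for x
    unfolding p_def[abs_def] p'_def by simp
  have r: "(r has_real_derivative r' x) (at x)" for x
  proof -
    have "((\<lambda>x. (max 0 (- x))\<^sup>2) has_real_derivative 2 * max 0 (- x) * - 1) (at x)"
      by (rule DERIV_chain2[OF has_derivative_max_0_sq]) (auto intro!: derivative_eq_intros)
    from DERIV_add[OF p this] show ?thesis unfolding r_def[abs_def] r'_def by simp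
  qed
  have e: "(e has_real_derivative c * e x + f x) (at x)" if "x > -2" for x
  proof -
    have "((\<lambda>x. exp (c * x)) has_real_derivative exp (c * x) * (c * 1)) (at x)"
      by (intro DERIV_chain2[OF DERIV_exp] DERIV_cmult DERIV_ident)
    moreover have "((\<lambda>x. G x - G R) has_real_derivative k x - 0) (at x)"
      by (intro DERIV_diff G that DERIV_const)
    ultimately have "(e has_real_derivative exp (c * x) * (c * 1) * (G x - G R) + (k x - 0) * exp (c * x)) (at x)"
      unfolding e_def[abs_def] by (rule DERIV_mult)
    moreover have "k x * exp (c * x) = f x"
      by (simp add: k_def exp_minus)
    ultimately show ?thesis by (simp add: e_def mult_ac)
  qed
  define h' where "h' x = (if x > -2 then (p' x * r x - p x * r' x) / (r x * r x) * e x + (c * e x + f x) * (p x / r x) else 0)" for x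
  have h: "(h has_real_derivative h' x) (at x)" for x
  proof (cases "x > -2")
    case True
    have "r x \<noteq> 0" using r_pos[of x] by simp
    from DERIV_mult[OF DERIV_divide[OF p r this] e[OF True]] show ?thesis
      unfolding h_def[abs_def] h'_def using True by simp
  next
    case False
    have "(h has_real_derivative 0) (at x) \<longleftrightarrow> ((\<lambda>_. 0) has_real_derivative 0) (at x)"
      by (rule DERIV_cong_ev[OF refl _ refl])
        (use False eventually_nhds_in_open[of "{..<-1}" x] in \<open>auto elim!: eventually_mono simp: h_def p_def\<close>)
    thus ?thesis using False by (simp add: h'_def)
  qed
  have h'_cont: "isCont h' x" for x
  proof (cases "x > -2")
    case True
    have ev: "\<forall>\<^sub>F y in nhds x. h' y = (p' y * r y - p y * r' y) / (r y * r y) * e y + (c * e y + f y) * (p y / r y)"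
      using True eventually_nhds_in_open[of "{-2<..}" x] by (auto elim!: eventually_mono simp: h'_def)
    have "isCont p' x" "isCont r' x"
      unfolding r'_def[abs_def] p'_def[abs_def] by (intro continuous_intros)+
    moreover have "isCont p x" "isCont r x" "isCont e x" "isCont f x" "r x \<noteq> 0"
      using DERIV_isCont[OF p] DERIV_isCont[OF r] DERIV_isCont[OF e[OF True]]
        DERIV_isCont[OF test_functionD(1)[OF f]] r_pos[of x] by auto
    ultimately have "isCont (\<lambda>y. (p' y * r y - p y * r' y) / (r y * r y) * e y + (c * e y + f y) * (p y / r y)) x"
      by (intro continuous_intros) auto
    thus ?thesis using isCont_cong[OF ev] by simp
  next
    case False
    have "\<forall>\<^sub>F y in nhds x. h' y = 0"
      using False eventually_nhds_in_open[of "{..<-1}" x]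
      by (auto elim!: eventually_mono simp: h'_def p_def p'_def)
    thus ?thesis using isCont_cong[of h' "\<lambda>_. 0" x] by simp
  qed
  have "test_function h"
  proof (rule test_functionI[OF h])
    show "continuous_on UNIV h'" using h'_cont by (simp add: continuous_on_eq_continuous_at)
    show "h x = 0" if "\<bar>x\<bar> > max R 1" for x
    proof (cases "x \<ge> R")
      case True thus ?thesis using G_const[OF True] by (simp add: h_def e_def)
    next
      case False
      hence "x \<le> -1" using that by auto
      thus ?thesis by (simp add: h_def p_def)
    qed
  qed
  moreover have "f x = deriv h x - c * h x" if "x \<ge> 0" for x
  proof -
    have "r x = p x" "r' x = p' x" "p x \<noteq> 0" using that by (auto simp: r_def r'_def p_def)
    thus ?thesis using that DERIV_imp_deriv[OF h, of x] by (simp add: h'_def h_def field_simps)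
  qed
  ultimately show ?thesis by (rule that)
qed

section \<open>Density families\<close>

lemma density_familyD:
  assumes "density_family u" and "t \<ge> 0"
  shows "finite_measure (u t)" "sets (u t) = sets borel" "space (u t) = UNIV" "AE x in u t. x \<ge> 0"
proof -
  show fin: "finite_measure (u t)" "sets (u t) = sets borel"
    using assms by (auto simp: density_family_def)
  show sp: "space (u t) = UNIV" using sets_eq_imp_space_eq[OF fin(2)] by simp
  have "emeasure (u t) {..<0} = 0" using assms by (auto simp: density_family_def)
  thus "AE x in u t. x \<ge> 0"
    using fin(2) sp by (intro AE_I[of _ _ "{..<0}"]) (auto simp: not_le)
qed

lemma density_family_bound:
  assumes "density_family u"
  shows "\<exists>C\<ge>0. \<forall>t\<ge>0. measure (u t) (space (u t)) \<le> C"
proof -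
  obtain C where "\<And>t. t \<ge> 0 \<Longrightarrow> measure (u t) UNIV \<le> C"
    using assms by (auto simp: density_family_def)
  thus ?thesis using density_familyD(3)[OF assms]
    by (intro exI[of _ "\<bar>C\<bar>"]) (auto intro: order_trans[OF _ abs_ge_self])
qed

lemma pairing_neg: "t < 0 \<Longrightarrow> pairing u f t = 0"
  by (simp add: pairing_def)

lemma pairing_bound:
  assumes u: "density_family u" and [measurable]: "f \<in> borel_measurable borel" and K: "\<And>x. \<bar>f x\<bar> \<le> K"
  shows "\<exists>C. \<forall>t. \<bar>pairing u f t\<bar> \<le> C"
proof -
  obtain C where C: "C \<ge> 0" "\<And>t. t \<ge> 0 \<Longrightarrow> measure (u t) (space (u t)) \<le> C"
    using density_family_bound[OF u] by auto
  have K0: "K \<ge> 0" using K[of 0] by linarith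
  have "\<bar>pairing u f t\<bar> \<le> K * C" for t
  proof (cases "t < 0")
    case False
    interpret finite_measure "u t" using density_familyD(1)[OF u, of t] False by simp
    have [measurable_cong]: "sets (u t) = sets borel" using density_familyD(2)[OF u, of t] False by simp
    have "\<bar>\<integral>x. f x \<partial>(u t)\<bar> \<le> (\<integral>x. \<bar>f x\<bar> \<partial>(u t))" by (rule integral_abs_bound)
    also have "\<dots> \<le> (\<integral>x. K \<partial>(u t))"
      by (rule integral_mono) (auto intro!: integrable_const_bound[of _ K] K)
    also have "\<dots> \<le> K * C" using mult_left_mono[OF C(2)[of t] K0] False by (simp add: mult.commute)
    finally show ?thesis using False by (simp add: pairing_def)
  qed (use K0 C in \<open>auto simp: pairing_def\<close>)
  thus ?thesis by blast
qed

lemma pairing_right_continuous: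
  "density_family u \<Longrightarrow> test_function f \<Longrightarrow> t \<ge> 0 \<Longrightarrow> continuous (at_right t) (pairing u f)"
  by (auto simp: density_family_def)

lemma pairing_integrable:
  fixes f :: "real \<Rightarrow> real"
  assumes u: "density_family u" "t \<ge> 0" and [measurable]: "f \<in> borel_measurable borel" and K: "\<And>x. \<bar>f x\<bar> \<le> K"
  shows "integrable (u t) f"
proof -
  interpret finite_measure "u t" using density_familyD(1)[OF u] .
  have [measurable_cong]: "sets (u t) = sets borel" using density_familyD(2)[OF u] .
  show ?thesis by (intro integrable_const_bound[of _ K]) (auto intro: K)
qed

lemma pairing_measurable:
  assumes "density_family u" "test_function f"
  shows "pairing u f \<in> borel_measurable borel"
  by (rule right_continuous_measurable[OF pairing_right_continuous[OF assms] pairing_neg])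

lemma has_laplace_pairing:
  assumes u: "density_family u" and f: "test_function f"
  shows "has_laplace (pairing u f)"
proof -
  obtain K where K: "K > 0" "\<And>x. \<bar>f x\<bar> \<le> K" "\<And>x. \<bar>deriv f x\<bar> \<le> K"
    using test_function_bounded[OF f] by auto
  obtain C where C: "\<And>t. \<bar>pairing u f t\<bar> \<le> C"
    using pairing_bound[OF u test_function_measurable[OF f] K(2)] by auto
  show ?thesis
    by (rule has_laplace_bounded[OF pairing_measurable[OF u f] pairing_neg C])
qed

text \<open>\<open>density_family\<close> provides regularity in \<open>t\<close> for test functions
  only, so the measurability of this pairing comes from difference quotients. The mean value theorem
  bounds them by the bound of the derivative, as dominated convergence requires.\<close>

lemma has_laplace_pairing_deriv:
  assumes u: "density_family u" and f: "test_function f"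
  shows "has_laplace (pairing u (deriv f))"
proof -
  note df = deriv_test_function_measurable[OF f]
  obtain K where K: "K > 0" "\<And>x. \<bar>f x\<bar> \<le> K" "\<And>x. \<bar>deriv f x\<bar> \<le> K"
    using test_function_bounded[OF f] by auto
  obtain C where C: "\<And>t. \<bar>pairing u (deriv f) t\<bar> \<le> C"
    using pairing_bound[OF u df K(3)] by auto
  define h where "h n x = real (Suc n) * (f (x + 1 / real (Suc n)) - f x)" for n x
  have h: "test_function (h n)" for n
    unfolding h_def by (rule test_function_difference_quotient[OF f])
  have h_bound: "\<bar>h n x\<bar> \<le> K" for n x
  proof -
    obtain z where z: "f (x + 1 / real (Suc n)) - f x = (x + 1 / real (Suc n) - x) * deriv f z"
      using MVT2[of x "x + 1 / real (Suc n)" f "deriv f"] test_functionD(1)[OF f] by auto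
    have "h n x = deriv f z" unfolding h_def z by simp
    thus ?thesis using K by simp
  qed
  have h_lim: "(\<lambda>n. h n x) \<longlonglongrightarrow> deriv f x" for x
  proof -
    have "(\<lambda>n. (f (x + 1 / real (Suc n)) - f x) / (1 / real (Suc n))) \<longlonglongrightarrow> deriv f x"
      using test_functionD(1)[OF f, of x] unfolding DERIV_def
      by (rule filterlim_compose) (auto simp: filterlim_at lim_1_over_n intro!: LIMSEQ_Suc[OF lim_1_over_n] simp del: of_nat_Suc)
    thus ?thesis by (simp add: h_def mult.commute del: of_nat_Suc)
  qed
  have "(\<lambda>n. pairing u (h n) t) \<longlonglongrightarrow> pairing u (deriv f) t" for t
  proof (cases "t < 0")
    case False
    hence t: "t \<ge> 0" by simp
    interpret finite_measure "u t" using density_familyD(1)[OF u t] .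
    have [measurable_cong]: "sets (u t) = sets borel" using density_familyD(2)[OF u t] .
    have [measurable]: "h n \<in> borel_measurable borel" for n by (rule test_function_measurable[OF h])
    have "(\<lambda>n. \<integral>x. h n x \<partial>(u t)) \<longlonglongrightarrow> (\<integral>x. deriv f x \<partial>(u t))"
      by (rule integral_dominated_convergence[where w = "\<lambda>_. K"])
        (use df h_lim h_bound in auto)
    thus ?thesis using False by (simp add: pairing_def)
  qed (simp add: pairing_def)
  hence "pairing u (deriv f) \<in> borel_measurable borel"
    by (intro borel_measurable_LIMSEQ_real[OF _ pairing_measurable[OF u h]])
  thus ?thesis by (rule has_laplace_bounded[OF _ pairing_neg C])
qed

text \<open>If \<open>f = h' - \<Phi> \<xi> * h\<close> on the half-line, the identity for
  \<open>h\<close> evaluates the transform of \<open>pairing u f\<close> as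
  \<open>- \<Phi> \<xi> * h 0 / \<xi>\<close>, which no longer contains \<open>u\<close>. The
  function \<open>h\<close> changes with \<open>\<xi>\<close>; this is harmless, since the two
  families are compared at one \<open>\<xi>\<close> at a time.\<close>

lemma density_family_unique:
  assumes u: "density_family u" and v: "density_family v"
    and eq_u: "\<And>\<xi> f. \<xi> > 0 \<Longrightarrow> test_function f \<Longrightarrow>
        \<Phi> \<xi> * (laplace (pairing u f) \<xi> - f 0 / \<xi>) = laplace (pairing u (deriv f)) \<xi>"
    and eq_v: "\<And>\<xi> f. \<xi> > 0 \<Longrightarrow> test_function f \<Longrightarrow>
        \<Phi> \<xi> * (laplace (pairing v f) \<xi> - f 0 / \<xi>) = laplace (pairing v (deriv f)) \<xi>"
    and t: "t \<ge> 0"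
  shows "u t = v t"
proof (rule measure_eq_by_test_functions)
  show "finite_measure (u t)" "sets (u t) = sets borel" "finite_measure (v t)" "sets (v t) = sets borel"
    using density_familyD[OF u t] density_familyD[OF v t] by auto
  fix f assume f: "test_function f"
  have lap: "laplace (pairing w f) \<xi> = - \<Phi> \<xi> * h 0 / \<xi>"
    if \<xi>: "\<xi> > 0" and w: "density_family w" and h: "test_function h"
      and hf: "\<And>x. x \<ge> 0 \<Longrightarrow> f x = deriv h x - \<Phi> \<xi> * h x"
      and eq: "\<Phi> \<xi> * (laplace (pairing w h) \<xi> - h 0 / \<xi>) = laplace (pairing w (deriv h)) \<xi>" for \<xi> w h
  proof -
    obtain K where K: "K > 0" "\<And>x. \<bar>h x\<bar> \<le> K" "\<And>x. \<bar>deriv h x\<bar> \<le> K"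
    using test_function_bounded[OF h] by auto
    have "pairing w f t = pairing w (deriv h) t - \<Phi> \<xi> * pairing w h t" for t
    proof (cases "t < 0")
      case False
      hence t: "t \<ge> 0" by simp
      note [measurable_cong] = density_familyD(2)[OF w t]
      note [measurable] = test_function_measurable[OF h] test_function_measurable[OF f] deriv_test_function_measurable[OF h]
      note int = pairing_integrable[OF w t test_function_measurable[OF h] K(2)]
        pairing_integrable[OF w t deriv_test_function_measurable[OF h] K(3)]
      have "(\<integral>x. f x \<partial>(w t)) = (\<integral>x. deriv h x - \<Phi> \<xi> * h x \<partial>(w t))"
        using density_familyD(4)[OF w t] by (intro integral_cong_AE) (auto elim!: eventually_mono simp: hf)
      also have "\<dots> = (\<integral>x. deriv h x \<partial>(w t)) - \<Phi> \<xi> * (\<integral>x. h x \<partial>(w t))"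
        using int by simp
      finally show ?thesis using False by (simp add: pairing_def)
    qed (simp add: pairing_def)
    hence "laplace (pairing w f) \<xi> = laplace (\<lambda>t. pairing w (deriv h) t - \<Phi> \<xi> * pairing w h t) \<xi>"
      by presburger
    also have "\<dots> = laplace (pairing w (deriv h)) \<xi> - \<Phi> \<xi> * laplace (pairing w h) \<xi>"
      using \<xi> by (simp add: has_laplace_diff(2) has_laplace_cmult has_laplace_pairing[OF w h] has_laplace_pairing_deriv[OF w h])
    also have "\<dots> = - \<Phi> \<xi> * h 0 / \<xi>" unfolding eq[symmetric] by (simp add: algebra_simps)
    finally show ?thesis .
  qed
  have "pairing u f t - pairing v f t = 0"
  proof (rule laplace_unique[OF has_laplace_diff(1)[OF has_laplace_pairing[OF u f] has_laplace_pairing[OF v f]] _ _ t])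
    show "continuous (at_right t) (\<lambda>t. pairing u f t - pairing v f t)" if "t \<ge> 0" for t
      by (intro continuous_diff pairing_right_continuous that u v f)
    fix \<xi> :: real assume \<xi>: "\<xi> > 0"
    obtain h where h: "test_function h" "\<And>x. x \<ge> 0 \<Longrightarrow> f x = deriv h x - \<Phi> \<xi> * h x"
      using test_function_resolvent[OF f] by blast
    show "laplace (\<lambda>t. pairing u f t - pairing v f t) \<xi> = 0"
      using lap[OF \<xi> u h eq_u[OF \<xi> h(1)]] lap[OF \<xi> v h eq_v[OF \<xi> h(1)]] \<xi>
      by (simp add: has_laplace_diff(2) has_laplace_pairing u v f)
  qed
  thus "(\<integral>x. f x \<partial>(u t)) = (\<integral>x. f x \<partial>(v t))" using t by (simp add: pairing_def)
qed

section \<open>The equation after a Laplace transform in time\<close>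

text \<open>The kernel \<open>k\<close> is integrable only against a decaying exponential. As
  \<open>U\<close> vanishes at negative times, only \<open>s \<le> t \<le> T\<close> contributes,
  and there the factor \<open>exp (T - s) \<ge> 1\<close> may be inserted. The bound is uniform in
  \<open>t \<le> T\<close>, as needed for limits in \<open>t\<close>.\<close>

lemma conv_dominated:
  assumes k: "has_laplace k" and [measurable]: "U \<in> borel_measurable borel" and causal: "\<And>t. t < 0 \<Longrightarrow> U t = 0"
    and C: "\<And>t. \<bar>U t\<bar> \<le> C"
  shows "integrable lborel (\<lambda>s. C * exp T * \<bar>exp (- 1 * s) * k s\<bar>)"
    and "t \<le> T \<Longrightarrow> norm (k s * U (t - s)) \<le> C * exp T * \<bar>exp (- 1 * s) * k s\<bar>"
proof -
  show "integrable lborel (\<lambda>s. C * exp T * \<bar>exp (- 1 * s) * k s\<bar>)"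
    using has_laplaceD(2)[OF k zero_less_one] by simp
  have C0: "C \<ge> 0" using C[of 0] by linarith
  show "norm (k s * U (t - s)) \<le> C * exp T * \<bar>exp (- 1 * s) * k s\<bar>" if "t \<le> T"
  proof (cases "s > t")
    case True thus ?thesis using causal[of "t - s"] C0 by simp
  next
    case False
    hence "1 \<le> exp (T - s)" using that by simp
    have "norm (k s * U (t - s)) \<le> \<bar>k s\<bar> * C" by (simp add: abs_mult C mult_left_mono)
    also have "\<dots> * 1 \<le> \<bar>k s\<bar> * C * exp (T - s)"
      using C0 \<open>1 \<le> exp (T - s)\<close> by (intro mult_left_mono) auto
    also have "\<dots> = C * exp T * \<bar>exp (- 1 * s) * k s\<bar>"
      by (simp add: abs_mult exp_diff exp_minus field_simps)
    finally show ?thesis by simp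
  qed
qed

lemma conv_tendsto:
  assumes k: "has_laplace k" and U: "U \<in> borel_measurable borel" "\<And>t. t < 0 \<Longrightarrow> U t = 0" "\<And>t. \<bar>U t\<bar> \<le> C"
    and X: "X \<longlonglongrightarrow> t" and lim: "\<And>s. (\<lambda>n. U (X n - s)) \<longlonglongrightarrow> U (t - s)"
  shows "(\<lambda>n. conv k U (X n)) \<longlonglongrightarrow> conv k U t"
proof -
  note [measurable] = has_laplace_measurable[OF k] U(1)
  obtain T where T: "\<And>n. X n \<le> T"
    using Bseq_eq_bounded[of X] convergent_imp_Bseq[OF convergentI[OF X]]
    by (auto simp: Bseq_def abs_le_iff)
  show ?thesis
    unfolding conv_def
    by (rule integral_dominated_convergence[where w = "\<lambda>s. C * exp T * \<bar>exp (- 1 * s) * k s\<bar>"])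
      (use conv_dominated[OF k U] T lim in \<open>auto intro!: tendsto_intros simp del: mult_minus_left\<close>)
qed

lemma conv_diff:
  assumes k: "has_laplace k" and U: "U \<in> borel_measurable borel" "\<And>t. t < 0 \<Longrightarrow> U t = 0" "\<And>t. \<bar>U t\<bar> \<le> C"
    and V: "V \<in> borel_measurable borel" "\<And>t. t < 0 \<Longrightarrow> V t = 0" "\<And>t. \<bar>V t\<bar> \<le> D"
  shows "conv k (\<lambda>t. U t - c * V t) t = conv k U t - c * conv k V t"
proof -
  note [measurable] = has_laplace_measurable[OF k] U(1) V(1)
  have *: "integrable lborel (\<lambda>s. k s * W (t - s))"
    if W: "W \<in> borel_measurable borel" "\<And>t. t < 0 \<Longrightarrow> W t = 0" "\<And>t. \<bar>W t\<bar> \<le> E" for W E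
  proof (rule Bochner_Integration.integrable_bound)
    show "integrable lborel (\<lambda>s. E * exp t * \<bar>exp (- 1 * s) * k s\<bar>)"
      by (rule conv_dominated(1)[OF k W])
    have "norm (k s * W (t - s)) \<le> norm (E * exp t * \<bar>exp (- 1 * s) * k s\<bar>)" for s
    proof -
      have "norm (k s * W (t - s)) \<le> E * exp t * \<bar>exp (- 1 * s) * k s\<bar>"
        by (rule conv_dominated(2)[OF k W order_refl])
      also have "\<dots> \<le> norm (E * exp t * \<bar>exp (- 1 * s) * k s\<bar>)"
        unfolding real_norm_def by (rule abs_ge_self)
      finally show ?thesis .
    qed
    thus "AE s in lborel. norm (k s * W (t - s)) \<le> norm (E * exp t * \<bar>exp (- 1 * s) * k s\<bar>)"
      by simp
  qed (use W(1) in measurable)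
  have "integrable lborel (\<lambda>s. k s * U (t - s))" "integrable lborel (\<lambda>s. k s * V (t - s))"
    by (rule *[OF U]; assumption) (rule *[OF V]; assumption)
  hence "conv k U t - c * conv k V t = (\<integral>s. k s * U (t - s) - c * (k s * V (t - s)) \<partial>lborel)"
    unfolding conv_def by simp
  thus ?thesis by (simp add: conv_def algebra_simps)
qed

lemma conv_right_continuous:
  assumes k: "has_laplace k" and U: "U \<in> borel_measurable borel" "\<And>t. t < 0 \<Longrightarrow> U t = 0" "\<And>t. \<bar>U t\<bar> \<le> C"
    and rc: "\<And>t. t \<ge> 0 \<Longrightarrow> continuous (at_right t) U"
  shows "continuous (at_right t) (conv k U)"
  by (rule continuous_at_rightI_sequentially)
    (rule conv_tendsto[OF k U _ right_continuous_shift[OF U(2) rc]])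

text \<open>Turns the factor \<open>1 / \<xi>\<close> on the transform side into a primitive from 0,
  to which the fundamental theorem of calculus applies.\<close>

lemma conv_heaviside:
  assumes R: "has_laplace R" and t: "t \<ge> 0"
  shows "conv heaviside R t = integral {0..t} R"
proof -
  note [measurable] = has_laplace_measurable[OF R]
  have "integrable lborel (\<lambda>s. exp t * (exp (- 1 * s) * R s))"
    using has_laplaceD(2)[OF R zero_less_one] by simp
  hence "integrable lborel (\<lambda>s. indicator {0..t} s * R s)"
  proof (rule Bochner_Integration.integrable_bound)
    show "AE s in lborel. norm (indicator {0..t} s * R s) \<le> norm (exp t * (exp (- 1 * s) * R s))"
    proof (intro AE_I2)
      fix s
      have "1 * \<bar>R s\<bar> \<le> exp (t - s) * \<bar>R s\<bar>" if "s \<le> t" using that by (intro mult_right_mono) auto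
      thus "norm (indicator {0..t} s * R s) \<le> norm (exp t * (exp (- 1 * s) * R s))"
        by (auto simp: indicator_def abs_mult exp_diff exp_minus field_simps)
    qed
  qed simp
  hence "set_integrable lborel {0..t} R" by (simp add: set_integrable_def)
  from set_borel_integral_eq_integral(2)[OF this]
  have "integral {0..t} R = (\<integral>s. indicator {0..t} s * R s \<partial>lborel)"
    by (simp add: set_lebesgue_integral_def)
  also have "\<dots> = (\<integral>s. indicator {0..t} (t + (-1) * s) * R (t + (-1) * s) \<partial>lborel)"
    by (subst lborel_integral_real_affine[of "-1" _ t]) auto
  also have "\<dots> = conv heaviside R t"
    unfolding conv_def
    by (intro Bochner_Integration.integral_cong) (auto simp: heaviside_def indicator_def has_laplaceD(1)[OF R])
  finally show ?thesis by simp
qed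

lemma frac_kernel_right_continuous:
  assumes "\<beta> < 1" "t \<ge> 0"
  shows "continuous (at_right t) (frac_kernel (\<beta> - 1))"
proof -
  have "\<forall>\<^sub>F s in at_right t. 0 \<le> s"
    using eventually_at_right_less[of t] by eventually_elim (use assms in auto)
  moreover have "0 < Gamma (2 - \<beta>)"
    using assms by (intro Gamma_real_pos) simp
  hence "Gamma (2 - \<beta>) \<noteq> 0" by simp
  ultimately have "((\<lambda>s. s powr (1 - \<beta>) / Gamma (2 - \<beta>)) \<longlongrightarrow> t powr (1 - \<beta>) / Gamma (2 - \<beta>)) (at_right t)"
    using assms by (intro tendsto_divide tendsto_powr' tendsto_const tendsto_ident_at disjI2 conjI) auto
  moreover have "\<forall>\<^sub>F s in at_right t. s powr (1 - \<beta>) / Gamma (2 - \<beta>) = frac_kernel (\<beta> - 1) s"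
    using eventually_at_right_less[of t] by eventually_elim (use assms in \<open>auto simp: frac_kernel_def\<close>)
  ultimately have "(frac_kernel (\<beta> - 1) \<longlongrightarrow> t powr (1 - \<beta>) / Gamma (2 - \<beta>)) (at_right t)"
    by (rule Lim_transform_eventually)
  thus ?thesis using assms by (auto simp: continuous_within frac_kernel_def)
qed

lemma heaviside_right_continuous: "t \<ge> 0 \<Longrightarrow> continuous (at_right t) heaviside"
  unfolding continuous_within heaviside_def
  by (auto intro!: tendsto_eventually eventually_mono[OF eventually_at_right_less[of t]])

text \<open>Both sides have Laplace transform \<open>\<xi> powr (\<beta> - 2)\<close>.\<close>

lemma conv_frac_kernel_heaviside:
  assumes \<beta>: "\<beta> < 1" and t: "t \<ge> 0"
  shows "conv (frac_kernel \<beta>) heaviside t = frac_kernel (\<beta> - 1) t"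
proof -
  have \<beta>': "\<beta> - 1 < 1" using \<beta> by simp
  note lap = has_laplace_conv[OF has_laplace_frac_kernel(1)[OF \<beta>] has_laplace_heaviside]
    has_laplace_frac_kernel(1)[OF \<beta>']
  have "conv (frac_kernel \<beta>) heaviside t - frac_kernel (\<beta> - 1) t = 0"
  proof (rule laplace_unique[OF has_laplace_diff(1)[OF lap(1,3)] _ _ t])
    show "continuous (at_right t) (\<lambda>t. conv (frac_kernel \<beta>) heaviside t - frac_kernel (\<beta> - 1) t)" if "t \<ge> 0" for t
      by (intro continuous_diff frac_kernel_right_continuous \<beta> that conv_right_continuous[where C = 1]
          has_laplace_frac_kernel(1)[OF \<beta>] heaviside_measurable heaviside_right_continuous)
        (auto simp: heaviside_def)
    show "laplace (\<lambda>t. conv (frac_kernel \<beta>) heaviside t - frac_kernel (\<beta> - 1) t) \<xi> = 0" if "\<xi> > 0" for \<xi>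
      using that
      by (simp add: has_laplace_diff(2)[OF lap(1,3)] lap(2) has_laplace_frac_kernel(2)[OF \<beta>]
        has_laplace_frac_kernel(2)[OF \<beta>'] laplace_heaviside(2) powr_diff field_simps power2_eq_square)
  qed
  thus ?thesis by simp
qed

section \<open>The Caputo derivative as the derivative of a primitive\<close>

text \<open>At \<open>\<beta> = 1\<close> the fractional kernel degenerates to a unit mass at 0, so
  the convolution becomes the identity. In both cases the transform is multiplied by
  \<open>\<xi> powr (\<beta> - 1)\<close>.\<close>

definition caputo_primitive :: "real \<Rightarrow> (real \<Rightarrow> real) \<Rightarrow> real \<Rightarrow> real" where
  "caputo_primitive \<beta> V = (if \<beta> = 1 then V else conv (frac_kernel \<beta>) V)"

lemma has_laplace_caputo_primitive:
  assumes "0 < \<beta>" "\<beta> \<le> 1" "has_laplace V"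
  shows "has_laplace (caputo_primitive \<beta> V)"
    and "\<xi> > 0 \<Longrightarrow> laplace (caputo_primitive \<beta> V) \<xi> = \<xi> powr (\<beta> - 1) * laplace V \<xi>"
  using assms by (auto simp: caputo_primitive_def has_laplace_conv has_laplace_frac_kernel)

lemma caputo_primitive_right_continuous:
  assumes "0 < \<beta>" "\<beta> \<le> 1" and V: "V \<in> borel_measurable borel" "\<And>t. t < 0 \<Longrightarrow> V t = 0" "\<And>t. \<bar>V t\<bar> \<le> C"
    and rc: "\<And>t. t \<ge> 0 \<Longrightarrow> continuous (at_right t) V" and "t \<ge> 0"
  shows "continuous (at_right t) (caputo_primitive \<beta> V)"
proof (cases "\<beta> = 1")
  case False
  with assms(1,2) have "\<beta> < 1" by simp
  thus ?thesis using conv_right_continuous[OF has_laplace_frac_kernel(1) V rc] False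
    by (simp add: caputo_primitive_def)
qed (use assms in \<open>auto simp: caputo_primitive_def\<close>)

lemma caputo_primitive_0:
  assumes "V 0 = 0" "\<And>t. t < 0 \<Longrightarrow> V t = 0"
  shows "caputo_primitive \<beta> V 0 = 0"
proof -
  have "frac_kernel \<beta> s * V (0 - s) = 0" for s
    using assms(1) assms(2)[of "-s"] by (cases s "0::real" rule: linorder_cases) (auto simp: frac_kernel_def)
  hence "conv (frac_kernel \<beta>) V 0 = 0"
    by (simp only: conv_def Bochner_Integration.integral_zero)
  thus ?thesis using assms by (simp add: caputo_primitive_def)
qed

text \<open>For \<open>\<beta> < 1\<close>, subtracting \<open>U 0\<close> before the convolution
  removes \<open>U 0 * t powr (1 - \<beta>) / Gamma (2 - \<beta>)\<close> from the fractional
  integral, and the derivative of this term is the correction in \<open>caputo\<close>. Working with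
  \<open>has_real_derivative\<close> keeps the existence of the derivative and its value together,
  which the total \<open>deriv\<close> does not.\<close>

lemma caputo_iff_primitive:
  assumes \<beta>: "0 < \<beta>" "\<beta> \<le> 1" and U: "U \<in> borel_measurable borel" "\<And>t. t < 0 \<Longrightarrow> U t = 0" "\<And>t. \<bar>U t\<bar> \<le> C"
    and rc: "continuous (at_right 0) U" and t: "t > 0"
  shows "(caputo_primitive \<beta> (\<lambda>t. U t - U 0 * heaviside t) has_real_derivative D) (at t) \<longleftrightarrow>
    caputo_differentiable \<beta> U t \<and> caputo \<beta> U t = D"
proof -
  define J where "J = caputo_primitive \<beta> (\<lambda>t. U t - U 0 * heaviside t)"
  define W where "W = (if \<beta> = 1 then U else frac_integral \<beta> U)"
  define p where "p t = (if \<beta> = 1 then 1 else frac_kernel (\<beta> - 1) t)" for t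
  define p' where "p' = (if \<beta> = 1 then 0 else t powr (- \<beta>) / Gamma (1 - \<beta>))"
  have J_eq: "J s = W s - U 0 * p s" if "s > 0" for s
  proof (cases "\<beta> = 1")
    case False
    hence \<beta>1: "\<beta> < 1" using \<beta> by simp
    have "J s = conv (frac_kernel \<beta>) U s - U 0 * conv (frac_kernel \<beta>) heaviside s"
      unfolding J_def caputo_primitive_def if_not_P[OF False]
      by (rule conv_diff[OF has_laplace_frac_kernel(1)[OF \<beta>1] U heaviside_measurable, where D = 1])
        (auto simp: heaviside_def)
    thus ?thesis using False that conv_frac_kernel_heaviside[OF \<beta>1, of s] frac_integral_eq_conv[of U \<beta>, OF U(2)]
      by (simp add: W_def p_def)
  qed (use that in \<open>auto simp: J_def W_def p_def caputo_primitive_def heaviside_def\<close>)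
  have pos: "\<forall>\<^sub>F s in nhds t. s > 0" using eventually_nhds_in_open[of "{0<..}" t] t by simp
  have p: "(p has_real_derivative p') (at t)"
  proof (cases "\<beta> = 1")
    case False
    hence \<beta>1: "\<beta> < 1" using \<beta> by simp
    hence "1 - \<beta> \<notin> \<int>\<^sub>\<le>\<^sub>0" by (auto elim!: nonpos_Ints_cases)
    hence G: "Gamma (2 - \<beta>) = (1 - \<beta>) * Gamma (1 - \<beta>)" "Gamma (1 - \<beta>) > 0"
      using Gamma_plus1[of "1 - \<beta>"] \<beta>1 by (auto simp: Gamma_real_pos)
    have "((\<lambda>s. s powr (1 - \<beta>) / Gamma (2 - \<beta>)) has_real_derivative (1 - \<beta>) * t powr (- \<beta>) / Gamma (2 - \<beta>)) (at t)"
      using DERIV_cdivide[OF has_real_derivative_powr[OF t, of "1 - \<beta>"]] by simp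
    moreover have "(1 - \<beta>) * t powr (- \<beta>) / Gamma (2 - \<beta>) = p'"
      using G \<beta>1 False by (simp add: p'_def)
    moreover have ev: "\<forall>\<^sub>F s in nhds t. p s = s powr (1 - \<beta>) / Gamma (2 - \<beta>)"
      using pos by eventually_elim (use False in \<open>auto simp: p_def frac_kernel_def\<close>)
    ultimately show ?thesis using DERIV_cong_ev[OF refl ev refl] by simp
  qed (simp add: p_def[abs_def] p'_def)
  have "(J has_real_derivative E) (at t) \<longleftrightarrow> (W has_real_derivative E + U 0 * p') (at t)" for E
  proof -
    have "(J has_real_derivative E) (at t) \<longleftrightarrow> ((\<lambda>s. W s - U 0 * p s) has_real_derivative E) (at t)"
      by (rule DERIV_cong_ev[OF refl _ refl]) (use pos in \<open>auto elim!: eventually_mono simp: J_eq\<close>)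
    also have "\<dots> \<longleftrightarrow> (W has_real_derivative E + U 0 * p') (at t)"
    proof
      assume "((\<lambda>s. W s - U 0 * p s) has_real_derivative E) (at t)"
      from DERIV_add[OF this DERIV_cmult[OF p, of "U 0"]]
      show "(W has_real_derivative E + U 0 * p') (at t)" by simp
    next
      assume "(W has_real_derivative E + U 0 * p') (at t)"
      from DERIV_diff[OF this DERIV_cmult[OF p, of "U 0"]]
      show "((\<lambda>s. W s - U 0 * p s) has_real_derivative E) (at t)" by simp
    qed
    finally show ?thesis .
  qed
  moreover have "Lim (at_right 0) U = U 0"
    using rc by (intro tendsto_Lim) (auto simp: continuous_within)
  hence "caputo \<beta> U t = deriv W t - U 0 * p'"
    by (auto simp: caputo_def riemann_liouville_def W_def p'_def)
  moreover have "caputo_differentiable \<beta> U t \<longleftrightarrow> W differentiable (at t)"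
    by (simp add: caputo_differentiable_def W_def)
  ultimately show ?thesis
    unfolding J_def[symmetric]
    by (metis DERIV_deriv_iff_real_differentiable DERIV_imp_deriv add_diff_cancel diff_add_cancel real_differentiable_def)
qed

section \<open>The tested equation and its transform\<close>

locale equation_parameters =
  fixes b \<beta> \<gamma> rate :: real
  assumes b: "b \<ge> 0" and \<beta>: "0 < \<beta>" "\<beta> \<le> 1" and \<gamma>: "0 < \<gamma>" "\<gamma> \<le> 1" and rate: "rate > 0"
begin

definition exponent :: "real \<Rightarrow> real" where
  "exponent \<xi> = b powr \<beta> * \<xi> powr \<beta> + rate powr \<gamma> * (1 - exp (- \<xi>)) powr \<gamma>"

lemma exponent_pos: "\<xi> > 0 \<Longrightarrow> exponent \<xi> > 0"
  unfolding exponent_def using rate by (intro add_nonneg_pos mult_nonneg_nonneg mult_pos_pos) auto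

context
  fixes u f
  assumes u: "density_family u" and f: "test_function f"
begin

text \<open>A unit mass resting at 0 for all times is subtracted from the family. This changes the
  fractional difference by exactly the boundary term
  \<open>boundary_value \<gamma> rate t * f 0\<close>, so the equation becomes
  \<open>b powr \<beta> * caputo \<beta> (pairing u f) t = source t\<close>, without any boundary
  value.\<close>

definition "deviation t = pairing u f t - f 0 * heaviside t"
definition "source t = pairing u (deriv f) t - rate powr \<gamma> * frac_difference \<gamma> deviation t"

lemma deviation_neg: "t < 0 \<Longrightarrow> deviation t = 0"
  by (simp add: deviation_def pairing_def heaviside_def)

lemma has_laplace_deviation: "has_laplace deviation"
  unfolding deviation_def[abs_def]
  by (intro has_laplace_diff has_laplace_cmult has_laplace_pairing u f has_laplace_heaviside)

lemma laplace_deviation: "\<xi> > 0 \<Longrightarrow> laplace deviation \<xi> = laplace (pairing u f) \<xi> - f 0 / \<xi>"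
  unfolding deviation_def[abs_def]
  by (simp add: has_laplace_diff(2) has_laplace_cmult has_laplace_pairing u f has_laplace_heaviside laplace_heaviside)

lemma has_laplace_source: "has_laplace source"
  unfolding source_def[abs_def]
  by (intro has_laplace_diff has_laplace_cmult has_laplace_pairing_deriv u f has_laplace_frac_difference has_laplace_deviation)

lemma laplace_source:
  "\<xi> > 0 \<Longrightarrow> laplace source \<xi> = laplace (pairing u (deriv f)) \<xi> - rate powr \<gamma> * (1 - exp (- \<xi>)) powr \<gamma> * laplace deviation \<xi>"
  unfolding source_def[abs_def]
  by (simp add: has_laplace_diff(2) has_laplace_cmult has_laplace_pairing_deriv u f has_laplace_frac_difference has_laplace_deviation)

lemma source_eq:
  "minus_dx_pairing (boundary_value \<gamma> rate) u f t - rate powr \<gamma> * frac_difference \<gamma> (pairing u f) t = source t"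
proof -
  have eq: "frac_difference \<gamma> deviation t = frac_difference \<gamma> (pairing u f) t - f 0 * frac_difference \<gamma> heaviside t"
    unfolding deviation_def[abs_def]
    by (rule frac_difference_diff) (auto simp: pairing_def heaviside_def)
  show ?thesis
    unfolding source_def minus_dx_pairing_def eq boundary_value_eq_frac_difference[OF \<gamma> rate, of t]
    by (simp add: algebra_simps)
qed

lemma deviation_bounded: "\<exists>C. \<forall>t. \<bar>deviation t\<bar> \<le> C"
proof -
  obtain K where K: "K > 0" "\<And>x. \<bar>f x\<bar> \<le> K" "\<And>x. \<bar>deriv f x\<bar> \<le> K"
    using test_function_bounded[OF f] by auto
  obtain C where C: "\<And>t. \<bar>pairing u f t\<bar> \<le> C"
    using pairing_bound[OF u test_function_measurable[OF f] K(2)] by auto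
  have "\<bar>deviation t\<bar> \<le> C + \<bar>f 0\<bar>" for t
    using C[of t] unfolding deviation_def heaviside_def by (auto simp: abs_le_iff)
  thus ?thesis by blast
qed

lemma deviation_right_continuous: "t \<ge> 0 \<Longrightarrow> continuous (at_right t) deviation"
  unfolding deviation_def[abs_def]
  by (intro continuous_diff continuous_mult continuous_const pairing_right_continuous u f heaviside_right_continuous)

lemma caputo_iff_deviation:
  assumes "u 0 = return borel 0" "t > 0"
  shows "(caputo_primitive \<beta> deviation has_real_derivative D) (at t) \<longleftrightarrow>
    caputo_differentiable \<beta> (pairing u f) t \<and> caputo \<beta> (pairing u f) t = D"
proof -
  obtain K where K: "K > 0" "\<And>x. \<bar>f x\<bar> \<le> K" "\<And>x. \<bar>deriv f x\<bar> \<le> K"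
    using test_function_bounded[OF f] by auto
  obtain C where C: "\<And>t. \<bar>pairing u f t\<bar> \<le> C"
    using pairing_bound[OF u test_function_measurable[OF f] K(2)] by auto
  have "pairing u f 0 = f 0"
    using assms(1) test_function_measurable[OF f] by (simp add: pairing_def integral_return)
  thus ?thesis
    using caputo_iff_primitive[OF \<beta> pairing_measurable[OF u f] pairing_neg C pairing_right_continuous[OF u f order_refl] assms(2)]
    by (simp add: deviation_def[abs_def])
qed

lemma deviation_0:
  assumes "u 0 = return borel 0"
  shows "deviation 0 = 0"
  using assms test_function_measurable[OF f] by (simp add: deviation_def pairing_def integral_return heaviside_def)

text \<open>For \<open>b > 0\<close> the integrated equation is transformed instead of the equation
  itself: the behaviour of the derivative near \<open>t = 0\<close> is unknown, but the primitive is
  right-continuous there and starts at 0.\<close>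

lemma laplace_of_equation:
  assumes u0: "b > 0 \<Longrightarrow> u 0 = return borel 0"
    and diff: "\<And>t. b > 0 \<Longrightarrow> t > 0 \<Longrightarrow> caputo_differentiable \<beta> (pairing u f) t"
    and eq: "\<And>t. t > 0 \<Longrightarrow> b powr \<beta> * caputo \<beta> (pairing u f) t + rate powr \<gamma> * frac_difference \<gamma> (pairing u f) t
        = minus_dx_pairing (boundary_value \<gamma> rate) u f t"
    and \<xi>: "\<xi> > 0"
  shows "exponent \<xi> * (laplace (pairing u f) \<xi> - f 0 / \<xi>) = laplace (pairing u (deriv f)) \<xi>"
proof -
  have eq': "b powr \<beta> * caputo \<beta> (pairing u f) t = source t" if "t > 0" for t
    using eq[OF that] source_eq[of t] by simp
  have "b powr \<beta> * (\<xi> powr \<beta> * laplace deviation \<xi>) = laplace source \<xi>"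
  proof (cases "b = 0")
    case True
    \<comment> \<open>No equation is imposed at \<open>t = 0\<close>; a single point does not affect
      the transform.\<close>
    have "source t = 0" if "t \<noteq> 0" for t
      using eq'[of t] has_laplaceD(1)[OF has_laplace_source, of t] True that by (cases "t > 0") auto
    hence "AE t in lborel. exp (- \<xi> * t) * source t = 0"
      using AE_lborel_singleton[of "0::real"] by (auto elim!: eventually_mono)
    hence "laplace source \<xi> = 0"
      unfolding laplace_def by (rule integral_eq_zero_AE)
    thus ?thesis using True by simp
  next
    case False
    hence b: "b > 0" using b by simp
    define J where "J = caputo_primitive \<beta> deviation"
    obtain C where C: "\<And>t. \<bar>deviation t\<bar> \<le> C" using deviation_bounded by auto
    have J_lap: "has_laplace J" unfolding J_def
      by (rule has_laplace_caputo_primitive(1)[OF \<beta> has_laplace_deviation])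
    have J_deriv: "(J has_real_derivative source t / b powr \<beta>) (at t)" if "t > 0" for t
      unfolding J_def caputo_iff_deviation[OF u0[OF b] that]
      using diff[OF b that] eq'[OF that] b by (auto simp: field_simps)
    have J0: "J 0 = 0" unfolding J_def
      by (intro caputo_primitive_0 deviation_0 u0 b deviation_neg)
    have J_eq: "b powr \<beta> * J t = conv heaviside source t" for t
    proof (cases "t > 0")
      case True
      \<comment> \<open>The derivative exists at positive times only. At 0 the fundamental theorem
        asks for continuity from the right, and it delivers the integrability of
        \<open>source\<close> along with the value.\<close>
      have "((\<lambda>t. source t / b powr \<beta>) has_integral (J t - J 0)) {0..t}"
      proof (rule fundamental_theorem_of_calculus_interior)
        have "continuous (at s within {0..t}) J" if "s \<in> {0..t}" for s
        proof (cases "s = 0")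
          case True
          have "continuous (at_right 0) J" unfolding J_def
            by (rule caputo_primitive_right_continuous[OF \<beta> has_laplace_measurable[OF has_laplace_deviation]
                  deviation_neg C deviation_right_continuous]) auto
          thus ?thesis using \<open>t > 0\<close> True by (simp add: continuous_within at_within_Icc_at_right)
        next
          case False
          hence "isCont J s" using that J_deriv[of s] by (auto intro: DERIV_isCont)
          thus ?thesis by (rule continuous_at_imp_continuous_at_within)
        qed
        thus "continuous_on {0..t} J" by (simp add: continuous_on_eq_continuous_within)
      qed (use True J_deriv in \<open>auto simp: has_real_derivative_iff_has_vector_derivative\<close>)
      hence "((\<lambda>t. b powr \<beta> * (source t / b powr \<beta>)) has_integral (b powr \<beta> * (J t - J 0))) {0..t}"
        by (rule has_integral_mult_right)
      hence "(source has_integral (b powr \<beta> * J t)) {0..t}" using b J0 by simp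
      thus ?thesis using conv_heaviside[OF has_laplace_source, of t] True by (simp add: integral_unique)
    next
      case False
      show ?thesis
        using False J0 has_laplaceD(1)[OF J_lap, of t] has_laplaceD(1)[OF has_laplace_conv(1)[OF has_laplace_heaviside has_laplace_source], of t]
          conv_heaviside[OF has_laplace_source, of 0]
        by (cases "t = 0") auto
    qed
    have "b powr \<beta> * laplace J \<xi> = laplace (\<lambda>t. b powr \<beta> * J t) \<xi>"
      by (rule has_laplace_cmult(2)[OF J_lap, symmetric])
    also have "\<dots> = 1 / \<xi> * laplace source \<xi>"
      unfolding J_eq by (simp add: has_laplace_conv(2)[OF has_laplace_heaviside has_laplace_source \<xi>] laplace_heaviside(2)[OF \<xi>] flip: eta_contract_eq)
    finally show ?thesis
      using \<xi> by (simp add: J_def has_laplace_caputo_primitive(2)[OF \<beta> has_laplace_deviation \<xi>] powr_diff field_simps)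
  qed
  thus ?thesis
    unfolding laplace_source[OF \<xi>] laplace_deviation[OF \<xi>, symmetric]
    by (simp add: exponent_def distrib_right)
qed

text \<open>For \<open>b > 0\<close>, uniqueness of transforms gives the integrated equation.
  Differentiating it at a given \<open>t\<close> uses the continuity of \<open>source\<close>, which
  is why continuity of the pairings is assumed in that case; for \<open>b = 0\<close> the equation
  reads \<open>source t = 0\<close> and right continuity is enough.\<close>

lemma equation_of_laplace:
  assumes u0: "b > 0 \<Longrightarrow> u 0 = return borel 0"
    and cont: "b > 0 \<Longrightarrow> continuous_on {0..} (pairing u f)" "b > 0 \<Longrightarrow> continuous_on {0..} (pairing u (deriv f))"
    and rc: "\<And>t. t \<ge> 0 \<Longrightarrow> continuous (at_right t) (pairing u (deriv f))"
    and lap: "\<And>\<xi>. \<xi> > 0 \<Longrightarrow> exponent \<xi> * (laplace (pairing u f) \<xi> - f 0 / \<xi>) = laplace (pairing u (deriv f)) \<xi>"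
    and t: "t > 0"
  shows "b > 0 \<longrightarrow> caputo_differentiable \<beta> (pairing u f) t"
    and "b powr \<beta> * caputo \<beta> (pairing u f) t + rate powr \<gamma> * frac_difference \<gamma> (pairing u f) t
        = minus_dx_pairing (boundary_value \<gamma> rate) u f t"
proof -
  have lap': "b powr \<beta> * \<xi> powr \<beta> * laplace deviation \<xi> = laplace source \<xi>" if "\<xi> > 0" for \<xi>
    using lap[OF that] unfolding laplace_source[OF that] laplace_deviation[OF that, symmetric]
    by (simp add: exponent_def distrib_right)
  have "(b > 0 \<longrightarrow> caputo_differentiable \<beta> (pairing u f) t) \<and> b powr \<beta> * caputo \<beta> (pairing u f) t = source t"
  proof (cases "b = 0")
    case True
    have "source t = 0"
    proof (rule laplace_unique[OF has_laplace_source])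
      show "continuous (at_right s) source" if "s \<ge> 0" for s
        unfolding source_def[abs_def]
        by (intro continuous_diff continuous_mult continuous_const rc that
            frac_difference_right_continuous deviation_neg deviation_right_continuous)
    qed (use lap' True t in auto)
    thus ?thesis using True by simp
  next
    case False
    hence b: "b > 0" using b by simp
    define J where "J = caputo_primitive \<beta> deviation"
    obtain C where C: "\<And>t. \<bar>deviation t\<bar> \<le> C" using deviation_bounded by auto
    have J_lap: "has_laplace J" unfolding J_def
      by (rule has_laplace_caputo_primitive(1)[OF \<beta> has_laplace_deviation])
    \<comment> \<open>The fractional difference reaches back across time 0, so continuity is needed
      on the whole line: the jump of \<open>heaviside\<close> at 0 is cancelled by the initial
      mass.\<close>
    have dev_cont: "continuous_on UNIV deviation"
    proof -
      have "continuous_on {0..} deviation"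
        unfolding deviation_def[abs_def]
        by (rule continuous_on_eq[of _ "\<lambda>t. pairing u f t - f 0"])
          (auto simp: heaviside_def intro!: continuous_intros cont b)
      moreover have "continuous_on {..0} deviation"
        by (rule continuous_on_eq[of _ "\<lambda>_. 0"])
          (use deviation_0[OF u0[OF b]] deviation_neg in \<open>force simp: le_less\<close>)+
      ultimately have "continuous_on ({0..} \<union> {..0}) deviation"
        by (intro continuous_on_closed_Un) auto
      moreover have "{0..} \<union> {..0} = (UNIV :: real set)" by auto
      ultimately show ?thesis by simp
    qed
    have src_cont: "continuous_on {0..} source"
      unfolding source_def[abs_def]
      by (intro continuous_intros cont b continuous_on_subset[OF frac_difference_continuous[OF deviation_neg dev_cont]]) auto
    define I where "I s = integral {0..s} source" for s
    have I_deriv: "(I has_real_derivative source s) (at s within {0..s + 1})" if "s \<ge> 0" for s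
      unfolding I_def
      by (rule integral_has_real_derivative) (use that in \<open>auto intro: continuous_on_subset[OF src_cont]\<close>)
    note conv_lap = has_laplace_conv[OF has_laplace_heaviside has_laplace_source]
    have J_eq: "b powr \<beta> * J s = I s" if s: "s \<ge> 0" for s
    proof -
      have "b powr \<beta> * J s - conv heaviside source s = 0"
      proof (rule laplace_unique[OF has_laplace_diff(1)[OF has_laplace_cmult(1)[OF J_lap] conv_lap(1)] _ _ s])
        fix \<xi> :: real assume \<xi>: "\<xi> > 0"
        have "b powr \<beta> * (\<xi> powr (\<beta> - 1) * laplace deviation \<xi>) = 1 / \<xi> * laplace source \<xi>"
          unfolding lap'[OF \<xi>, symmetric] using \<xi> by (simp add: powr_diff)
        moreover have "laplace J \<xi> = \<xi> powr (\<beta> - 1) * laplace deviation \<xi>"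
          unfolding J_def by (rule has_laplace_caputo_primitive(2)[OF \<beta> has_laplace_deviation \<xi>])
        ultimately show "laplace (\<lambda>t. b powr \<beta> * J t - conv heaviside source t) \<xi> = 0"
          using \<xi> by (simp add: has_laplace_diff(2)[OF has_laplace_cmult(1)[OF J_lap] conv_lap(1)] has_laplace_cmult(2)[OF J_lap]
            conv_lap(2) laplace_heaviside(2))
      next
        fix r :: real assume r: "r \<ge> 0"
        have "(I has_real_derivative source r) (at r within {r..r + 1})"
          by (rule DERIV_subset[OF I_deriv[OF r]]) (use r in auto)
        from DERIV_continuous[OF this] have "(I \<longlongrightarrow> I r) (at_right r)"
          by (simp add: continuous_within at_within_Icc_at_right)
        moreover have "\<forall>\<^sub>F s in at_right r. I s = conv heaviside source s"
          using eventually_at_right_less[of r]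
          by eventually_elim (use r in \<open>simp add: I_def conv_heaviside[OF has_laplace_source]\<close>)
        ultimately have "(conv heaviside source \<longlongrightarrow> I r) (at_right r)"
          by (rule Lim_transform_eventually)
        hence "continuous (at_right r) (conv heaviside source)"
          using r by (simp add: continuous_within I_def conv_heaviside[OF has_laplace_source])
        moreover have "continuous (at_right r) J"
          unfolding J_def
          by (rule caputo_primitive_right_continuous[OF \<beta> has_laplace_measurable[OF has_laplace_deviation]
                deviation_neg C deviation_right_continuous r])
        ultimately show "continuous (at_right r) (\<lambda>t. b powr \<beta> * J t - conv heaviside source t)"
          by (intro continuous_diff continuous_mult continuous_const)
      qed
      thus ?thesis using conv_heaviside[OF has_laplace_source s] by (simp add: I_def)
    qed
    have "(I has_real_derivative source t) (at t)"
      using I_deriv[of t] t by (simp add: at_within_Icc_at)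
    hence "((\<lambda>s. I s / b powr \<beta>) has_real_derivative source t / b powr \<beta>) (at t)"
      by (rule DERIV_cdivide)
    moreover have ev: "\<forall>\<^sub>F s in nhds t. J s = I s / b powr \<beta>"
      using eventually_nhds_in_open[of "{0<..}" t] t b J_eq by (auto elim!: eventually_mono simp: field_simps)
    ultimately have "(J has_real_derivative source t / b powr \<beta>) (at t)"
      using DERIV_cong_ev[OF refl ev refl] by simp
    hence "caputo_differentiable \<beta> (pairing u f) t \<and> caputo \<beta> (pairing u f) t = source t / b powr \<beta>"
      unfolding J_def caputo_iff_deviation[OF u0[OF b] t] .
    thus ?thesis using b by simp
  qed
  thus "b > 0 \<longrightarrow> caputo_differentiable \<beta> (pairing u f) t"
    and "b powr \<beta> * caputo \<beta> (pairing u f) t + rate powr \<gamma> * frac_difference \<gamma> (pairing u f) t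
        = minus_dx_pairing (boundary_value \<gamma> rate) u f t"
    using source_eq[of t] by auto
qed

end

end

section \<open>Subordination\<close>

text \<open>Brings the drift \<open>\<nu> = 1\<close>, for which only the values are prescribed,
  under the same facts as the random case, and admits \<open>s = t\<close> in the formula for
  increments.\<close>

lemma stable_subordinatorD:
  assumes S: "stable_subordinator M \<nu> S" and M: "prob_space M"
  shows "t \<ge> 0 \<Longrightarrow> S t \<in> borel_measurable M"
    and "\<omega> \<in> space M \<Longrightarrow> S 0 \<omega> = 0"
    and "\<omega> \<in> space M \<Longrightarrow> t \<ge> 0 \<Longrightarrow> continuous (at_right t) (\<lambda>s. S s \<omega>)"
    and "\<omega> \<in> space M \<Longrightarrow> 0 \<le> s \<Longrightarrow> s \<le> t \<Longrightarrow> S s \<omega> \<le> S t \<omega>"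
    and "0 \<le> s \<Longrightarrow> s \<le> t \<Longrightarrow> 0 \<le> \<xi> \<Longrightarrow>
      (\<integral>\<omega>. exp (- \<xi> * (S t \<omega> - S s \<omega>)) \<partial>M) = exp (- (t - s) * \<xi> powr \<nu>)"
proof -
  interpret prob_space M by fact
  have *: "S t \<omega> = t" if "\<nu> = 1" "t \<ge> 0" "\<omega> \<in> space M" for t \<omega>
    using S that by (auto simp: stable_subordinator_def)
  show "t \<ge> 0 \<Longrightarrow> S t \<in> borel_measurable M"
  proof (cases "\<nu> = 1")
    case True
    assume "t \<ge> 0"
    hence "S t \<in> borel_measurable M \<longleftrightarrow> (\<lambda>_. t) \<in> borel_measurable M"
      using * True by (intro measurable_cong) auto
    thus ?thesis by simp
  qed (use S in \<open>auto simp: stable_subordinator_def\<close>)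
  show "\<omega> \<in> space M \<Longrightarrow> S 0 \<omega> = 0"
    using S by (cases "\<nu> = 1") (auto simp: stable_subordinator_def)
  show "continuous (at_right t) (\<lambda>s. S s \<omega>)" if "\<omega> \<in> space M" "t \<ge> 0"
  proof (cases "\<nu> = 1")
    case True
    have "((\<lambda>s. S s \<omega>) \<longlongrightarrow> t) (at_right t)"
      by (rule Lim_transform_eventually[OF tendsto_ident_at])
        (use that * True in \<open>auto intro!: eventually_mono[OF eventually_at_right_less[of t]]\<close>)
    thus ?thesis using that * True by (simp add: continuous_within)
  qed (use S that in \<open>auto simp: stable_subordinator_def right_continuous_paths_def\<close>)
  show "S s \<omega> \<le> S t \<omega>" if "\<omega> \<in> space M" "0 \<le> s" "s \<le> t"
    using S that * by (cases "\<nu> = 1") (auto simp: stable_subordinator_def nondecreasing_paths_def mono_on_def)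
  show "(\<integral>\<omega>. exp (- \<xi> * (S t \<omega> - S s \<omega>)) \<partial>M) = exp (- (t - s) * \<xi> powr \<nu>)"
    if "0 \<le> s" "s \<le> t" "0 \<le> \<xi>"
  proof (cases "\<nu> = 1 \<or> s = t")
    case True
    have "(\<integral>\<omega>. exp (- \<xi> * (S t \<omega> - S s \<omega>)) \<partial>M) = (\<integral>\<omega>. exp (- (t - s) * \<xi> powr \<nu>) \<partial>M)"
      using True that * by (intro Bochner_Integration.integral_cong) (auto simp: algebra_simps)
    thus ?thesis by (simp add: prob_space)
  qed (use S that in \<open>auto simp: stable_subordinator_def\<close>)
qed

text \<open>A convergent sequence of natural numbers is eventually constant. Hence limits in time
  pass through arbitrary functions of \<open>N\<close>.\<close>

lemma eventually_eq_of_nat_right_continuous: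
  fixes n :: "real \<Rightarrow> nat"
  assumes "continuous (at_right t) (\<lambda>s. real (n s))" and "X \<longlonglongrightarrow> t" and "\<And>k. t \<le> X k"
  shows "eventually (\<lambda>k. n (X k) = n t) sequentially"
proof -
  have "{t..} - {t} = {t<..} - {t}" by auto
  hence "at t within {t..} = at_right t" by (simp only: at_within_def)
  hence "continuous (at t within {t..}) (\<lambda>s. real (n s))" using assms(1) by simp
  hence "(\<lambda>k. real (n (X k))) \<longlonglongrightarrow> real (n t)"
    by (rule continuous_within_tendsto_compose') (use assms in auto)
  hence "eventually (\<lambda>k. dist (real (n (X k))) (real (n t)) < 1) sequentially"
    by (rule tendstoD) simp
  thus ?thesis by eventually_elim (auto simp: dist_real_def)
qed

text \<open>The piece belonging to the value \<open>j\<close> of \<open>J\<close> is bounded in mean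
  by \<open>C * P(J = j)\<close>, and these bounds have a finite sum, so the integral may be taken
  piece by piece.\<close>

lemma (in prob_space) sums_integral_partition:
  fixes J :: "'a \<Rightarrow> nat" and w :: "nat \<Rightarrow> 'a \<Rightarrow> real"
  assumes J [measurable]: "J \<in> measurable M (count_space UNIV)" and w [measurable]: "\<And>j. w j \<in> borel_measurable M"
    and C: "\<And>j \<omega>. \<bar>w j \<omega>\<bar> \<le> C"
  shows "(\<lambda>j. \<integral>\<omega>. indicator {j} (J \<omega>) * w j \<omega> \<partial>M) sums (\<integral>\<omega>. w (J \<omega>) \<omega> \<partial>M)"
proof -
  define f where "f j \<omega> = indicator {j} (J \<omega>) * w j \<omega>" for j \<omega>
  have [measurable]: "f j \<in> borel_measurable M" for j
  proof -
    have "(\<lambda>\<omega>. indicat_real {j} (J \<omega>)) \<in> borel_measurable M"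
      by (rule measurable_compose[OF J]) simp
    from borel_measurable_times[OF this w] show ?thesis unfolding f_def[abs_def] .
  qed
  have C0: "C \<ge> 0" using C[of 0 undefined] by linarith
  have f_le: "norm (f j \<omega>) \<le> C * indicator {j} (J \<omega>)" for j \<omega>
    using C[of j \<omega>] by (auto simp: f_def indicator_def)
  have int: "integrable M (f j)" for j
    by (rule integrable_const_bound[of _ C]) (use C C0 in \<open>auto simp: f_def indicator_def\<close>)
  have "(\<lambda>j. measure M (J -` {j} \<inter> space M)) sums measure M (\<Union>j. J -` {j} \<inter> space M)"
    by (rule finite_measure_UNION) (auto simp: disjoint_family_on_def)
  hence summ: "summable (\<lambda>j. C * measure M (J -` {j} \<inter> space M))"
    by (intro summable_mult) (rule sums_summable)
  have "(\<integral>\<omega>. norm (f j \<omega>) \<partial>M) \<le> C * measure M (J -` {j} \<inter> space M)" for j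
  proof -
    have "(\<integral>\<omega>. norm (f j \<omega>) \<partial>M) \<le> (\<integral>\<omega>. C * indicator (J -` {j} \<inter> space M) \<omega> \<partial>M)"
    proof (rule integral_mono)
      show "integrable M (\<lambda>\<omega>. C * indicator (J -` {j} \<inter> space M) \<omega>)"
        by (intro integrable_mult_right integrable_real_indicator) (auto simp: emeasure_eq_measure)
      show "norm (f j \<omega>) \<le> C * indicator (J -` {j} \<inter> space M) \<omega>" if "\<omega> \<in> space M" for \<omega>
        using f_le[of j \<omega>] that by (auto simp: indicator_def)
    qed (use int in auto)
    thus ?thesis by simp
  qed
  hence summ': "summable (\<lambda>j. \<integral>\<omega>. norm (f j \<omega>) \<partial>M)"
    by (intro summable_comparison_test[OF _ summ]) auto
  have pt: "f j \<omega> = 0" if "j \<notin> {J \<omega>}" for j \<omega> using that by (auto simp: f_def)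
  have "(\<lambda>j. \<integral>\<omega>. f j \<omega> \<partial>M) sums (\<integral>\<omega>. (\<Sum>j. f j \<omega>) \<partial>M)"
  proof (rule sums_integral[OF int _ summ'])
    have "summable (\<lambda>j. norm (f j \<omega>))" for \<omega>
      by (rule summable_finite[of "{J \<omega>}"]) (simp_all add: pt)
    thus "AE \<omega> in M. summable (\<lambda>j. norm (f j \<omega>))" by simp
  qed
  moreover have "(\<Sum>j. f j \<omega>) = w (J \<omega>) \<omega>" for \<omega>
    using suminf_finite[of "{J \<omega>}" "\<lambda>j. f j \<omega>"] pt by (simp add: f_def)
  ultimately show ?thesis by (simp add: f_def)
qed

lemma poisson_pmf_exp:
  assumes "m > 0"
  shows "(\<integral>n. exp (- \<xi> * real n) \<partial>measure_pmf (poisson_pmf m)) = exp (- m * (1 - exp (- \<xi>)))"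
proof -
  have trm: "pmf (poisson_pmf m) n * exp (- \<xi> * real n) = exp (- m) * ((m * exp (- \<xi>)) ^ n /\<^sub>R fact n)" for n
  proof -
    have "exp (- \<xi> * real n) = exp (- \<xi>) ^ n" by (simp add: exp_of_nat_mult[symmetric] mult.commute)
    thus ?thesis using assms by (simp add: power_mult_distrib divide_inverse)
  qed
  have sums: "(\<lambda>n. pmf (poisson_pmf m) n * exp (- \<xi> * real n)) sums (exp (- m) * exp (m * exp (- \<xi>)))"
    unfolding trm by (intro sums_mult exp_converges)
  have "(\<integral>n. exp (- \<xi> * real n) \<partial>measure_pmf (poisson_pmf m))
      = (\<integral>n. pmf (poisson_pmf m) n * exp (- \<xi> * real n) \<partial>count_space UNIV)"
    by (simp add: measure_pmf_eq_density integral_density)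
  also have "\<dots> = exp (- m) * exp (m * exp (- \<xi>))"
    by (subst integral_count_space_nat)
      (use sums in \<open>auto simp: integrable_count_space_nat_iff sums_iff abs_mult simp del: pmf_poisson\<close>)
  also have "\<dots> = exp (- m * (1 - exp (- \<xi>)))"
    by (simp add: exp_add[symmetric] algebra_simps)
  finally show ?thesis .
qed

lemma emeasure_exponential_atLeast:
  assumes \<xi>: "\<xi> > 0" and y: "y \<ge> 0"
  shows "emeasure (density lborel (exponential_density \<xi>)) {y..} = ennreal (exp (- \<xi> * y))"
proof -
  have "emeasure (density lborel (exponential_density \<xi>)) {y..}
      = (\<integral>\<^sup>+t. ennreal (exponential_density \<xi> t * indicator {y..} t) \<partial>lborel)"
    by (subst emeasure_density) (auto intro!: nn_integral_cong simp: indicator_def)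
  also have "\<dots> = (\<integral>\<^sup>+t. ennreal (exponential_density \<xi> (y + 1 * t) * indicator {y..} (y + 1 * t)) \<partial>lborel)"
    by (subst nn_integral_real_affine[where c = 1 and t = y]) auto
  also have "\<dots> = (\<integral>\<^sup>+t. ennreal (exp (- \<xi> * y)) * ennreal (exponential_density \<xi> t) \<partial>lborel)"
    using \<xi> y by (intro nn_integral_cong, subst ennreal_mult[symmetric])
      (auto simp: exponential_density_def indicator_def exp_add[symmetric] algebra_simps)
  also have "\<dots> = ennreal (exp (- \<xi> * y)) * (\<integral>\<^sup>+t. ennreal (exponential_density \<xi> t) \<partial>lborel)"
    by (rule nn_integral_cmult) simp
  also have "(\<integral>\<^sup>+t. ennreal (exponential_density \<xi> t) \<partial>lborel) = 1"
    using nn_integral_erlang_ith_moment[OF \<xi>, of 0 0] by simp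
  finally show ?thesis by simp
qed

section \<open>Inverses of nondecreasing paths\<close>

definition first_passage :: "(real \<Rightarrow> real) \<Rightarrow> real \<Rightarrow> real" where
  "first_passage y t = Inf {s. 0 \<le> s \<and> y s > t}"

text \<open>By monotonicity a rational witness suffices, which makes the condition a countable union
  of events. Only the level \<open>t\<close> itself has to be exceeded, so bounded paths are covered
  as well.\<close>

lemma first_passage_less_iff':
  assumes mono: "\<And>r s. 0 \<le> r \<Longrightarrow> r \<le> s \<Longrightarrow> y r \<le> y s" and ex: "\<exists>s\<ge>0. y s > t"
  shows "first_passage y t < x \<longleftrightarrow> (\<exists>q\<in>\<rat>. 0 \<le> q \<and> q < x \<and> y q > t)"
proof -
  have "first_passage y t < x \<longleftrightarrow> (\<exists>s\<in>{s. 0 \<le> s \<and> y s > t}. s < x)"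
    unfolding first_passage_def using ex by (intro cInf_less_iff) (auto intro!: bdd_belowI[of _ 0])
  also have "\<dots> \<longleftrightarrow> (\<exists>q\<in>\<rat>. 0 \<le> q \<and> q < x \<and> y q > t)"
  proof safe
    fix s assume s: "0 \<le> s" "t < y s" "s < x"
    obtain q where q: "q \<in> \<rat>" "s < q" "q < x" using Rats_dense_in_real[OF s(3)] by blast
    have "y s \<le> y q" using s q by (intro mono) auto
    thus "\<exists>q\<in>\<rat>. 0 \<le> q \<and> q < x \<and> t < y q" using s q by (intro bexI[of _ q]) auto
  qed auto
  finally show ?thesis .
qed

context
  fixes y :: "real \<Rightarrow> real"
  assumes mono: "\<And>r s. 0 \<le> r \<Longrightarrow> r \<le> s \<Longrightarrow> y r \<le> y s"
    and unbounded: "\<And>t. \<exists>s\<ge>0. y s > t"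
begin

lemma first_passage_le: "0 \<le> s \<Longrightarrow> y s > t \<Longrightarrow> first_passage y t \<le> s"
  unfolding first_passage_def by (rule cInf_lower) (auto intro!: bdd_belowI[of _ 0])

text \<open>With \<open>less_first_passage\<close> this forms a sandwich for
  \<open>x \<ge> 0\<close>: \<open>x < first_passage y t\<close> implies \<open>y x \<le> t\<close>,
  which implies \<open>x \<le> first_passage y t\<close>. The boundary case stays open because
  \<open>y\<close> may jump; later arguments are arranged to tolerate it.\<close>

lemma first_passage_ge: "y s \<le> t \<Longrightarrow> s \<le> first_passage y t"
  unfolding first_passage_def using unbounded[of t] mono
  by (intro cInf_greatest) (auto, meson le_less_trans linear not_less)

lemma first_passage_nonneg: "0 \<le> first_passage y t"
  unfolding first_passage_def using unbounded[of t] by (intro cInf_greatest) auto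

lemma less_first_passage: "0 \<le> s \<Longrightarrow> s < first_passage y t \<Longrightarrow> y s \<le> t"
  using first_passage_le[of s t] by force

lemma first_passage_less_iff: "first_passage y t < x \<longleftrightarrow> (\<exists>q\<in>\<rat>. 0 \<le> q \<and> q < x \<and> y q > t)"
  by (rule first_passage_less_iff'[OF mono unbounded])

lemma first_passage_mono: "s \<le> t \<Longrightarrow> first_passage y s \<le> first_passage y t"
  using first_passage_nonneg[of s] less_first_passage[of _ s] first_passage_ge
  by (meson dense_ge first_passage_less_iff less_eq_real_def not_le order_le_less_trans)

text \<open>The condition \<open>y q > t\<close> for a passage is strict, hence stable under small
  increases of \<open>t\<close>.\<close>

lemma first_passage_right_continuous: "continuous (at_right t) (first_passage y)"
  unfolding continuous_within
proof (rule order_tendstoI)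
  fix a assume "a < first_passage y t"
  thus "\<forall>\<^sub>F s in at_right t. a < first_passage y s"
    using first_passage_mono
    by (intro eventually_mono[OF eventually_at_right_less[of t]]) (meson less_le_trans less_imp_le)
next
  fix a assume "first_passage y t < a"
  then obtain q where q: "0 \<le> q" "q < a" "y q > t" unfolding first_passage_less_iff by blast
  have "\<forall>\<^sub>F s in at_right t. s < y q"
    using q(3) eventually_at_right_field by blast
  thus "\<forall>\<^sub>F s in at_right t. first_passage y s < a"
    by eventually_elim (use q first_passage_le in force)
qed

text \<open>A jump of the inverse would be a flat stretch of \<open>y\<close>, which strict growth
  rules out.\<close>

lemma first_passage_continuous:
  assumes strict: "\<And>r s. 0 \<le> r \<Longrightarrow> r < s \<Longrightarrow> y r < y s"
  shows "isCont (first_passage y) t"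
  unfolding isCont_def
proof (rule order_tendstoI)
  fix a assume a: "a < first_passage y t"
  show "\<forall>\<^sub>F s in at t. a < first_passage y s"
  proof (cases "a < 0")
    case True thus ?thesis using first_passage_nonneg by (auto intro: always_eventually less_le_trans)
  next
    case False
    obtain p where p: "a < p" "p < first_passage y t" using dense[OF a] by blast
    obtain q where q: "p < q" "q < first_passage y t" using dense[OF p(2)] by blast
    have "y p < t" using strict[of p q] less_first_passage[of q t] p q False by force
    hence "\<forall>\<^sub>F s in at t. y p < s"
      using order_tendstoD(1)[OF tendsto_ident_at] by blast
    thus ?thesis by eventually_elim (rule less_le_trans[OF p(1) first_passage_ge], simp)
  qed
next
  fix a assume "first_passage y t < a"
  then obtain q where q: "0 \<le> q" "q < a" "y q > t" unfolding first_passage_less_iff by blast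
  have "\<forall>\<^sub>F s in at t. s < y q"
    using order_tendstoD(2)[OF tendsto_ident_at q(3)] .
  thus "\<forall>\<^sub>F s in at t. first_passage y s < a"
    by eventually_elim (use q first_passage_le in force)
qed

lemma first_passage_0:
  assumes strict: "\<And>r s. 0 \<le> r \<Longrightarrow> r < s \<Longrightarrow> y r < y s" and "y 0 = 0"
  shows "first_passage y 0 = 0"
proof (rule antisym[OF _ first_passage_nonneg])
  have "first_passage y 0 \<le> s" if "s > 0" for s
    using strict[of 0 s] that assms(2) by (intro first_passage_le) auto
  thus "first_passage y 0 \<le> 0" by (rule dense_ge)
qed

end

section \<open>The law of the hitting time\<close>

lemma exp_neg_powr_tendsto_0:
  fixes c p :: real
  assumes "c > 0" "p > 0"
  shows "(\<lambda>n. exp (- c * real n powr p)) \<longlonglongrightarrow> 0"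
proof -
  have "filterlim (\<lambda>n. exp (p * ln (real n))) at_top sequentially"
    using assms(2) by (intro filterlim_compose[OF exp_at_top] filterlim_tendsto_pos_mult_at_top[OF tendsto_const]
      filterlim_compose[OF ln_at_top filterlim_real_sequentially])
  moreover have ev: "\<forall>\<^sub>F n in sequentially. exp (p * ln (real n)) = real n powr p"
    using eventually_gt_at_top[of 0] by eventually_elim (simp add: powr_def)
  ultimately have "filterlim (\<lambda>n. real n powr p) at_top sequentially"
    by (simp only: filterlim_cong[OF refl refl ev])
  hence "filterlim (\<lambda>n. - c * real n powr p) at_bot sequentially"
    using assms(1) by (intro filterlim_tendsto_neg_mult_at_bot[OF tendsto_const]) auto
  thus ?thesis by (rule filterlim_compose[OF exp_at_bot])
qed

lemma (in pair_sigma_finite) AE_pair_snd: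
  assumes "AE y in M2. Q y"
  shows "AE z in M1 \<Otimes>\<^sub>M M2. Q (snd z)"
proof -
  obtain S where S: "{y \<in> space M2. \<not> Q y} \<subseteq> S" "emeasure M2 S = 0" "S \<in> sets M2"
    using assms by (rule AE_E)
  show ?thesis
  proof (rule AE_I)
    show "{z \<in> space (M1 \<Otimes>\<^sub>M M2). \<not> Q (snd z)} \<subseteq> space M1 \<times> S"
      using S(1) by (auto simp: space_pair_measure)
    show "emeasure (M1 \<Otimes>\<^sub>M M2) (space M1 \<times> S) = 0"
      using S by (simp add: M2.emeasure_pair_measure_Times)
  qed (use S(3) in simp)
qed

section \<open>The subordinated process and its Laplace exponent\<close>

locale hitting_setup = prob_space M + equation_parameters b \<beta> \<gamma> rate
  for M :: "'a measure" and b \<beta> \<gamma> rate :: real +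
  fixes N :: "real \<Rightarrow> 'a \<Rightarrow> nat" and A B :: "real \<Rightarrow> 'a \<Rightarrow> real"
  assumes N: "poisson_process M rate N"
    and A: "stable_subordinator M \<gamma> A"
    and B: "stable_subordinator M \<beta> B"
    and indep: "independent_processes M [\<lambda>t \<omega>. real (N t \<omega>), A, B]"
begin

lemmas A_meas = stable_subordinatorD(1)[OF A prob_space_axioms]
  and A_0 = stable_subordinatorD(2)[OF A prob_space_axioms]
  and A_mono = stable_subordinatorD(4)[OF A prob_space_axioms]
  and A_exp = stable_subordinatorD(5)[OF A prob_space_axioms]
  and B_meas = stable_subordinatorD(1)[OF B prob_space_axioms]
  and B_0 = stable_subordinatorD(2)[OF B prob_space_axioms]
  and B_mono = stable_subordinatorD(4)[OF B prob_space_axioms]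
  and B_exp = stable_subordinatorD(5)[OF B prob_space_axioms]

lemma A_nonneg: "\<omega> \<in> space M \<Longrightarrow> 0 \<le> t \<Longrightarrow> 0 \<le> A t \<omega>"
  using A_mono[of \<omega> 0 t] A_0[of \<omega>] by simp

lemma B_nonneg: "\<omega> \<in> space M \<Longrightarrow> 0 \<le> t \<Longrightarrow> 0 \<le> B t \<omega>"
  using B_mono[of \<omega> 0 t] B_0[of \<omega>] by simp

lemma A_laplace: "0 \<le> t \<Longrightarrow> 0 \<le> \<xi> \<Longrightarrow> (\<integral>\<omega>. exp (- \<xi> * A t \<omega>) \<partial>M) = exp (- t * \<xi> powr \<gamma>)"
  using A_exp[of 0 t \<xi>] by (simp add: A_0 cong: Bochner_Integration.integral_cong)

lemma B_laplace: "0 \<le> t \<Longrightarrow> 0 \<le> \<xi> \<Longrightarrow> (\<integral>\<omega>. exp (- \<xi> * B t \<omega>) \<partial>M) = exp (- t * \<xi> powr \<beta>)"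
  using B_exp[of 0 t \<xi>] by (simp add: B_0 cong: Bochner_Integration.integral_cong)

lemma N_meas: "t \<ge> 0 \<Longrightarrow> N t \<in> measurable M (count_space UNIV)"
  and N_0: "\<omega> \<in> space M \<Longrightarrow> N 0 \<omega> = 0"
  and N_rc: "\<omega> \<in> space M \<Longrightarrow> t \<ge> 0 \<Longrightarrow> continuous (at_right t) (\<lambda>s. real (N s \<omega>))"
  and N_mono: "\<omega> \<in> space M \<Longrightarrow> 0 \<le> s \<Longrightarrow> s \<le> t \<Longrightarrow> N s \<omega> \<le> N t \<omega>"
  and N_distr: "0 < t \<Longrightarrow> distr M (count_space UNIV) (\<lambda>\<omega>. N t \<omega> - N 0 \<omega>) = measure_pmf (poisson_pmf (rate * t))"
  using N by (auto simp: poisson_process_def right_continuous_paths_def nondecreasing_paths_def mono_on_def)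

lemma N_expectation:
  fixes q :: "nat \<Rightarrow> real"
  assumes "t > 0"
  shows "(\<integral>\<omega>. q (N t \<omega>) \<partial>M) = (\<integral>n. q n \<partial>measure_pmf (poisson_pmf (rate * t)))"
proof -
  have [measurable]: "N t \<in> measurable M (count_space UNIV)" "N 0 \<in> measurable M (count_space UNIV)"
    using assms by (auto intro: N_meas)
  have "(\<integral>n. q n \<partial>measure_pmf (poisson_pmf (rate * t))) = (\<integral>\<omega>. q (N t \<omega> - N 0 \<omega>) \<partial>M)"
    unfolding N_distr[OF assms, symmetric] by (subst integral_distr) auto
  also have "\<dots> = (\<integral>\<omega>. q (N t \<omega>) \<partial>M)"
    by (intro Bochner_Integration.integral_cong) (auto simp: N_0)
  finally show ?thesis by simp
qed

lemma N_laplace: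
  assumes "t \<ge> 0"
  shows "(\<integral>\<omega>. exp (- \<xi> * real (N t \<omega>)) \<partial>M) = exp (- (rate * (1 - exp (- \<xi>))) * t)"
proof (cases "t = 0")
  case True
  have "(\<integral>\<omega>. exp (- \<xi> * real (N t \<omega>)) \<partial>M) = (\<integral>\<omega>. 1 \<partial>M)"
    using True by (intro Bochner_Integration.integral_cong) (auto simp: N_0)
  thus ?thesis using True by (simp add: prob_space)
next
  case False
  hence "t > 0" using assms by simp
  thus ?thesis
    using N_expectation[of t "\<lambda>n. exp (- \<xi> * real n)"] poisson_pmf_exp[of "rate * t" \<xi>] rate
    by (simp add: mult_ac)
qed

definition K :: "real \<Rightarrow> 'a \<Rightarrow> nat" where "K x \<omega> = N (A x \<omega>) \<omega>"

definition Y :: "real \<Rightarrow> 'a \<Rightarrow> real" where "Y x \<omega> = real (K x \<omega>) + b * B x \<omega>"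

text \<open>\<open>N\<close> is evaluated at a random time, so its joint measurability in time and
  chance is composed with the map from \<open>\<omega>\<close> to
  \<open>(A x \<omega>, \<omega>)\<close>.\<close>

lemma K_meas:
  assumes "x \<ge> 0"
  shows "K x \<in> measurable M (count_space UNIV)"
proof -
  have [measurable]: "A x \<in> borel_measurable M" by (rule A_meas[OF assms])
  have "(\<lambda>(t, \<omega>). real (N (max 0 t) \<omega>)) \<in> borel_measurable (borel \<Otimes>\<^sub>M M)"
    using N_meas by (intro right_continuous_joint_measurable N_rc measurable_compose[OF N_meas]) auto
  moreover have "(\<lambda>\<omega>. (A x \<omega>, \<omega>)) \<in> measurable M (borel \<Otimes>\<^sub>M M)" by measurable
  ultimately have "(\<lambda>\<omega>. real (N (max 0 (A x \<omega>)) \<omega>)) \<in> borel_measurable M"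
    by (auto dest: measurable_compose[rotated])
  hence "(\<lambda>\<omega>. nat \<lfloor>real (N (max 0 (A x \<omega>)) \<omega>)\<rfloor>) \<in> measurable M (count_space UNIV)"
    by measurable
  also have "?this \<longleftrightarrow> ?thesis"
    using A_nonneg[OF _ assms] by (intro measurable_cong) (auto simp: K_def max_def)
  finally show ?thesis .
qed

lemma Y_meas:
  assumes "x \<ge> 0"
  shows "Y x \<in> borel_measurable M"
proof -
  have [measurable]: "K x \<in> measurable M (count_space UNIV)" "B x \<in> borel_measurable M"
    using assms by (auto intro: K_meas B_meas)
  show ?thesis unfolding Y_def[abs_def] by measurable
qed

lemma Y_0: "\<omega> \<in> space M \<Longrightarrow> Y 0 \<omega> = 0"
  by (simp add: Y_def K_def A_0 B_0 N_0)

lemma Y_mono: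
  assumes "\<omega> \<in> space M" "0 \<le> r" "r \<le> s"
  shows "Y r \<omega> \<le> Y s \<omega>"
  unfolding Y_def K_def using assms b
  by (intro add_mono mult_left_mono B_mono of_nat_mono N_mono A_mono A_nonneg) auto

lemma Y_nonneg: "\<omega> \<in> space M \<Longrightarrow> 0 \<le> s \<Longrightarrow> 0 \<le> Y s \<omega>"
  using Y_mono[of \<omega> 0 s] Y_0[of \<omega>] by simp

text \<open>Independence of whole paths, evaluated at one time per process. The time of
  \<open>N\<close> is separate from that of \<open>A\<close> and \<open>B\<close>, so that it can
  later run over the grid points approximating \<open>A x\<close>.\<close>

lemma independent_expectation:
  fixes q g r :: "real \<Rightarrow> real"
  assumes t: "t \<ge> 0" and x: "x \<ge> 0"
    and [measurable]: "q \<in> borel_measurable borel" "g \<in> borel_measurable borel" "r \<in> borel_measurable borel"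
    and bounds: "\<And>y. \<bar>q y\<bar> \<le> C" "\<And>y. \<bar>g y\<bar> \<le> D" "\<And>y. \<bar>r y\<bar> \<le> E"
  shows "(\<integral>\<omega>. q (real (N t \<omega>)) * g (A x \<omega>) * r (B x \<omega>) \<partial>M)
    = (\<integral>\<omega>. q (real (N t \<omega>)) \<partial>M) * (\<integral>\<omega>. g (A x \<omega>) \<partial>M) * (\<integral>\<omega>. r (B x \<omega>) \<partial>M)"
proof -
  define Xs where "Xs = [\<lambda>t \<omega>. real (N t \<omega>), A, B]"
  define time where "time i = (if i = (0::nat) then t else x)" for i
  define fn where "fn i = (if i = (0::nat) then q else if i = 1 then g else r)" for i
  define Z where "Z i \<omega> = fn i ((Xs ! i) (time i) \<omega>)" for i \<omega>
  have time: "time i \<in> {0..}" for i using t x by (simp add: time_def)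
  have [measurable]: "fn i \<in> borel_measurable borel" for i by (simp add: fn_def)
  have "indep_vars (\<lambda>_. PiM {0..} (\<lambda>_. borel)) (\<lambda>i \<omega>. \<lambda>t\<in>{0..}. (Xs ! i) t \<omega>) {..<3}"
    using indep by (simp add: independent_processes_def Xs_def numeral_3_eq_3)
  hence "indep_vars (\<lambda>_. borel) (\<lambda>i \<omega>. fn i ((\<lambda>t\<in>{0..}. (Xs ! i) t \<omega>) (time i))) {..<3}"
    by (rule indep_vars_compose2[where Y = "\<lambda>i p. fn i (p (time i))"])
      (rule measurable_compose[OF measurable_component_singleton[OF time]], simp)
  hence ind: "indep_vars (\<lambda>_. borel) Z {..<3}"
    using time by (simp add: Z_def[abs_def] del: atLeast_iff)
  have "\<bar>Z i \<omega>\<bar> \<le> \<bar>C\<bar> + \<bar>D\<bar> + \<bar>E\<bar>" for i \<omega>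
  proof -
    have "\<bar>q y\<bar> \<le> \<bar>C\<bar> + \<bar>D\<bar> + \<bar>E\<bar>" "\<bar>g y\<bar> \<le> \<bar>C\<bar> + \<bar>D\<bar> + \<bar>E\<bar>" "\<bar>r y\<bar> \<le> \<bar>C\<bar> + \<bar>D\<bar> + \<bar>E\<bar>" for y
      using bounds(1)[of y] bounds(2)[of y] bounds(3)[of y] by linarith+
    thus ?thesis by (simp add: Z_def fn_def)
  qed
  hence int: "integrable M (Z i)" if "i < 3" for i
    using ind that by (intro integrable_const_bound[of _ "\<bar>C\<bar> + \<bar>D\<bar> + \<bar>E\<bar>"]) (auto simp: indep_vars_def)
  have three: "{..<3::nat} = {0, 1, 2}" by auto
  have "(\<integral>\<omega>. (\<Prod>i<3. Z i \<omega>) \<partial>M) = (\<Prod>i<3. \<integral>\<omega>. Z i \<omega> \<partial>M)"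
    by (rule indep_vars_lebesgue_integral) (use ind int in auto)
  thus ?thesis unfolding three by (simp add: Z_def fn_def Xs_def time_def mult.assoc)
qed

text \<open>Conditioning on \<open>A\<close>: it is approximated from above by variables with values in a
  countable set, where only the independence of single times is needed.\<close>

lemma subordinated_expectation:
  fixes q :: "nat \<Rightarrow> real" and r :: "real \<Rightarrow> real"
  assumes x: "x \<ge> 0" and [measurable]: "r \<in> borel_measurable borel"
    and q: "\<And>n. \<bar>q n\<bar> \<le> C" and r: "\<And>y. \<bar>r y\<bar> \<le> D"
  defines "G \<equiv> \<lambda>a. \<integral>\<omega>. q (N a \<omega>) \<partial>M"
  shows "(\<integral>\<omega>. q (K x \<omega>) * r (B x \<omega>) \<partial>M) = (\<integral>\<omega>. G (A x \<omega>) \<partial>M) * (\<integral>\<omega>. r (B x \<omega>) \<partial>M)"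
proof -
  have [measurable]: "A x \<in> borel_measurable M" "B x \<in> borel_measurable M" "K x \<in> measurable M (count_space UNIV)"
    using x by (auto intro: A_meas B_meas K_meas)
  have C0: "C \<ge> 0" and D0: "D \<ge> 0" using q[of 0] r[of 0] by linarith+
  \<comment> \<open>\<open>J k\<close> numbers the grid cell that contains \<open>A x\<close>, and
    \<open>v k j\<close> is the right end of cell \<open>j\<close>. So
    \<open>v k (J k \<omega>)\<close> approximates \<open>A x \<omega>\<close> strictly from above,
    where the right continuity of \<open>N\<close> applies.\<close>
  define J where "J k \<omega> = nat \<lfloor>real (Suc k) * A x \<omega>\<rfloor>" for k \<omega>
  define v where "v k j = (real j + 1) / real (Suc k)" for k j
  have J[measurable]: "J k \<in> measurable M (count_space UNIV)" for k unfolding J_def[abs_def] by measurable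
  have v0: "v k j \<ge> 0" for k j by (simp add: v_def)
  have up: "v k (J k \<omega>) = up_approx k (A x \<omega>)" if "\<omega> \<in> space M" for k \<omega>
    using A_nonneg[OF that x] by (simp add: v_def J_def up_approx_def)
  have N_v[measurable]: "N (v k j) \<in> measurable M (count_space UNIV)" for k j
    by (rule N_meas[OF v0])
  have NvJ: "(\<lambda>\<omega>. N (v k (J k \<omega>)) \<omega>) \<in> measurable M (count_space UNIV)" for k
    by (rule measurable_compose_countable[OF N_v J])
  have G_bound: "\<bar>G a\<bar> \<le> C" if "a \<ge> 0" for a
  proof -
    have [measurable]: "N a \<in> measurable M (count_space UNIV)" by (rule N_meas[OF that])
    have "\<bar>G a\<bar> \<le> (\<integral>\<omega>. \<bar>q (N a \<omega>)\<bar> \<partial>M)" unfolding G_def by (rule integral_abs_bound)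
    also have "\<dots> \<le> (\<integral>\<omega>. C \<partial>M)"
      by (rule integral_mono) (auto intro!: integrable_const_bound[of _ C] q simp: C0)
    finally show ?thesis by (simp add: prob_space)
  qed
  have discrete: "(\<integral>\<omega>. q (N (v k (J k \<omega>)) \<omega>) * r (B x \<omega>) \<partial>M) = (\<integral>\<omega>. G (v k (J k \<omega>)) \<partial>M) * (\<integral>\<omega>. r (B x \<omega>) \<partial>M)" for k
  proof -
    have "(\<lambda>j. \<integral>\<omega>. indicator {j} (J k \<omega>) * (q (N (v k j) \<omega>) * r (B x \<omega>)) \<partial>M)
        sums (\<integral>\<omega>. q (N (v k (J k \<omega>)) \<omega>) * r (B x \<omega>) \<partial>M)"
      by (rule sums_integral_partition[OF J, where C = "C * D" and w = "\<lambda>j \<omega>. q (N (v k j) \<omega>) * r (B x \<omega>)"])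
        (auto simp: abs_mult intro!: mult_mono q r C0)
    moreover have "(\<lambda>j. (\<integral>\<omega>. indicator {j} (J k \<omega>) * G (v k j) \<partial>M) * (\<integral>\<omega>. r (B x \<omega>) \<partial>M))
        sums ((\<integral>\<omega>. G (v k (J k \<omega>)) \<partial>M) * (\<integral>\<omega>. r (B x \<omega>) \<partial>M))"
      by (rule sums_mult2, rule sums_integral_partition[OF J, where C = C and w = "\<lambda>j _. G (v k j)"])
        (auto intro: G_bound v0)
    \<comment> \<open>The floor functions rewrite a function of the count and the event
      \<open>J k = j\<close> as Borel functions of the real-valued variables
      \<open>N (v k j)\<close> and \<open>A x\<close>.\<close>
    moreover have "(\<integral>\<omega>. indicator {j} (J k \<omega>) * (q (N (v k j) \<omega>) * r (B x \<omega>)) \<partial>M)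
        = (\<integral>\<omega>. indicator {j} (J k \<omega>) * G (v k j) \<partial>M) * (\<integral>\<omega>. r (B x \<omega>) \<partial>M)" for j
      using independent_expectation[OF v0 x, of "\<lambda>y. q (nat \<lfloor>y\<rfloor>)" "\<lambda>y. indicat_real {j} (nat \<lfloor>real (Suc k) * y\<rfloor>)" r C 1 D k j]
      by (simp add: q r J_def G_def mult_ac indicator_def)
    ultimately show ?thesis using sums_unique2 by simp
  qed
  \<comment> \<open>Two sample points, one for the random time and one for the path of
    \<open>N\<close>: equal points serve the left side of the claim, separate ones the inner
    integral \<open>G\<close>.\<close>
  have N_lim: "eventually (\<lambda>k. N (v k (J k \<omega>)) \<omega>' = N (A x \<omega>) \<omega>') sequentially"
    if "\<omega> \<in> space M" "\<omega>' \<in> space M" for \<omega> \<omega>'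
    unfolding up[OF that(1)]
    by (rule eventually_eq_of_nat_right_continuous[OF N_rc])
      (use that A_nonneg x up_approx_tendsto less_imp_le[OF up_approx_gt] in auto)
  have lhs: "(\<lambda>k. \<integral>\<omega>. q (N (v k (J k \<omega>)) \<omega>) * r (B x \<omega>) \<partial>M) \<longlonglongrightarrow> (\<integral>\<omega>. q (K x \<omega>) * r (B x \<omega>) \<partial>M)"
  proof (rule integral_dominated_convergence[where w = "\<lambda>_. C * D"])
    show "(\<lambda>\<omega>. q (N (v k (J k \<omega>)) \<omega>) * r (B x \<omega>)) \<in> borel_measurable M" for k
      using measurable_compose[OF NvJ, of q borel] by simp
    show "AE \<omega> in M. (\<lambda>k. q (N (v k (J k \<omega>)) \<omega>) * r (B x \<omega>)) \<longlonglongrightarrow> q (K x \<omega>) * r (B x \<omega>)"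
    proof (rule AE_I2)
      fix \<omega> assume "\<omega> \<in> space M"
      from N_lim[OF this this]
      have "\<forall>\<^sub>F k in sequentially. q (N (v k (J k \<omega>)) \<omega>) * r (B x \<omega>) = q (K x \<omega>) * r (B x \<omega>)"
        by eventually_elim (simp add: K_def)
      thus "(\<lambda>k. q (N (v k (J k \<omega>)) \<omega>) * r (B x \<omega>)) \<longlonglongrightarrow> q (K x \<omega>) * r (B x \<omega>)"
        by (rule tendsto_eventually)
    qed
  qed (auto simp: abs_mult intro!: mult_mono q r C0)
  have "(\<lambda>k. \<integral>\<omega>. G (v k (J k \<omega>)) \<partial>M) \<longlonglongrightarrow> (\<integral>\<omega>. G (A x \<omega>) \<partial>M)"
  proof -
    have lim: "(\<lambda>k. G (v k (J k \<omega>))) \<longlonglongrightarrow> G (A x \<omega>)" if \<omega>: "\<omega> \<in> space M" for \<omega>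
      unfolding G_def
    proof (rule integral_dominated_convergence[where w = "\<lambda>_. C"])
      have [measurable]: "N (A x \<omega>) \<in> measurable M (count_space UNIV)"
        by (rule N_meas[OF A_nonneg[OF \<omega> x]])
      show "(\<lambda>\<omega>'. q (N (A x \<omega>) \<omega>')) \<in> borel_measurable M" by measurable
      show "AE \<omega>' in M. (\<lambda>k. q (N (v k (J k \<omega>)) \<omega>')) \<longlonglongrightarrow> q (N (A x \<omega>) \<omega>')"
      proof (rule AE_I2)
        fix \<omega>' assume "\<omega>' \<in> space M"
        from N_lim[OF \<omega> this]
        have "\<forall>\<^sub>F k in sequentially. q (N (v k (J k \<omega>)) \<omega>') = q (N (A x \<omega>) \<omega>')"
          by eventually_elim simp
        thus "(\<lambda>k. q (N (v k (J k \<omega>)) \<omega>')) \<longlonglongrightarrow> q (N (A x \<omega>) \<omega>')"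
          by (rule tendsto_eventually)
      qed
    qed (auto intro: q)
    have meas: "(\<lambda>\<omega>. G (v k (J k \<omega>))) \<in> borel_measurable M" for k
      using measurable_compose[OF J, of "\<lambda>j. G (v k j)" borel] by simp
    show ?thesis
    proof (rule integral_dominated_convergence[where w = "\<lambda>_. C"])
      show "(\<lambda>\<omega>. G (A x \<omega>)) \<in> borel_measurable M"
        by (rule borel_measurable_LIMSEQ_real[OF lim meas])
    qed (use lim meas in \<open>auto intro: G_bound v0\<close>)
  qed
  hence "(\<lambda>k. (\<integral>\<omega>. G (v k (J k \<omega>)) \<partial>M) * (\<integral>\<omega>. r (B x \<omega>) \<partial>M)) \<longlonglongrightarrow> (\<integral>\<omega>. G (A x \<omega>) \<partial>M) * (\<integral>\<omega>. r (B x \<omega>) \<partial>M)"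
    by (rule tendsto_mult_right)
  with lhs show ?thesis unfolding discrete by (rule LIMSEQ_unique)
qed

lemma Y_laplace:
  assumes x: "x \<ge> 0" and \<xi>: "\<xi> > 0"
  shows "(\<integral>\<omega>. exp (- \<xi> * Y x \<omega>) \<partial>M) = exp (- x * exponent \<xi>)"
proof -
  \<comment> \<open>The function applied to \<open>B x\<close> must be bounded on the whole line;
    hence the \<open>max 0\<close>, which changes nothing at nonnegative values.\<close>
  have "(\<integral>\<omega>. exp (- \<xi> * Y x \<omega>) \<partial>M) = (\<integral>\<omega>. exp (- \<xi> * real (K x \<omega>)) * exp (- (\<xi> * b) * max 0 (B x \<omega>)) \<partial>M)"
    using B_nonneg[OF _ x]
    by (intro Bochner_Integration.integral_cong) (auto simp: Y_def exp_add[symmetric] algebra_simps max_def)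
  also have "\<dots> = (\<integral>\<omega>. (\<integral>\<omega>'. exp (- \<xi> * real (N (A x \<omega>) \<omega>')) \<partial>M) \<partial>M) * (\<integral>\<omega>. exp (- (\<xi> * b) * max 0 (B x \<omega>)) \<partial>M)"
    by (rule subordinated_expectation[OF x, where C = 1 and D = 1]) (use \<xi> b in auto)
  also have "(\<integral>\<omega>. (\<integral>\<omega>'. exp (- \<xi> * real (N (A x \<omega>) \<omega>')) \<partial>M) \<partial>M) = (\<integral>\<omega>. exp (- (rate * (1 - exp (- \<xi>))) * A x \<omega>) \<partial>M)"
    by (intro Bochner_Integration.integral_cong refl N_laplace A_nonneg x)
  also have "\<dots> = exp (- x * (rate * (1 - exp (- \<xi>))) powr \<gamma>)"
    using rate \<xi> by (intro A_laplace x) auto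
  also have "(\<integral>\<omega>. exp (- (\<xi> * b) * max 0 (B x \<omega>)) \<partial>M) = (\<integral>\<omega>. exp (- (\<xi> * b) * B x \<omega>) \<partial>M)"
    using B_nonneg[OF _ x] by (intro Bochner_Integration.integral_cong) auto
  also have "\<dots> = exp (- x * (\<xi> * b) powr \<beta>)"
    using b \<xi> by (intro B_laplace x) auto
  also have "exp (- x * (rate * (1 - exp (- \<xi>))) powr \<gamma>) * exp (- x * (\<xi> * b) powr \<beta>) = exp (- x * exponent \<xi>)"
  proof -
    have "(rate * (1 - exp (- \<xi>))) powr \<gamma> = rate powr \<gamma> * (1 - exp (- \<xi>)) powr \<gamma>"
      "(\<xi> * b) powr \<beta> = b powr \<beta> * \<xi> powr \<beta>"
      using rate b \<xi> by (auto simp: powr_mult mult.commute)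
    thus ?thesis by (simp add: exponent_def exp_add[symmetric] distrib_left)
  qed
  finally show ?thesis .
qed

text \<open>Markov's inequality for \<open>exp (- \<xi> * Y x)\<close>.\<close>

lemma Y_laplace_bound:
  assumes x: "x \<ge> 0" and \<xi>: "\<xi> > 0"
  shows "prob {\<omega> \<in> space M. Y x \<omega> \<le> m} \<le> exp (\<xi> * m) * exp (- x * exponent \<xi>)"
proof -
  have [measurable]: "Y x \<in> borel_measurable M" by (rule Y_meas[OF x])
  have "prob {\<omega> \<in> space M. Y x \<omega> \<le> m} = (\<integral>\<omega>. indicat_real {\<omega> \<in> space M. Y x \<omega> \<le> m} \<omega> \<partial>M)"
    by simp
  also have "\<dots> \<le> (\<integral>\<omega>. exp (\<xi> * m) * exp (- \<xi> * Y x \<omega>) \<partial>M)"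
  proof (rule integral_mono)
    show "integrable M (\<lambda>\<omega>. exp (\<xi> * m) * exp (- \<xi> * Y x \<omega>))"
      by (intro integrable_mult_right integrable_const_bound[of _ 1] AE_I2) (use \<xi> x Y_nonneg in auto)
    show "indicat_real {\<omega> \<in> space M. Y x \<omega> \<le> m} \<omega> \<le> exp (\<xi> * m) * exp (- \<xi> * Y x \<omega>)" for \<omega>
      using \<xi> by (auto simp: indicator_def exp_add[symmetric] mult_le_cancel_left_pos)
  qed (auto simp: emeasure_eq_measure)
  also have "\<dots> = exp (\<xi> * m) * exp (- x * exponent \<xi>)"
    using Y_laplace[OF x \<xi>] by simp
  finally show ?thesis .
qed

text \<open>The preceding bound at \<open>\<xi> = 1\<close> decays exponentially along integer
  times, so almost surely no integer level confines the path. Countably many levels leave one null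
  set for all \<open>t\<close>.\<close>

lemma Y_unbounded: "AE \<omega> in M. \<forall>t. \<exists>s\<ge>0. Y s \<omega> > t"
proof -
  have "AE \<omega> in M. \<exists>n::nat. Y (real n) \<omega> > real m" for m :: nat
  proof -
    have [measurable]: "Y (real n) \<in> borel_measurable M" for n by (rule Y_meas) simp
    have e: "exponent 1 > 0" by (rule exponent_pos) simp
    have "prob {\<omega> \<in> space M. \<forall>n. Y (real n) \<omega> \<le> real m} \<le> exp (real m) * exp (- real n * exponent 1)" for n
    proof -
      have "prob {\<omega> \<in> space M. \<forall>n. Y (real n) \<omega> \<le> real m} \<le> prob {\<omega> \<in> space M. Y (real n) \<omega> \<le> real m}"
        by (rule finite_measure_mono) auto
      also have "\<dots> \<le> exp (1 * real m) * exp (- real n * exponent 1)"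
        by (rule Y_laplace_bound) auto
      finally show ?thesis by simp
    qed
    moreover have "(\<lambda>n. exp (real m) * exp (- real n * exponent 1)) \<longlonglongrightarrow> exp (real m) * 0"
    proof (intro tendsto_mult tendsto_const)
      have "exp (- real n * exponent 1) = exp (- exponent 1) ^ n" for n
        by (simp add: exp_of_nat_mult[symmetric])
      moreover have "(\<lambda>n. exp (- exponent 1) ^ n) \<longlonglongrightarrow> 0"
        using e by (intro LIMSEQ_realpow_zero) auto
      ultimately show "(\<lambda>n. exp (- real n * exponent 1)) \<longlonglongrightarrow> 0" by simp
    qed
    ultimately have "prob {\<omega> \<in> space M. \<forall>n. Y (real n) \<omega> \<le> real m} \<le> 0"
      using LIMSEQ_le_const by fastforce
    hence "prob {\<omega> \<in> space M. \<forall>n. Y (real n) \<omega> \<le> real m} = 0"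
      using measure_nonneg by (simp add: antisym)
    hence "emeasure M {\<omega> \<in> space M. \<forall>n. Y (real n) \<omega> \<le> real m} = 0" by (simp add: emeasure_eq_measure)
    thus ?thesis by (intro AE_I[of _ _ "{\<omega> \<in> space M. \<forall>n. Y (real n) \<omega> \<le> real m}"]) (auto simp: not_less)
  qed
  hence "AE \<omega> in M. \<forall>m. \<exists>n::nat. Y (real n) \<omega> > real m" by (simp add: AE_all_countable)
  thus ?thesis
  proof eventually_elim
    case (elim \<omega>)
    show ?case
    proof
      fix t
      obtain m where "t < real m" using reals_Archimedean2 by blast
      thus "\<exists>s\<ge>0. Y s \<omega> > t" using elim by (metis less_trans of_nat_0_le_iff)
    qed
  qed
qed

section \<open>The hitting time as a random variable\<close>

abbreviation "hit \<equiv> hitting_time N A b B"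

lemma hit_eq: "hit t \<omega> = first_passage (\<lambda>s. Y s \<omega>) t"
  by (simp add: hitting_time_def first_passage_def Y_def K_def)

text \<open>Joint measurability in \<open>t\<close> and \<open>\<omega>\<close> prepares the
  evaluation at an independent random time. On paths that never exceed \<open>t\<close> the value is
  the unspecified constant \<open>Inf {}\<close>; it is carried along as a separate measurable case
  instead of being discarded as a null event.\<close>

lemma hit_joint_measurable: "(\<lambda>(t, \<omega>). hit t \<omega>) \<in> borel_measurable (borel \<Otimes>\<^sub>M M)"
  unfolding borel_measurable_iff_less
proof
  fix x :: real
  have [measurable]: "Y q \<in> borel_measurable M" if "q \<ge> 0" for q by (rule Y_meas[OF that])
  have pred_Y [measurable]: "Measurable.pred (borel \<Otimes>\<^sub>M M) (\<lambda>z. Y q (snd z) > fst z)" if "q \<ge> 0" for q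
    using that by measurable
  define Q where "Q = {q \<in> \<rat>. 0 \<le> q \<and> q < x}"
  have "countable Q" unfolding Q_def by (rule countable_subset[OF _ countable_rat]) auto
  hence "(\<Union>q\<in>Q. {z \<in> space (borel \<Otimes>\<^sub>M M). Y q (snd z) > fst z}) \<in> sets (borel \<Otimes>\<^sub>M M)"
    by (rule sets.countable_UN') (use pred_Y in \<open>auto simp: Q_def pred_def\<close>)
  also have "(\<Union>q\<in>Q. {z \<in> space (borel \<Otimes>\<^sub>M M). Y q (snd z) > fst z})
      = {z \<in> space (borel \<Otimes>\<^sub>M M). \<exists>q\<in>Q. Y q (snd z) > fst z}" by auto
  finally have [measurable]: "Measurable.pred (borel \<Otimes>\<^sub>M M) (\<lambda>z. \<exists>q\<in>Q. Y q (snd z) > fst z)"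
    by (simp add: pred_def)
  \<comment> \<open>By monotonicity integer times already decide whether the level is ever exceeded,
    which makes the case distinction measurable.\<close>
  have "{z \<in> space (borel \<Otimes>\<^sub>M M). (case z of (t, \<omega>) \<Rightarrow> hit t \<omega>) < x}
    = {z \<in> space (borel \<Otimes>\<^sub>M M). if \<exists>n::nat. Y (real n) (snd z) > fst z then \<exists>q\<in>Q. Y q (snd z) > fst z else Inf {} < x}"
  proof (intro Collect_cong conj_cong refl)
    fix z :: "real \<times> 'a" assume "z \<in> space (borel \<Otimes>\<^sub>M M)"
    then obtain t \<omega> where z: "z = (t, \<omega>)" and \<omega>: "\<omega> \<in> space M" by (auto simp: space_pair_measure)
    show "((case z of (t, \<omega>) \<Rightarrow> hit t \<omega>) < x) = (if \<exists>n::nat. Y (real n) (snd z) > fst z then \<exists>q\<in>Q. Y q (snd z) > fst z else Inf {} < x)"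
    proof (cases "\<exists>s\<ge>0. Y s \<omega> > t")
      case True
      then obtain s where s: "s \<ge> 0" "Y s \<omega> > t" by blast
      obtain n :: nat where "s \<le> real n" using real_arch_simple by blast
      hence "\<exists>n::nat. Y (real n) \<omega> > t" using Y_mono[OF \<omega> s(1), of "real n"] s(2) by (intro exI[of _ n]) auto
      moreover have "hit t \<omega> < x \<longleftrightarrow> (\<exists>q\<in>Q. Y q \<omega> > t)"
        unfolding hit_eq using first_passage_less_iff'[of "\<lambda>s. Y s \<omega>" t x] Y_mono[OF \<omega>] True
        by (auto simp: Q_def)
      ultimately show ?thesis by (simp add: z)
    next
      case False
      hence "\<not> (\<exists>n::nat. Y (real n) \<omega> > t)" by auto
      from False have "{s. 0 \<le> s \<and> Y s \<omega> > t} = {}" by auto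
      hence "hit t \<omega> = Inf {}" unfolding hit_eq first_passage_def by (simp only:)
      thus ?thesis using \<open>\<not> (\<exists>n::nat. Y (real n) \<omega> > t)\<close> by (simp add: z)
    qed
  qed
  also have "\<dots> \<in> sets (borel \<Otimes>\<^sub>M M)" by measurable
  finally show "{z \<in> space (borel \<Otimes>\<^sub>M M). (case z of (t, \<omega>) \<Rightarrow> hit t \<omega>) < x} \<in> sets (borel \<Otimes>\<^sub>M M)" .
qed

lemma hit_measurable [measurable]: "hit t \<in> borel_measurable M"
proof -
  have "(\<lambda>\<omega>. (t, \<omega>)) \<in> measurable M (borel \<Otimes>\<^sub>M M)" by measurable
  from measurable_compose[OF this hit_joint_measurable] show ?thesis by simp
qed

definition law :: "real \<Rightarrow> real measure" where "law t = distr M borel (hit t)"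

lemma pairing_law:
  assumes "t \<ge> 0" "k \<in> borel_measurable borel"
  shows "pairing law k t = (\<integral>\<omega>. k (hit t \<omega>) \<partial>M)"
  using assms by (simp add: pairing_def law_def integral_distr)

lemma hit_properties:
  "AE \<omega> in M. (\<forall>t. hit t \<omega> \<ge> 0 \<and> continuous (at_right t) (\<lambda>t. hit t \<omega>)) \<and>
    (\<forall>t x. x \<ge> 0 \<longrightarrow> (x < hit t \<omega> \<longrightarrow> Y x \<omega> \<le> t) \<and> (Y x \<omega> \<le> t \<longrightarrow> x \<le> hit t \<omega>))"
  using Y_unbounded AE_space
proof eventually_elim
  case (elim \<omega>)
  have m: "0 \<le> r \<Longrightarrow> r \<le> s \<Longrightarrow> Y r \<omega> \<le> Y s \<omega>" for r s by (rule Y_mono[OF elim(2)])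
  have u: "\<exists>s\<ge>0. Y s \<omega> > t" for t using elim(1) by blast
  note fp = first_passage_nonneg[of "\<lambda>s. Y s \<omega>", OF m u] first_passage_right_continuous[of "\<lambda>s. Y s \<omega>", OF m u]
    less_first_passage[of "\<lambda>s. Y s \<omega>", OF m u] first_passage_ge[of "\<lambda>s. Y s \<omega>", OF m u]
  have "(\<lambda>t. hit t \<omega>) = first_passage (\<lambda>s. Y s \<omega>)" by (auto simp: hit_eq)
  thus ?case using fp by (auto simp: hit_eq)
qed

text \<open>On the event \<open>B s \<le> B r\<close> the variable
  \<open>exp (- n * (B s - B r))\<close> is at least 1, while its mean
  \<open>exp (- (s - r) * n powr \<beta>)\<close> tends to 0 as \<open>n\<close> grows.\<close>

lemma B_less:
  assumes that: "0 \<le> r" "r < s"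
  shows "AE \<omega> in M. B r \<omega> < B s \<omega>"
proof -
  have [measurable]: "B r \<in> borel_measurable M" "B s \<in> borel_measurable M"
    using that by (auto intro: B_meas)
  have "prob {\<omega> \<in> space M. B s \<omega> \<le> B r \<omega>} \<le> exp (- (s - r) * real n powr \<beta>)" for n
  proof -
    have "prob {\<omega> \<in> space M. B s \<omega> \<le> B r \<omega>} = (\<integral>\<omega>. indicat_real {\<omega> \<in> space M. B s \<omega> \<le> B r \<omega>} \<omega> \<partial>M)"
      by simp
    also have "\<dots> \<le> (\<integral>\<omega>. exp (- real n * (B s \<omega> - B r \<omega>)) \<partial>M)"
    proof (rule integral_mono)
      show "integrable M (\<lambda>\<omega>. exp (- real n * (B s \<omega> - B r \<omega>)))"
        by (intro integrable_const_bound[of _ 1] AE_I2) (use that B_mono in auto)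
      show "indicat_real {\<omega> \<in> space M. B s \<omega> \<le> B r \<omega>} \<omega> \<le> exp (- real n * (B s \<omega> - B r \<omega>))" for \<omega>
        by (auto simp: indicator_def mult_le_0_iff)
    qed (auto simp: emeasure_eq_measure)
    also have "\<dots> = exp (- (s - r) * real n powr \<beta>)"
      using that by (intro B_exp) auto
    finally show ?thesis .
  qed
  moreover have "(\<lambda>n. exp (- (s - r) * real n powr \<beta>)) \<longlonglongrightarrow> 0"
    using that \<beta>(1) by (intro exp_neg_powr_tendsto_0) auto
  ultimately have "prob {\<omega> \<in> space M. B s \<omega> \<le> B r \<omega>} \<le> 0"
    using LIMSEQ_le_const by fastforce
  hence "emeasure M {\<omega> \<in> space M. B s \<omega> \<le> B r \<omega>} = 0"
    by (simp add: emeasure_eq_measure antisym)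
  thus ?thesis by (intro AE_I[of _ _ "{\<omega> \<in> space M. B s \<omega> \<le> B r \<omega>}"]) (auto simp: not_less)
qed

text \<open>\<open>B\<close> alone supplies the strictness. Two rationals between \<open>r\<close>
  and \<open>s\<close> reduce the claim to countably many pairs, hence to one null set.\<close>

lemma Y_strict:
  assumes "b > 0"
  shows "AE \<omega> in M. \<forall>r s. 0 \<le> r \<longrightarrow> r < s \<longrightarrow> Y r \<omega> < Y s \<omega>"
proof -
  have "AE \<omega> in M. \<forall>r\<in>\<rat>. \<forall>s\<in>\<rat>. 0 \<le> r \<longrightarrow> r < s \<longrightarrow> B r \<omega> < B s \<omega>"
    by (simp add: AE_ball_countable countable_rat) (use B_less in auto)
  with AE_space show ?thesis
  proof eventually_elim
    case (elim \<omega>)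
    show ?case
    proof (intro allI impI)
      fix r s :: real assume rs: "0 \<le> r" "r < s"
      obtain p where p: "p \<in> \<rat>" "r < p" "p < s" using Rats_dense_in_real[OF rs(2)] by blast
      obtain q where q: "q \<in> \<rat>" "p < q" "q < s" using Rats_dense_in_real[OF p(3)] by blast
      have "B r \<omega> \<le> B p \<omega>" "B p \<omega> < B q \<omega>" "B q \<omega> \<le> B s \<omega>"
        using elim p q rs by (auto intro!: B_mono)
      hence "b * B r \<omega> < b * B s \<omega>" using assms by simp
      moreover have "K r \<omega> \<le> K s \<omega>"
        unfolding K_def using elim(1) rs by (intro N_mono A_mono A_nonneg) auto
      ultimately show "Y r \<omega> < Y s \<omega>" by (simp add: Y_def)
    qed
  qed
qed

lemma hit_continuous:
  assumes "b > 0"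
  shows "AE \<omega> in M. hit 0 \<omega> = 0 \<and> (\<forall>t. isCont (\<lambda>t. hit t \<omega>) t)"
  using Y_unbounded AE_space Y_strict[OF assms]
proof eventually_elim
  case (elim \<omega>)
  have m: "0 \<le> r \<Longrightarrow> r \<le> s \<Longrightarrow> Y r \<omega> \<le> Y s \<omega>" for r s by (rule Y_mono[OF elim(2)])
  have u: "\<exists>s\<ge>0. Y s \<omega> > t" for t using elim(1) by blast
  have s: "0 \<le> r \<Longrightarrow> r < s \<Longrightarrow> Y r \<omega> < Y s \<omega>" for r s using elim(3) by blast
  show ?case
    unfolding hit_eq
    by (intro conjI allI first_passage_0[of "\<lambda>s. Y s \<omega>"] first_passage_continuous[of "\<lambda>s. Y s \<omega>"])
      (fact m u s Y_0[OF elim(2)])+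
qed

lemma pairing_law_tendsto:
  assumes k: "continuous_on UNIV k" "\<And>x. \<bar>k x\<bar> \<le> C" and X: "\<And>n. X n \<ge> 0" "t \<ge> 0"
    and lim: "AE \<omega> in M. (\<lambda>n. hit (X n) \<omega>) \<longlonglongrightarrow> hit t \<omega>"
  shows "(\<lambda>n. pairing law k (X n)) \<longlonglongrightarrow> pairing law k t"
proof -
  have [measurable]: "k \<in> borel_measurable borel" by (rule borel_measurable_continuous_onI[OF k(1)])
  have "(\<lambda>n. \<integral>\<omega>. k (hit (X n) \<omega>) \<partial>M) \<longlonglongrightarrow> (\<integral>\<omega>. k (hit t \<omega>) \<partial>M)"
  proof (rule integral_dominated_convergence[where w = "\<lambda>_. C"])
    show "AE \<omega> in M. (\<lambda>n. k (hit (X n) \<omega>)) \<longlonglongrightarrow> k (hit t \<omega>)"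
      using lim
    proof eventually_elim
      case (elim \<omega>)
      have "isCont k (hit t \<omega>)" using k(1) by (simp add: continuous_on_eq_continuous_at)
      thus ?case using elim by (rule isCont_tendsto_compose)
    qed
  qed (use k(2) in auto)
  thus ?thesis using X by (simp add: pairing_law)
qed

lemma pairing_law_right_continuous:
  assumes k: "continuous_on UNIV k" "\<And>x. \<bar>k x\<bar> \<le> C" and t: "t \<ge> 0"
  shows "continuous (at_right t) (pairing law k)"
proof (rule continuous_at_rightI_sequentially)
  fix X assume X: "\<And>n. t < X n" "X \<longlonglongrightarrow> t"
  show "(\<lambda>n. pairing law k (X n)) \<longlonglongrightarrow> pairing law k t"
  proof (rule pairing_law_tendsto[OF k])
    show "X n \<ge> 0" for n using X(1)[of n] t by simp
    show "AE \<omega> in M. (\<lambda>n. hit (X n) \<omega>) \<longlonglongrightarrow> hit t \<omega>"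
      using hit_properties by eventually_elim (rule right_cont_tendsto[OF _ X(2,1)], blast)
  qed fact
qed

lemma pairing_law_continuous:
  assumes "b > 0" and k: "continuous_on UNIV k" "\<And>x. \<bar>k x\<bar> \<le> C"
  shows "continuous_on {0..} (pairing law k)"
  unfolding continuous_on_sequentially
proof (intro allI ballI impI)
  fix X :: "nat \<Rightarrow> real" and t :: real assume "t \<in> {0..}" and X: "(\<forall>n. X n \<in> {0..}) \<and> X \<longlonglongrightarrow> t"
  have "(\<lambda>n. pairing law k (X n)) \<longlonglongrightarrow> pairing law k t"
  proof (rule pairing_law_tendsto[OF k])
    show "AE \<omega> in M. (\<lambda>n. hit (X n) \<omega>) \<longlonglongrightarrow> hit t \<omega>"
      using hit_continuous[OF \<open>b > 0\<close>]
      by eventually_elim (rule isCont_tendsto_compose[of t "\<lambda>t. hit t _"], use X in auto)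
  qed (use X \<open>t \<in> {0..}\<close> in auto)
  thus "(pairing law k \<circ> X) \<longlonglongrightarrow> pairing law k t" by (simp add: o_def)
qed

lemma density_family_law: "density_family law"
  unfolding density_family_def
proof (intro conjI allI impI)
  fix t :: real assume t: "t \<ge> 0"
  show "finite_measure (law t)" unfolding law_def by (intro finite_measure_distr) simp
  show "sets (law t) = sets borel" by (simp add: law_def)
  have "AE \<omega> in M. hit t \<omega> \<ge> 0" using hit_properties by eventually_elim blast
  hence "emeasure M {\<omega> \<in> space M. \<not> hit t \<omega> \<ge> 0} = 0" by (intro emeasure_eq_0_AE) auto
  moreover have "hit t -` {..<0} \<inter> space M = {\<omega> \<in> space M. \<not> hit t \<omega> \<ge> 0}" by (auto simp: not_le)
  ultimately show "emeasure (law t) {..<0} = 0" by (simp add: law_def emeasure_distr)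
next
  have "measure (law t) UNIV \<le> 1" for t
    using measure_distr[of "hit t" M borel UNIV] by (simp add: law_def)
  thus "\<exists>C. \<forall>t\<ge>0. measure (law t) UNIV \<le> C" by blast
next
  fix f t assume "test_function f" "0 \<le> (t :: real)"
  thus "continuous (at_right t) (pairing law f)"
    using test_function_bounded pairing_law_right_continuous test_function_continuous by meson
qed

section \<open>The hitting time at an independent exponential time\<close>

text \<open>The left side is the mean of \<open>k (hit T)\<close> for an exponential
  \<open>T\<close> of parameter \<open>\<xi>\<close>, realised on a product space. There
  \<open>Y x \<le> T\<close> has as probability the mean of \<open>exp (- \<xi> * Y x)\<close>, so
  that \<open>T\<close> converts the known transform of \<open>Y x\<close> into the tail of
  \<open>hit T\<close>.\<close>

lemma hit_exponential_time:
  assumes \<xi>: "\<xi> > 0" and k [measurable]: "k \<in> borel_measurable borel" and C: "\<And>x. \<bar>k x\<bar> \<le> C"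
  shows "\<xi> * laplace (pairing law k) \<xi> = (\<integral>x. exponential_density (exponent \<xi>) x * k x \<partial>lborel)"
proof -
  define T where "T = density lborel (exponential_density \<xi>)"
  interpret T: prob_space T unfolding T_def using \<xi> by (rule prob_space_exponential_density)
  interpret P: pair_prob_space T M ..
  have sets_T [measurable_cong]: "sets T = sets borel" by (simp add: T_def)
  have space_T: "space T = UNIV" by (simp add: T_def)
  define h where "h z = hit (fst z) (snd z)" for z
  have h [measurable]: "h \<in> borel_measurable (T \<Otimes>\<^sub>M M)"
    using hit_joint_measurable unfolding h_def split_def
    by (subst measurable_cong_sets[OF sets_pair_measure_cong[OF sets_T refl] refl]) simp
  have Y_le: "P.prob {z \<in> space (T \<Otimes>\<^sub>M M). Y x (snd z) \<le> fst z} = exp (- x * exponent \<xi>)" if x: "x \<ge> 0" for x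
  proof -
    have [measurable]: "Y x \<in> borel_measurable M" by (rule Y_meas[OF x])
    have "emeasure (T \<Otimes>\<^sub>M M) {z \<in> space (T \<Otimes>\<^sub>M M). Y x (snd z) \<le> fst z}
      = (\<integral>\<^sup>+\<omega>. emeasure T ((\<lambda>t. (t, \<omega>)) -` {z \<in> space (T \<Otimes>\<^sub>M M). Y x (snd z) \<le> fst z}) \<partial>M)"
      by (rule P.emeasure_pair_measure_alt2) measurable
    also have "\<dots> = (\<integral>\<^sup>+\<omega>. ennreal (exp (- \<xi> * Y x \<omega>)) \<partial>M)"
    proof (rule nn_integral_cong)
      fix \<omega> assume \<omega>: "\<omega> \<in> space M"
      hence "(\<lambda>t. (t, \<omega>)) -` {z \<in> space (T \<Otimes>\<^sub>M M). Y x (snd z) \<le> fst z} = {Y x \<omega>..}"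
        by (auto simp: space_pair_measure space_T)
      thus "emeasure T ((\<lambda>t. (t, \<omega>)) -` {z \<in> space (T \<Otimes>\<^sub>M M). Y x (snd z) \<le> fst z}) = ennreal (exp (- \<xi> * Y x \<omega>))"
        using emeasure_exponential_atLeast[OF \<xi> Y_nonneg[OF \<omega> x]] by (simp add: T_def)
    qed
    also have "\<dots> = ennreal (\<integral>\<omega>. exp (- \<xi> * Y x \<omega>) \<partial>M)"
      by (rule nn_integral_eq_integral) (use \<xi> x Y_nonneg in \<open>auto intro!: integrable_const_bound[of _ 1] AE_I2\<close>)
    finally show ?thesis using Y_laplace[OF x \<xi>] by (simp add: measure_def)
  qed
  have AE_hit: "AE z in T \<Otimes>\<^sub>M M. \<forall>x\<ge>0. (x < h z \<longrightarrow> Y x (snd z) \<le> fst z) \<and> (Y x (snd z) \<le> fst z \<longrightarrow> x \<le> h z)"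
  proof -
    have "AE z in T \<Otimes>\<^sub>M M. (\<forall>t. hit t (snd z) \<ge> 0 \<and> continuous (at_right t) (\<lambda>t. hit t (snd z))) \<and>
      (\<forall>t x. x \<ge> 0 \<longrightarrow> (x < hit t (snd z) \<longrightarrow> Y x (snd z) \<le> t) \<and> (Y x (snd z) \<le> t \<longrightarrow> x \<le> hit t (snd z)))"
      using hit_properties by (rule P.AE_pair_snd)
    thus ?thesis by eventually_elim (auto simp: h_def)
  qed
  \<comment> \<open>Only the sandwich between \<open>Y x \<le> t\<close> and the hitting time is
    available: the upper bound uses the level \<open>a\<close>, the lower bound the levels
    \<open>a + 1 / (n + 1)\<close>, and continuity of the exponential closes the gap.\<close>
  have gt: "P.prob {z \<in> space (T \<Otimes>\<^sub>M M). a < h z} = exp (- a * exponent \<xi>)" if a: "a \<ge> 0" for a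
  proof (rule antisym)
    have [measurable]: "Y x \<in> borel_measurable M" if "x \<ge> 0" for x by (rule Y_meas[OF that])
    have "P.prob {z \<in> space (T \<Otimes>\<^sub>M M). a < h z} \<le> P.prob {z \<in> space (T \<Otimes>\<^sub>M M). Y a (snd z) \<le> fst z}"
      by (rule P.finite_measure_mono_AE) (use AE_hit a in \<open>auto elim!: eventually_mono\<close>)
    thus "P.prob {z \<in> space (T \<Otimes>\<^sub>M M). a < h z} \<le> exp (- a * exponent \<xi>)" by (simp add: Y_le a)
    have "exp (- (a + 1 / real (Suc n)) * exponent \<xi>) \<le> P.prob {z \<in> space (T \<Otimes>\<^sub>M M). a < h z}" for n
    proof -
      have a': "a + 1 / real (Suc n) \<ge> 0" "a < a + 1 / real (Suc n)" using a by auto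
      have "P.prob {z \<in> space (T \<Otimes>\<^sub>M M). Y (a + 1 / real (Suc n)) (snd z) \<le> fst z} \<le> P.prob {z \<in> space (T \<Otimes>\<^sub>M M). a < h z}"
      proof (rule P.finite_measure_mono_AE)
        show "AE z in T \<Otimes>\<^sub>M M. z \<in> {z \<in> space (T \<Otimes>\<^sub>M M). Y (a + 1 / real (Suc n)) (snd z) \<le> fst z} \<longrightarrow> z \<in> {z \<in> space (T \<Otimes>\<^sub>M M). a < h z}"
          using AE_hit
        proof eventually_elim
          case (elim z)
          hence "Y (a + 1 / real (Suc n)) (snd z) \<le> fst z \<longrightarrow> a + 1 / real (Suc n) \<le> h z"
            using a'(1) by blast
          thus ?case using less_le_trans[OF a'(2), of "h z"] by auto
        qed
      qed measurable
      thus ?thesis by (simp only: Y_le[OF a'(1)])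
    qed
    moreover have "(\<lambda>n. exp (- (a + 1 / real (Suc n)) * exponent \<xi>)) \<longlonglongrightarrow> exp (- (a + 0) * exponent \<xi>)"
      by (intro tendsto_intros LIMSEQ_Suc[OF lim_1_over_n])
    ultimately show "exp (- a * exponent \<xi>) \<le> P.prob {z \<in> space (T \<Otimes>\<^sub>M M). a < h z}"
      using LIMSEQ_le_const2 by fastforce
  qed
  have "distributed (T \<Otimes>\<^sub>M M) lborel h (exponential_density (exponent \<xi>))"
  proof (rule exponential_distributedI[OF h exponent_pos[OF \<xi>]])
    fix a :: real assume a: "0 \<le> a"
    have "P.prob {z \<in> space (T \<Otimes>\<^sub>M M). h z \<le> a} = 1 - P.prob {z \<in> space (T \<Otimes>\<^sub>M M). a < h z}"
      using P.prob_neg[of "\<lambda>z. a < h z"] by (simp add: not_less)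
    thus "emeasure (T \<Otimes>\<^sub>M M) {z \<in> space (T \<Otimes>\<^sub>M M). h z \<le> a} = 1 - ennreal (exp (- a * exponent \<xi>))"
      unfolding gt[OF a]
      by (simp add: P.emeasure_eq_measure ennreal_minus ennreal_1[symmetric] del: ennreal_1)
  qed
  hence "(\<integral>x. exponential_density (exponent \<xi>) x * k x \<partial>lborel) = (\<integral>z. k (h z) \<partial>(T \<Otimes>\<^sub>M M))"
    using exponent_pos[OF \<xi>] by (intro distributed_integral) (auto simp: exponential_density_def)
  also have "\<dots> = (\<integral>t. (\<integral>\<omega>. k (h (t, \<omega>)) \<partial>M) \<partial>T)"
    by (rule P.integral_fst'[symmetric]) (use C in \<open>auto intro!: P.integrable_const_bound[of _ C]\<close>)
  also have "\<dots> = (\<integral>t. (\<integral>\<omega>. k (hit t \<omega>) \<partial>M) \<partial>T)" by (simp add: h_def)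
  also have "\<dots> = (\<integral>t. exponential_density \<xi> t * (\<integral>\<omega>. k (hit t \<omega>) \<partial>M) \<partial>lborel)"
  proof -
    have "(\<lambda>t. \<integral>\<omega>. k (case (t, \<omega>) of (t, \<omega>) \<Rightarrow> hit t \<omega>) \<partial>M) \<in> borel_measurable borel"
      by (rule borel_measurable_lebesgue_integral)
        (use measurable_compose[OF hit_joint_measurable k] in \<open>simp add: split_def\<close>)
    thus ?thesis
      unfolding T_def using \<xi> by (subst integral_density) (auto simp: exponential_density_def)
  qed
  also have "\<dots> = (\<integral>t. \<xi> * (exp (- \<xi> * t) * pairing law k t) \<partial>lborel)"
    by (intro Bochner_Integration.integral_cong)
      (auto simp: exponential_density_def pairing_law pairing_neg mult_ac)
  finally show ?thesis by (simp add: laplace_def)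
qed

text \<open>Integration by parts against the exponential density of parameter
  \<open>exponent \<xi>\<close>; the boundary term at 0 is the origin of \<open>f 0\<close>.\<close>

lemma law_laplace:
  assumes \<xi>: "\<xi> > 0" and f: "test_function f"
  shows "exponent \<xi> * (laplace (pairing law f) \<xi> - f 0 / \<xi>) = laplace (pairing law (deriv f)) \<xi>"
proof -
  define c where "c = exponent \<xi>"
  have c: "c > 0" unfolding c_def by (rule exponent_pos[OF \<xi>])
  obtain K where K: "K > 0" "\<And>x. \<bar>f x\<bar> \<le> K" "\<And>x. \<bar>deriv f x\<bar> \<le> K"
    using test_function_bounded[OF f] by auto
  note [measurable] = test_function_measurable[OF f] deriv_test_function_measurable[OF f]
  have int: "integrable lborel (\<lambda>x. exponential_density c x * k x)"
    if [measurable]: "k \<in> borel_measurable borel" and k: "\<And>x. \<bar>k x\<bar> \<le> C" for k :: "real \<Rightarrow> real" and C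
  proof (rule Bochner_Integration.integrable_bound)
    show "integrable lborel (\<lambda>x. exponential_density c x * C)"
      using has_bochner_integral_exponential_density[OF c] by (auto simp: has_bochner_integral_iff)
    have "C \<ge> 0" using k[of 0] by linarith
    thus "AE x in lborel. norm (exponential_density c x * k x) \<le> norm (exponential_density c x * C)"
      using c k by (intro AE_I2) (auto simp: abs_mult intro!: mult_left_mono)
  qed simp
  obtain R where R: "R > 0" "\<And>x. \<bar>x\<bar> > R \<Longrightarrow> f x = 0" using test_function_support[OF f] by blast
  define F where "F x = exp (- c * x) * f x" for x
  define F' where "F' x = exp (- c * x) * (deriv f x - c * f x)" for x
  have f_0: "f x = 0" "deriv f x = 0" if "x > R" for x
  proof -
    show "f x = 0" using R that by simp
    have ev: "\<forall>\<^sub>F y in nhds x. f y = 0"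
      using eventually_nhds_in_open[of "{R<..}" x] that R by (auto elim!: eventually_mono)
    have "(f has_real_derivative 0) (at x)" using DERIV_cong_ev[OF refl ev refl] by simp
    thus "deriv f x = 0" by (rule DERIV_imp_deriv)
  qed
  \<comment> \<open>Beyond \<open>R\<close> both \<open>f\<close> and its derivative vanish, so the
    integral up to \<open>R + 1\<close> is already the full one and the upper boundary term is
    0.\<close>
  have "(\<integral>x. F' x * indicator {0..R + 1} x \<partial>lborel) = F (R + 1) - F 0"
  proof (rule integral_FTC_Icc_real)
    show "(F has_real_derivative F' x) (at x)" for x
    proof -
      have "((\<lambda>x. exp (- c * x)) has_real_derivative exp (- c * x) * (- c * 1)) (at x)"
        by (intro DERIV_chain2[OF DERIV_exp] DERIV_cmult DERIV_ident)
      from DERIV_mult[OF this test_functionD(1)[OF f]] show ?thesis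
        unfolding F_def[abs_def] F'_def by (simp add: algebra_simps)
    qed
    have "isCont f x" "isCont (deriv f) x" for x
      using test_function_continuous[OF f] test_functionD(2)[OF f] by (auto simp: continuous_on_eq_continuous_at)
    thus "isCont F' x" for x unfolding F'_def[abs_def] by (intro continuous_intros)
  qed (use R in simp)
  also have "\<dots> = - f 0" using f_0(1)[of "R + 1"] by (simp add: F_def)
  also have "(\<integral>x. F' x * indicator {0..R + 1} x \<partial>lborel)
      = (\<integral>x. 1 / c * (exponential_density c x * deriv f x - c * (exponential_density c x * f x)) \<partial>lborel)"
    using c f_0 by (intro Bochner_Integration.integral_cong)
      (auto simp: F'_def exponential_density_def indicator_def field_simps)
  also have "\<dots> = 1 / c * ((\<integral>x. exponential_density c x * deriv f x \<partial>lborel) - c * (\<integral>x. exponential_density c x * f x \<partial>lborel))"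
    using int[of f K] int[of "deriv f" K] K by simp
  also have "\<dots> = 1 / c * (\<xi> * laplace (pairing law (deriv f)) \<xi> - c * (\<xi> * laplace (pairing law f) \<xi>))"
    unfolding c_def by (subst (1 2) hit_exponential_time[OF \<xi>, symmetric, where C = K]) (use K in auto)
  finally have "\<xi> * laplace (pairing law (deriv f)) \<xi> = c * (\<xi> * laplace (pairing law f) \<xi> - f 0)"
    using c by (simp add: field_simps)
  thus ?thesis unfolding c_def[symmetric] using \<xi> by (simp add: field_simps)
qed

theorem law_solution: "ibvp_solution b \<beta> \<gamma> rate (return borel 0) (boundary_value \<gamma> rate) law"
proof -
  have law0: "law 0 = return borel 0" if "b > 0"
  proof -
    have "AE \<omega> in M. hit 0 \<omega> = 0" using hit_continuous[OF that] by eventually_elim blast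
    hence "distr M borel (hit 0) = distr M borel (\<lambda>_. 0)"
      by (intro distr_cong_AE) (auto intro: hit_measurable)
    thus ?thesis by (simp add: law_def)
  qed
  have eq: "(b > 0 \<longrightarrow> caputo_differentiable \<beta> (pairing law f) t) \<and>
        b powr \<beta> * caputo \<beta> (pairing law f) t + rate powr \<gamma> * frac_difference \<gamma> (pairing law f) t
        = minus_dx_pairing (boundary_value \<gamma> rate) law f t"
    if f: "test_function f" and t: "t > 0" for f t
  proof -
    obtain C where C: "\<And>x. \<bar>f x\<bar> \<le> C" "\<And>x. \<bar>deriv f x\<bar> \<le> C"
      using test_function_bounded[OF f] by auto
    note hyps = law0 pairing_law_continuous[OF _ test_function_continuous[OF f] C(1)]
      pairing_law_continuous[OF _ test_functionD(2)[OF f] C(2)]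
      pairing_law_right_continuous[OF test_functionD(2)[OF f] C(2)] law_laplace[OF _ f] t
    show ?thesis
      using equation_of_laplace[OF density_family_law f hyps] by blast
  qed
  show ?thesis
    unfolding ibvp_solution_def
  proof (intro conjI allI impI)
    fix f and t :: real assume "test_function f \<and> t > 0"
    hence *: "test_function f" "t > 0" by auto
    show "b > 0 \<Longrightarrow> caputo_differentiable \<beta> (pairing law f) t" using eq[OF *] by simp
    show "b powr \<beta> * caputo \<beta> (pairing law f) t + rate powr \<gamma> * frac_difference \<gamma> (pairing law f) t
        = minus_dx_pairing (boundary_value \<gamma> rate) law f t" using eq[OF *] by simp
  qed (rule density_family_law, rule law0)
qed

text \<open>For \<open>b = 0\<close> no value at time 0 is prescribed; that \<open>u 0\<close> still
  agrees with \<open>law 0\<close> comes from right continuity at 0, which enters through the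
  uniqueness of transforms.\<close>

theorem solution_unique:
  assumes u: "ibvp_solution b \<beta> \<gamma> rate (return borel 0) (boundary_value \<gamma> rate) u" and "t \<ge> 0"
  shows "u t = law t"
proof (rule density_family_unique[OF _ density_family_law _ law_laplace \<open>t \<ge> 0\<close>])
  show df: "density_family u" using u by (simp add: ibvp_solution_def)
  show "exponent \<xi> * (laplace (pairing u f) \<xi> - f 0 / \<xi>) = laplace (pairing u (deriv f)) \<xi>"
    if "\<xi> > 0" "test_function f" for \<xi> f
    by (rule laplace_of_equation[OF df that(2) _ _ _ that(1)]) (use u that in \<open>auto simp: ibvp_solution_def\<close>)
qed

end

section \<open>Absolute continuity\<close>

definition add_measure :: "real measure \<Rightarrow> real measure \<Rightarrow> real measure" where
  "add_measure \<mu> \<nu> = measure_of UNIV (sets borel) (\<lambda>S. emeasure \<mu> S + emeasure \<nu> S)"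

lemma emeasure_add_measure:
  assumes "sets \<mu> = sets borel" "sets \<nu> = sets borel" "S \<in> sets borel"
  shows "emeasure (add_measure \<mu> \<nu>) S = emeasure \<mu> S + emeasure \<nu> S"
  unfolding add_measure_def
proof (rule emeasure_measure_of_sigma)
  show "sigma_algebra UNIV (sets (borel :: real measure))" using sets.sigma_algebra_axioms[of "borel :: real measure"] by simp
  show "positive (sets borel) (\<lambda>S. emeasure \<mu> S + emeasure \<nu> S)" by (simp add: positive_def)
  show "countably_additive (sets borel) (\<lambda>S. emeasure \<mu> S + emeasure \<nu> S)"
    unfolding countably_additive_def
  proof (intro allI impI)
    fix F :: "nat \<Rightarrow> real set" assume F: "range F \<subseteq> sets borel" "disjoint_family F" "\<Union> (range F) \<in> sets borel"
    have "(\<Sum>i. emeasure \<mu> (F i) + emeasure \<nu> (F i)) = (\<Sum>i. emeasure \<mu> (F i)) + (\<Sum>i. emeasure \<nu> (F i))"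
      by (rule suminf_add[symmetric]) auto
    also have "\<dots> = emeasure \<mu> (\<Union> (range F)) + emeasure \<nu> (\<Union> (range F))"
      using F assms by (simp add: suminf_emeasure)
    finally show "(\<Sum>i. emeasure \<mu> (F i) + emeasure \<nu> (F i)) = emeasure \<mu> (\<Union> (range F)) + emeasure \<nu> (\<Union> (range F))" .
  qed
qed (use assms in auto)

lemma sets_add_measure: "sets (add_measure \<mu> \<nu>) = sets borel"
  unfolding add_measure_def using sets.sets_measure_of_eq[of "borel :: real measure"] by simp

text \<open>The difference of the distribution functions is itself the distribution function of
  a measure, so that \<open>\<rho>\<close> is the sum of \<open>\<mu>\<close> and that measure.\<close>

lemma measure_le_of_intervals:
  fixes \<mu> \<rho> :: "real measure"
  assumes \<mu>: "finite_measure \<mu>" "sets \<mu> = sets borel" and \<rho>: "finite_measure \<rho>" "sets \<rho> = sets borel"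
    and le: "\<And>x y. x \<le> y \<Longrightarrow> measure \<mu> {x<..y} \<le> measure \<rho> {x<..y}" and S: "S \<in> sets borel"
  shows "emeasure \<mu> S \<le> emeasure \<rho> S"
proof -
  interpret \<mu>: finite_borel_measure \<mu> by (intro finite_borel_measure.intro finite_borel_measure_axioms.intro \<mu>)
  interpret \<rho>: finite_borel_measure \<rho> by (intro finite_borel_measure.intro finite_borel_measure_axioms.intro \<rho>)
  define F where "F x = cdf \<rho> x - cdf \<mu> x" for x
  have mono: "F x \<le> F y" if "x \<le> y" for x y
    using le[OF that] that \<mu>.cdf_diff_eq[of x y] \<rho>.cdf_diff_eq[of x y] by (cases "x = y") (auto simp: F_def)
  have rc: "continuous (at_right a) F" for a
    unfolding F_def[abs_def] by (intro continuous_diff \<mu>.cdf_is_right_cont \<rho>.cdf_is_right_cont)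
  have "((\<lambda>x. cdf \<rho> x - cdf \<mu> x) \<longlongrightarrow> 0 - 0) at_bot"
    by (intro tendsto_diff \<mu>.cdf_lim_at_bot \<rho>.cdf_lim_at_bot)
  hence bot: "(F \<longlongrightarrow> 0) at_bot" by (simp add: F_def[abs_def])
  define \<sigma> where "\<sigma> = add_measure (interval_measure F) \<mu>"
  have \<sigma>: "emeasure \<sigma> S = emeasure (interval_measure F) S + emeasure \<mu> S" if "S \<in> sets borel" for S
    unfolding \<sigma>_def by (rule emeasure_add_measure) (use that \<mu> in auto)
  have "\<sigma> = \<rho>"
  proof (rule measure_eqI_generator_eq[where \<Omega> = UNIV])
    show "Int_stable (range (\<lambda>(a, b). {a<..b::real}))" by (auto simp: Int_stable_def)
    show "sets \<sigma> = sigma_sets UNIV (range (\<lambda>(a, b). {a<..b::real}))" "sets \<rho> = sigma_sets UNIV (range (\<lambda>(a, b). {a<..b::real}))"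
      using \<rho>(2) by (simp_all add: \<sigma>_def sets_add_measure borel_sigma_sets_Ioc)
    show "(\<Union>i. {- real (i::nat)<..real i}) = UNIV" by (rule UN_Ioc_eq_UNIV)
    fix X assume "X \<in> range (\<lambda>(a, b). {a<..b::real})"
    then obtain x y where X: "X = {x<..y}" by auto
    show "emeasure \<sigma> X = emeasure \<rho> X"
    proof (cases "x \<le> y")
      case True
      have "cdf \<mu> x \<le> cdf \<mu> y" using \<mu>.cdf_nondecreasing[OF True] .
      hence "emeasure \<sigma> X = ennreal (F y - F x + (cdf \<mu> y - cdf \<mu> x))"
        using mono[OF True] True
        by (simp add: X \<sigma> emeasure_interval_measure_Ioc[OF _ mono rc] \<mu>.emeasure_Ioc ennreal_plus)
      also have "\<dots> = emeasure \<rho> X"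
        using True by (simp add: X F_def \<rho>.emeasure_Ioc)
      finally show ?thesis .
    qed (simp add: X)
  next
    fix i :: nat
    show "emeasure \<sigma> {- real i<..real i} \<noteq> \<infinity>"
      by (simp add: \<sigma> emeasure_interval_measure_Ioc[OF _ mono rc] \<mu>.emeasure_Ioc)
  qed auto
  thus ?thesis using \<sigma>[OF S] by auto
qed

lemma powr_le_iff_base:
  fixes x y p :: real
  assumes "0 < p" "0 \<le> x" "0 \<le> y"
  shows "x powr p \<le> y powr p \<longleftrightarrow> x \<le> y"
proof
  show "x powr p \<le> y powr p \<Longrightarrow> x \<le> y"
    using powr_less_mono2[OF assms(1,3), of x] by linarith
qed (use assms powr_mono2 in auto)

text \<open>Dilations preserve Lebesgue null sets. This carries absolute continuity from one time of
  an inverse stable subordinator to all others.\<close>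

lemma absolutely_continuous_cmult:
  fixes E :: "'a \<Rightarrow> real"
  assumes [measurable]: "E \<in> borel_measurable M" and "c \<noteq> 0"
    and ac: "absolutely_continuous lborel (distr M borel E)"
  shows "absolutely_continuous lborel (distr M borel (\<lambda>\<omega>. c * E \<omega>))"
  unfolding absolutely_continuous_def
proof
  fix S :: "real set" assume "S \<in> null_sets lborel"
  hence S[measurable]: "S \<in> sets borel" and S0: "emeasure lborel S = 0" by auto
  have "emeasure lborel S = \<bar>c\<bar> * emeasure lborel ((\<lambda>x. c * x) -` S)"
  proof -
    have "emeasure lborel S = (\<integral>\<^sup>+x. indicator S x \<partial>lborel)" by simp
    also have "\<dots> = \<bar>c\<bar> * (\<integral>\<^sup>+x. indicator S (0 + c * x) \<partial>lborel)"
      by (rule nn_integral_real_affine[OF _ \<open>c \<noteq> 0\<close>]) simp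
    also have "(\<integral>\<^sup>+x. indicator S (0 + c * x) \<partial>lborel) = (\<integral>\<^sup>+x. indicator ((\<lambda>x. c * x) -` S) x \<partial>lborel)"
      by (intro nn_integral_cong) (auto simp: indicator_def)
    also have "\<dots> = emeasure lborel ((\<lambda>x. c * x) -` S)"
    proof (rule nn_integral_indicator)
      have "(\<lambda>x. c * x) -` S \<inter> space borel \<in> sets borel" by (rule measurable_sets[OF _ S]) simp
      thus "(\<lambda>x. c * x) -` S \<in> sets lborel" by simp
    qed
    finally show ?thesis .
  qed
  hence "emeasure lborel ((\<lambda>x. c * x) -` S) = 0" using S0 \<open>c \<noteq> 0\<close> by (auto simp: ennreal_eq_0_iff)
  moreover have "(\<lambda>x. c * x) -` S \<inter> space borel \<in> sets borel" by (rule measurable_sets[OF _ S]) simp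
  ultimately have "emeasure (distr M borel E) ((\<lambda>x. c * x) -` S) = 0"
    using ac by (intro absolutely_continuousD[OF ac]) auto
  hence "emeasure (distr M borel (\<lambda>\<omega>. c * E \<omega>)) S = 0"
    using \<open>(\<lambda>x. c * x) -` S \<inter> space borel \<in> sets borel\<close>
    by (simp add: emeasure_distr vimage_def)
  thus "S \<in> null_sets (distr M borel (\<lambda>\<omega>. c * E \<omega>))" by auto
qed

text \<open>For the inverse \<open>x\<close> of a \<open>\<beta>\<close>-stable subordinator at time \<open>t\<close>, the measure
  \<open>dt P(x > a)\<close> has the density \<open>\<integral>\<^sub>a\<^sup>\<infinity> E (frac_kernel \<beta> (t - r powr (1/\<beta>) * Z)) dr\<close>, as both have the
  Laplace transform \<open>exp (- a * \<xi> powr \<beta>) / \<xi>\<close>. This yields the absolute continuity for almost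
  every \<open>t\<close>, hence by scaling for every \<open>t\<close>.\<close>

lemma (in prob_space) inverse_stable_absolutely_continuous:
  fixes Z :: "'a \<Rightarrow> real" and \<beta> :: real
  assumes \<beta>: "0 < \<beta>" "\<beta> < 1" and Z [measurable]: "Z \<in> borel_measurable M"
    and pos: "\<And>\<omega>. \<omega> \<in> space M \<Longrightarrow> 0 \<le> Z \<omega>" and AE_pos: "AE \<omega> in M. 0 < Z \<omega>"
    and lap: "\<And>\<xi>. 0 \<le> \<xi> \<Longrightarrow> (\<integral>\<omega>. exp (- \<xi> * Z \<omega>) \<partial>M) = exp (- (\<xi> powr \<beta>))"
  shows "\<exists>c>0. absolutely_continuous lborel (distr M borel (\<lambda>\<omega>. c * Z \<omega> powr (- \<beta>)))"
proof -
  have lap': "(\<integral>\<^sup>+\<omega>. ennreal (exp (- (\<xi> * r powr (1 / \<beta>)) * Z \<omega>)) \<partial>M) = ennreal (exp (- r * \<xi> powr \<beta>))"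
    if "\<xi> > 0" "r > 0" for \<xi> r
  proof -
    have "(\<integral>\<^sup>+\<omega>. ennreal (exp (- (\<xi> * r powr (1 / \<beta>)) * Z \<omega>)) \<partial>M) = ennreal (\<integral>\<omega>. exp (- (\<xi> * r powr (1 / \<beta>)) * Z \<omega>) \<partial>M)"
      by (rule nn_integral_eq_integral) (use that pos in \<open>auto intro!: integrable_const_bound[of _ 1] AE_I2\<close>)
    also have "(\<integral>\<omega>. exp (- (\<xi> * r powr (1 / \<beta>)) * Z \<omega>) \<partial>M) = exp (- ((\<xi> * r powr (1 / \<beta>)) powr \<beta>))"
      by (rule lap) (use that in auto)
    also have "(\<xi> * r powr (1 / \<beta>)) powr \<beta> = r * \<xi> powr \<beta>"
      using that \<beta> by (simp add: powr_mult powr_powr)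
    finally show ?thesis by simp
  qed
  \<comment> \<open>\<open>r powr (1 / \<beta>) * Z\<close> has the law of the subordinator at time
    \<open>r\<close>. So \<open>L a t\<close> is the probability that the inverse at time
    \<open>t\<close> is at least \<open>a\<close>, and \<open>m r t\<close> is the candidate for its
    density at \<open>r\<close>, with tail \<open>R a t\<close>.\<close>
  define L where "L a t = emeasure M {\<omega> \<in> space M. a powr (1 / \<beta>) * Z \<omega> \<le> t}" for a t
  define m where "m r t = (\<integral>\<^sup>+\<omega>. ennreal (frac_kernel \<beta> (t - r powr (1 / \<beta>) * Z \<omega>)) \<partial>M)" for r t
  define R where "R a t = (\<integral>\<^sup>+r. indicator {a<..} r * m r t \<partial>lborel)" for a t
  have L_alt: "L a t = (\<integral>\<^sup>+\<omega>. indicator {0..} (t - a powr (1 / \<beta>) * Z \<omega>) \<partial>M)" for a t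
  proof -
    have "(\<integral>\<^sup>+\<omega>. indicator {0..} (t - a powr (1 / \<beta>) * Z \<omega>) \<partial>M)
      = (\<integral>\<^sup>+\<omega>. indicator {\<omega> \<in> space M. a powr (1 / \<beta>) * Z \<omega> \<le> t} \<omega> \<partial>M)"
      by (intro nn_integral_cong) (auto simp: indicator_def)
    also have "\<dots> = L a t" unfolding L_def by (rule nn_integral_indicator) measurable
    finally show ?thesis by simp
  qed
  have m_meas [measurable]: "(\<lambda>(r, t). m r t) \<in> borel_measurable (borel \<Otimes>\<^sub>M borel)" unfolding m_def by measurable
  have L_meas [measurable]: "L a \<in> borel_measurable borel" for a unfolding L_alt[abs_def] by measurable
  have R_meas [measurable]: "R a \<in> borel_measurable borel" for a unfolding R_def[abs_def] by measurable
  have shift: "(\<integral>\<^sup>+t. ennreal (exp (- \<xi> * t)) * g (t - s) \<partial>lborel) = ennreal (exp (- \<xi> * s)) * (\<integral>\<^sup>+t. ennreal (exp (- \<xi> * t)) * g t \<partial>lborel)"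
    if [measurable]: "g \<in> borel_measurable borel" for g :: "real \<Rightarrow> ennreal" and \<xi> s
  proof -
    have "(\<integral>\<^sup>+t. ennreal (exp (- \<xi> * t)) * g (t - s) \<partial>lborel) = (\<integral>\<^sup>+t. ennreal (exp (- \<xi> * (s + 1 * t))) * g (s + 1 * t - s) \<partial>lborel)"
      by (subst nn_integral_real_affine[where c = 1 and t = s]) auto
    also have "\<dots> = (\<integral>\<^sup>+t. ennreal (exp (- \<xi> * s)) * (ennreal (exp (- \<xi> * t)) * g t) \<partial>lborel)"
    proof (rule nn_integral_cong)
      fix t
      have "exp (- \<xi> * (s + 1 * t)) = exp (- \<xi> * s) * exp (- \<xi> * t)"
        by (simp add: exp_add[symmetric] algebra_simps)
      thus "ennreal (exp (- \<xi> * (s + 1 * t))) * g (s + 1 * t - s) = ennreal (exp (- \<xi> * s)) * (ennreal (exp (- \<xi> * t)) * g t)"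
        by (simp add: ennreal_mult mult.assoc)
    qed
    finally show ?thesis by (simp add: nn_integral_cmult)
  qed
  have exp_int: "(\<integral>\<^sup>+t. ennreal (exp (- \<xi> * t)) * indicator {y..} t \<partial>lborel) = ennreal (exp (- \<xi> * y) / \<xi>)" if "\<xi> > 0" "y \<ge> 0" for \<xi> y
  proof -
    have "(\<integral>\<^sup>+t. ennreal (exp (- \<xi> * t)) * indicator {y..} t \<partial>lborel)
      = (\<integral>\<^sup>+t. ennreal (1 / \<xi>) * (ennreal (exponential_density \<xi> t) * indicator {y..} t) \<partial>lborel)"
      using that by (intro nn_integral_cong)
        (auto simp: exponential_density_def indicator_def ennreal_mult[symmetric] mult.commute)
    also have "\<dots> = ennreal (1 / \<xi>) * emeasure (density lborel (exponential_density \<xi>)) {y..}"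
      by (subst nn_integral_cmult) (auto simp: emeasure_density)
    also have "\<dots> = ennreal (exp (- \<xi> * y) / \<xi>)"
      using that by (simp add: emeasure_exponential_atLeast ennreal_mult[symmetric])
    finally show ?thesis .
  qed
  have L_lap: "(\<integral>\<^sup>+t. ennreal (exp (- \<xi> * t)) * L a t \<partial>lborel) = ennreal (exp (- a * \<xi> powr \<beta>) / \<xi>)" if \<xi>: "\<xi> > 0" and a: "a > 0" for \<xi> a
  proof -
    have "(\<integral>\<^sup>+t. ennreal (exp (- \<xi> * t)) * L a t \<partial>lborel)
        = (\<integral>\<^sup>+t. (\<integral>\<^sup>+\<omega>. ennreal (exp (- \<xi> * t)) * indicator {0..} (t - a powr (1 / \<beta>) * Z \<omega>) \<partial>M) \<partial>lborel)"
      unfolding L_alt by (simp add: nn_integral_cmult)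
    also have "\<dots> = (\<integral>\<^sup>+\<omega>. (\<integral>\<^sup>+t. ennreal (exp (- \<xi> * t)) * indicator {0..} (t - a powr (1 / \<beta>) * Z \<omega>) \<partial>lborel) \<partial>M)"
      by (rule pair_sigma_finite.Fubini') (auto intro: pair_sigma_finite.intro sigma_finite_measure_axioms sigma_finite_lborel)
    also have "\<dots> = (\<integral>\<^sup>+\<omega>. ennreal (1 / \<xi>) * ennreal (exp (- (\<xi> * a powr (1 / \<beta>)) * Z \<omega>)) \<partial>M)"
    proof (rule nn_integral_cong)
      fix \<omega>
      have e0: "(\<integral>\<^sup>+t. ennreal (exp (- \<xi> * t)) * indicator {0..} t \<partial>lborel) = ennreal (1 / \<xi>)"
        using exp_int[OF \<xi> order_refl] by simp
      have "(\<integral>\<^sup>+t. ennreal (exp (- \<xi> * t)) * indicator {0..} (t - a powr (1 / \<beta>) * Z \<omega>) \<partial>lborel)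
          = ennreal (exp (- \<xi> * (a powr (1 / \<beta>) * Z \<omega>))) * (\<integral>\<^sup>+t. ennreal (exp (- \<xi> * t)) * indicator {0..} t \<partial>lborel)"
        by (rule shift) simp
      also have "\<dots> = ennreal (1 / \<xi>) * ennreal (exp (- (\<xi> * a powr (1 / \<beta>)) * Z \<omega>))"
        unfolding e0 by (simp add: mult.commute mult.left_commute)
      finally show "(\<integral>\<^sup>+t. ennreal (exp (- \<xi> * t)) * indicator {0..} (t - a powr (1 / \<beta>) * Z \<omega>) \<partial>lborel)
          = ennreal (1 / \<xi>) * ennreal (exp (- (\<xi> * a powr (1 / \<beta>)) * Z \<omega>))" .
    qed
    also have "\<dots> = ennreal (1 / \<xi>) * ennreal (exp (- a * \<xi> powr \<beta>))"
      by (subst nn_integral_cmult) (auto simp only: lap'[OF \<xi> a], measurable)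
    finally show ?thesis using \<xi> by (simp add: ennreal_mult[symmetric])
  qed
  have R_lap: "(\<integral>\<^sup>+t. ennreal (exp (- \<xi> * t)) * R a t \<partial>lborel) = ennreal (exp (- a * \<xi> powr \<beta>) / \<xi>)" if \<xi>: "\<xi> > 0" and a: "a > 0" for \<xi> a
  proof -
    have m_lap: "(\<integral>\<^sup>+t. ennreal (exp (- \<xi> * t)) * m r t \<partial>lborel) = ennreal (\<xi> powr (\<beta> - 1) * exp (- r * \<xi> powr \<beta>))" if r: "r > 0" for r
    proof -
      have "(\<integral>\<^sup>+t. ennreal (exp (- \<xi> * t)) * m r t \<partial>lborel)
        = (\<integral>\<^sup>+t. (\<integral>\<^sup>+\<omega>. ennreal (exp (- \<xi> * t)) * ennreal (frac_kernel \<beta> (t - r powr (1 / \<beta>) * Z \<omega>)) \<partial>M) \<partial>lborel)"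
        unfolding m_def by (simp add: nn_integral_cmult)
      also have "\<dots> = (\<integral>\<^sup>+\<omega>. (\<integral>\<^sup>+t. ennreal (exp (- \<xi> * t)) * ennreal (frac_kernel \<beta> (t - r powr (1 / \<beta>) * Z \<omega>)) \<partial>lborel) \<partial>M)"
        by (rule pair_sigma_finite.Fubini') (auto intro: pair_sigma_finite.intro sigma_finite_measure_axioms sigma_finite_lborel)
      also have "\<dots> = (\<integral>\<^sup>+\<omega>. ennreal (\<xi> powr (\<beta> - 1)) * ennreal (exp (- (\<xi> * r powr (1 / \<beta>)) * Z \<omega>)) \<partial>M)"
      proof (rule nn_integral_cong)
        fix \<omega>
        have "(\<integral>\<^sup>+t. ennreal (exp (- \<xi> * t)) * ennreal (frac_kernel \<beta> t) \<partial>lborel) = ennreal (\<xi> powr (\<beta> - 1))"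
          using nn_integral_frac_kernel[OF \<beta>(2) \<xi>] by (simp add: ennreal_mult' frac_kernel_nonneg \<beta>)
        thus "(\<integral>\<^sup>+t. ennreal (exp (- \<xi> * t)) * ennreal (frac_kernel \<beta> (t - r powr (1 / \<beta>) * Z \<omega>)) \<partial>lborel)
          = ennreal (\<xi> powr (\<beta> - 1)) * ennreal (exp (- (\<xi> * r powr (1 / \<beta>)) * Z \<omega>))"
          by (subst shift[of "\<lambda>t. ennreal (frac_kernel \<beta> t)"]) (auto simp: mult_ac)
      qed
      also have "\<dots> = ennreal (\<xi> powr (\<beta> - 1)) * ennreal (exp (- r * \<xi> powr \<beta>))"
        by (subst nn_integral_cmult) (auto simp only: lap'[OF \<xi> r], measurable)
      finally show ?thesis by (simp add: ennreal_mult[symmetric])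
    qed
    have "(\<integral>\<^sup>+t. ennreal (exp (- \<xi> * t)) * R a t \<partial>lborel)
      = (\<integral>\<^sup>+t. (\<integral>\<^sup>+r. ennreal (exp (- \<xi> * t)) * (indicator {a<..} r * m r t) \<partial>lborel) \<partial>lborel)"
      unfolding R_def by (simp add: nn_integral_cmult)
    also have "\<dots> = (\<integral>\<^sup>+r. (\<integral>\<^sup>+t. ennreal (exp (- \<xi> * t)) * (indicator {a<..} r * m r t) \<partial>lborel) \<partial>lborel)"
      by (rule lborel_pair.Fubini') measurable
    also have "\<dots> = (\<integral>\<^sup>+r. indicator {a<..} r * (\<integral>\<^sup>+t. ennreal (exp (- \<xi> * t)) * m r t \<partial>lborel) \<partial>lborel)"
      by (simp add: nn_integral_cmult[symmetric] mult.left_commute)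
    also have "\<dots> = (\<integral>\<^sup>+r. ennreal (\<xi> powr (\<beta> - 1)) * (ennreal (exp (- (\<xi> powr \<beta>) * r)) * indicator {a..} r) \<partial>lborel)"
    proof (rule nn_integral_cong_AE, rule eventually_mono[OF AE_lborel_singleton[of a]])
      fix r assume "r \<noteq> a"
      show "indicator {a<..} r * (\<integral>\<^sup>+t. ennreal (exp (- \<xi> * t)) * m r t \<partial>lborel)
        = ennreal (\<xi> powr (\<beta> - 1)) * (ennreal (exp (- (\<xi> powr \<beta>) * r)) * indicator {a..} r)"
      proof (cases "a < r")
        case True
        hence "(\<integral>\<^sup>+t. ennreal (exp (- \<xi> * t)) * m r t \<partial>lborel) = ennreal (\<xi> powr (\<beta> - 1) * exp (- r * \<xi> powr \<beta>))"
          using a by (intro m_lap) simp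
        also have "\<dots> = ennreal (\<xi> powr (\<beta> - 1)) * ennreal (exp (- (\<xi> powr \<beta>) * r))"
          by (subst ennreal_mult[symmetric]) (auto simp: mult.commute)
        finally show ?thesis using True by simp
      qed (use \<open>r \<noteq> a\<close> in simp)
    qed
    also have "\<dots> = ennreal (\<xi> powr (\<beta> - 1)) * ennreal (exp (- (\<xi> powr \<beta>) * a) / \<xi> powr \<beta>)"
    proof -
      have e: "(\<integral>\<^sup>+r. ennreal (exp (- (\<xi> powr \<beta>) * r)) * indicator {a..} r \<partial>lborel) = ennreal (exp (- (\<xi> powr \<beta>) * a) / \<xi> powr \<beta>)"
        by (rule exp_int) (use \<xi> a in auto)
      show ?thesis unfolding e[symmetric] by (rule nn_integral_cmult) simp
    qed
    also have "\<dots> = ennreal (exp (- a * \<xi> powr \<beta>) / \<xi>)"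
      using \<xi> by (subst ennreal_mult[symmetric]) (auto simp: powr_diff mult.commute)
    finally show ?thesis .
  qed
  have LR: "AE t in lborel. L a t = R a t" if a: "a > 0" for a
  proof -
    have neg: "L a t = 0" "R a t = 0" if "t < 0" for t
    proof -
      have less: "t < x powr (1 / \<beta>) * Z \<omega>" if "\<omega> \<in> space M" for x \<omega>
        using less_le_trans[OF \<open>t < 0\<close>] pos[OF that] by simp
      hence "{\<omega> \<in> space M. a powr (1 / \<beta>) * Z \<omega> \<le> t} = {}"
        by (metis (no_types, lifting) Collect_empty_eq not_le)
      thus "L a t = 0" unfolding L_def by (simp only: emeasure_empty)
      have "frac_kernel \<beta> (t - r powr (1 / \<beta>) * Z \<omega>) = 0" if "\<omega> \<in> space M" for r \<omega>
        using less[OF that, of r] by (simp add: frac_kernel_def)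
      hence "m r t = (\<integral>\<^sup>+\<omega>. 0 \<partial>M)" for r
        unfolding m_def by (intro nn_integral_cong) simp
      thus "R a t = 0" unfolding R_def by simp
    qed
    have fin: "finite_measure (density lborel (\<lambda>t. ennreal (exp (- 1 * t)) * g t))"
      if [measurable]: "g \<in> borel_measurable borel" and "(\<integral>\<^sup>+t. ennreal (exp (- 1 * t)) * g t \<partial>lborel) = ennreal c" for g c
      using that by (intro finite_measureI) (auto simp: emeasure_density)
    have ge0: "AE t in density lborel (\<lambda>t. ennreal (exp (- 1 * t)) * g t). 0 \<le> t"
      if [measurable]: "g \<in> borel_measurable borel" and "\<And>t. t < 0 \<Longrightarrow> g t = 0" for g
      by (subst AE_density) (use that(2) in \<open>auto intro!: AE_I2 leI\<close>)
    have int: "(\<integral>t. exp (- real n * t) \<partial>density lborel (\<lambda>t. ennreal (exp (- 1 * t)) * g t))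
        = enn2real (\<integral>\<^sup>+t. ennreal (exp (- (real n + 1) * t)) * g t \<partial>lborel)"
      if [measurable]: "g \<in> borel_measurable borel" for g n
    proof -
      have "(\<integral>t. exp (- real n * t) \<partial>density lborel (\<lambda>t. ennreal (exp (- 1 * t)) * g t))
        = enn2real (\<integral>\<^sup>+t. ennreal (exp (- real n * t)) \<partial>density lborel (\<lambda>t. ennreal (exp (- 1 * t)) * g t))"
        by (rule integral_eq_nn_integral) auto
      also have "(\<integral>\<^sup>+t. ennreal (exp (- real n * t)) \<partial>density lborel (\<lambda>t. ennreal (exp (- 1 * t)) * g t))
        = (\<integral>\<^sup>+t. ennreal (exp (- (real n + 1) * t)) * g t \<partial>lborel)"
      proof (subst nn_integral_density)
        have "ennreal (exp (- 1 * t)) * g t * ennreal (exp (- real n * t)) = ennreal (exp (- (real n + 1) * t)) * g t" for t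
        proof -
          have "exp (- (real n + 1) * t) = exp (- 1 * t) * exp (- real n * t)"
            by (simp add: exp_add[symmetric] algebra_simps)
          thus ?thesis by (simp only: ennreal_mult[OF exp_ge_zero exp_ge_zero] mult_ac)
        qed
        thus "(\<integral>\<^sup>+t. ennreal (exp (- 1 * t)) * g t * ennreal (exp (- real n * t)) \<partial>lborel)
          = (\<integral>\<^sup>+t. ennreal (exp (- (real n + 1) * t)) * g t \<partial>lborel)" by simp
      qed auto
      finally show ?thesis .
    qed
    have eq1: "(\<integral>\<^sup>+t. ennreal (exp (- (real n + 1) * t)) * L a t \<partial>lborel) = (\<integral>\<^sup>+t. ennreal (exp (- (real n + 1) * t)) * R a t \<partial>lborel)" for n :: nat
      using L_lap[of "real n + 1" a] R_lap[of "real n + 1" a] a by simp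
    have "density lborel (\<lambda>t. ennreal (exp (- 1 * t)) * L a t) = density lborel (\<lambda>t. ennreal (exp (- 1 * t)) * R a t)"
    proof (rule laplace_unique_measure)
      show "finite_measure (density lborel (\<lambda>t. ennreal (exp (- 1 * t)) * L a t))"
        by (rule fin[OF L_meas L_lap[OF zero_less_one a]])
      show "finite_measure (density lborel (\<lambda>t. ennreal (exp (- 1 * t)) * R a t))"
        by (rule fin[OF R_meas R_lap[OF zero_less_one a]])
      show "AE t in density lborel (\<lambda>t. ennreal (exp (- 1 * t)) * L a t). 0 \<le> t"
        by (rule ge0[OF L_meas neg(1)])
      show "AE t in density lborel (\<lambda>t. ennreal (exp (- 1 * t)) * R a t). 0 \<le> t"
        by (rule ge0[OF R_meas neg(2)])
      show "(\<integral>t. exp (- real n * t) \<partial>density lborel (\<lambda>t. ennreal (exp (- 1 * t)) * L a t))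
        = (\<integral>t. exp (- real n * t) \<partial>density lborel (\<lambda>t. ennreal (exp (- 1 * t)) * R a t))" for n :: nat
        by (simp only: int[OF L_meas] int[OF R_meas] eq1)
    qed auto
    hence "AE t in lborel. ennreal (exp (- 1 * t)) * L a t = ennreal (exp (- 1 * t)) * R a t"
      by (intro sigma_finite_measure.density_unique sigma_finite_lborel) auto
    thus ?thesis
    proof eventually_elim
      case (elim t)
      thus ?case
        unfolding ennreal_mult_cancel_left by (simp add: ennreal_eq_0_iff not_le)
    qed
  qed
  \<comment> \<open>Rational levels \<open>a\<close> keep the exceptional set of times null, so that
    a single \<open>t > 0\<close> serves all of them.\<close>
  have "AE t in lborel. \<forall>a\<in>{a\<in>\<rat>. a > 0}. L a t = R a t"
    by (subst AE_ball_countable) (auto intro: LR countable_subset[OF _ countable_rat])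
  hence "\<exists>t>0. \<forall>a\<in>{a\<in>\<rat>. a > 0}. L a t = R a t"
  proof (rule contrapos_pp)
    assume "\<not> (\<exists>t>0. \<forall>a\<in>{a\<in>\<rat>. a > 0}. L a t = R a t)"
    hence imp: "(\<forall>a\<in>{a\<in>\<rat>. a > 0}. L a t = R a t) \<Longrightarrow> t \<notin> {0<..<1}" for t by auto
    show "\<not> (AE t in lborel. \<forall>a\<in>{a\<in>\<rat>. a > 0}. L a t = R a t)"
    proof
      assume "AE t in lborel. \<forall>a\<in>{a\<in>\<rat>. a > 0}. L a t = R a t"
      hence "AE t in lborel. t \<notin> {0<..<1::real}" by (rule eventually_mono) (rule imp)
      moreover have "{x \<in> space lborel. \<not> x \<notin> {0<..<1::real}} = {0<..<1}" by auto
      ultimately have "emeasure lborel {0<..<1::real} = 0"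
        using AE_iff_measurable[of "{0<..<1::real}" lborel "\<lambda>x. x \<notin> {0<..<1}"] by simp
      thus False by simp
    qed
  qed
  then obtain t where t: "t > 0" and LR_t: "\<And>a. a \<in> \<rat> \<Longrightarrow> a > 0 \<Longrightarrow> L a t = R a t" by auto
  \<comment> \<open>\<open>E\<close> represents the inverse at time \<open>t\<close>: when
    \<open>Z > 0\<close> and \<open>a > 0\<close>, the inequality \<open>a \<le> E\<close> means
    \<open>a powr (1 / \<beta>) * Z \<le> t\<close>.\<close>
  define E where "E \<omega> = t powr \<beta> * Z \<omega> powr (- \<beta>)" for \<omega>
  have [measurable]: "E \<in> borel_measurable M" unfolding E_def by measurable
  have [measurable]: "(\<lambda>r. m r t) \<in> borel_measurable borel"
    using measurable_compose[OF _ m_meas, of "\<lambda>r. (r, t)" borel] by simp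
  have E_ge: "emeasure M {\<omega> \<in> space M. a \<le> E \<omega>} = L a t" if a: "a > 0" for a
  proof -
    have iff: "a \<le> E \<omega> \<longleftrightarrow> a powr (1 / \<beta>) * Z \<omega> \<le> t" if Z0: "0 < Z \<omega>" for \<omega>
    proof -
      have "a \<le> E \<omega> \<longleftrightarrow> a * Z \<omega> powr \<beta> \<le> t powr \<beta>"
        unfolding E_def powr_minus divide_inverse[symmetric]
        using Z0 by (intro pos_le_divide_eq) simp
      also have "a * Z \<omega> powr \<beta> = (a powr (1 / \<beta>) * Z \<omega>) powr \<beta>"
        using a Z0 \<beta> by (simp add: powr_mult powr_powr)
      also have "\<dots> \<le> t powr \<beta> \<longleftrightarrow> a powr (1 / \<beta>) * Z \<omega> \<le> t"
        by (rule powr_le_iff_base) (use a Z0 t \<beta> in auto)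
      finally show ?thesis .
    qed
    have "{\<omega> \<in> space M. a \<le> E \<omega>} \<in> sets M" by measurable
    moreover have "{\<omega> \<in> space M. a powr (1 / \<beta>) * Z \<omega> \<le> t} \<in> sets M" by measurable
    ultimately show ?thesis
      unfolding L_def by (intro emeasure_eq_AE eventually_mono[OF AE_pos]) (simp_all add: iff)
  qed
  define \<mu> where "\<mu> = density (distr M borel E) (indicator {0<..})"
  define \<nu> where "\<nu> = density lborel (\<lambda>r. indicator {0<..} r * m r t)"
  have \<mu>: "emeasure \<mu> S = emeasure (distr M borel E) ({0<..} \<inter> S)" if "S \<in> sets borel" for S
    unfolding \<mu>_def using that by (intro emeasure_restricted) auto
  have \<mu>_ge: "emeasure \<mu> {a..} = L a t" if "a > 0" for a
  proof -
    have "{0<..} \<inter> {a..} = {a..}" "E -` {a..} \<inter> space M = {\<omega> \<in> space M. a \<le> E \<omega>}" using that by auto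
    thus ?thesis using E_ge[OF that] by (simp add: \<mu> emeasure_distr)
  qed
  have \<nu>_gt: "emeasure \<nu> {a<..} = R a t" if "a \<ge> 0" for a
    unfolding \<nu>_def R_def by (subst emeasure_density) (use that in \<open>auto intro!: nn_integral_cong simp: indicator_def\<close>)
  have sets: "sets \<mu> = sets borel" "sets \<nu> = sets borel" by (simp_all add: \<mu>_def \<nu>_def)
  \<comment> \<open>The tails of \<open>\<mu>\<close> are known on closed half-lines, those of
    \<open>\<nu>\<close> on open ones, and they are matched at rational points only. Comparing with
    some room and then exhausting \<open>{x<..}\<close> from inside removes both
    discrepancies.\<close>
  have squeeze: "emeasure \<kappa> {x<..} \<le> emeasure \<kappa>' {x<..}"
    if s: "sets \<kappa> = sets borel" and s': "sets \<kappa>' = sets borel" and x: "x \<ge> 0"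
      and le: "\<And>a y. a \<in> \<rat> \<Longrightarrow> x < a \<Longrightarrow> a < y \<Longrightarrow> emeasure \<kappa> {y<..} \<le> emeasure \<kappa>' {x<..}" for \<kappa> \<kappa>' :: "real measure" and x :: real
  proof -
    have "(\<Union>n. {x + 1 / real (Suc n)<..}) = {x<..}"
    proof safe
      fix y n assume "x + 1 / real (Suc n) < y"
      moreover have "1 / real (Suc n) > 0" by simp
      ultimately show "x < y" by linarith
    next
      fix y assume "x < y"
      then obtain n where "1 / real (Suc n) < y - x"
        using nat_approx_posE[of "y - x"] by (metis diff_gt_0_iff_gt)
      thus "y \<in> (\<Union>n. {x + 1 / real (Suc n)<..})" by (auto intro!: exI[of _ n])
    qed
    moreover have "incseq (\<lambda>n. {x + 1 / real (Suc n)<..})"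
    proof (rule incseq_SucI, rule subsetI)
      fix n y assume "y \<in> {x + 1 / real (Suc n)<..}"
      moreover have "1 / real (Suc (Suc n)) \<le> 1 / real (Suc n)" by (intro divide_left_mono) auto
      ultimately show "y \<in> {x + 1 / real (Suc (Suc n))<..}"
        unfolding greaterThan_iff by (meson add_left_mono order_le_less_trans)
    qed
    moreover have "range (\<lambda>n. {x + 1 / real (Suc n)<..}) \<subseteq> sets \<kappa>"
      unfolding s by (rule image_subsetI) (rule borel_open[OF open_greaterThan])
    ultimately have "emeasure \<kappa> {x<..} = (SUP n. emeasure \<kappa> {x + 1 / real (Suc n)<..})"
      using SUP_emeasure_incseq[of "\<lambda>n. {x + 1 / real (Suc n)<..}" \<kappa>] by (simp only: simp_thms)
    also have "\<dots> \<le> emeasure \<kappa>' {x<..}"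
    proof (rule SUP_least)
      fix n
      have "x < x + 1 / real (Suc n)" by simp
      then obtain a where "a \<in> \<rat>" "x < a" "a < x + 1 / real (Suc n)"
        using Rats_dense_in_real by blast
      thus "emeasure \<kappa> {x + 1 / real (Suc n)<..} \<le> emeasure \<kappa>' {x<..}" by (rule le)
    qed
    finally show ?thesis .
  qed
  have eq_gt: "emeasure \<mu> {x<..} = emeasure \<nu> {x<..}" if x: "x \<ge> 0" for x
  proof (rule antisym)
    show "emeasure \<mu> {x<..} \<le> emeasure \<nu> {x<..}"
    proof (rule squeeze[OF sets x])
      fix a y :: real assume a: "a \<in> \<rat>" "x < a" "a < y"
      have "emeasure \<mu> {y<..} \<le> emeasure \<mu> {a..}" using a sets by (intro emeasure_mono) auto
      also have "\<dots> = emeasure \<nu> {a<..}" using a x by (simp add: \<mu>_ge \<nu>_gt LR_t)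
      also have "\<dots> \<le> emeasure \<nu> {x<..}" using a sets by (intro emeasure_mono) auto
      finally show "emeasure \<mu> {y<..} \<le> emeasure \<nu> {x<..}" .
    qed
    show "emeasure \<nu> {x<..} \<le> emeasure \<mu> {x<..}"
    proof (rule squeeze[OF sets(2,1) x])
      fix a y :: real assume a: "a \<in> \<rat>" "x < a" "a < y"
      have "emeasure \<nu> {y<..} \<le> emeasure \<nu> {a<..}" using a sets by (intro emeasure_mono) auto
      also have "\<dots> = emeasure \<mu> {a..}" using a x by (simp add: \<mu>_ge \<nu>_gt LR_t)
      also have "\<dots> \<le> emeasure \<mu> {x<..}" using a sets by (intro emeasure_mono) auto
      finally show "emeasure \<nu> {y<..} \<le> emeasure \<mu> {x<..}" .
    qed
  qed
  have "\<mu> = \<nu>"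
  proof (rule measure_eqI_lessThan[OF sets])
    have \<mu>_fin: "emeasure \<mu> S < \<infinity>" if "S \<in> sets borel" for S
      unfolding \<mu>[OF that] using that
      by (simp add: emeasure_distr emeasure_eq_measure)
    thus "emeasure \<mu> {x<..} < \<infinity>" for x by simp
    have red: "emeasure \<mu> {x<..} = emeasure \<mu> {0<..}" "emeasure \<nu> {x<..} = emeasure \<nu> {0<..}" if "x < 0" for x
    proof -
      have "{0<..} \<inter> {x<..} = {0<..}" using that by auto
      thus "emeasure \<mu> {x<..} = emeasure \<mu> {0<..}" by (simp add: \<mu>)
      show "emeasure \<nu> {x<..} = emeasure \<nu> {0<..}"
        unfolding \<nu>_def using that by (subst (1 2) emeasure_density) (auto intro!: nn_integral_cong simp: indicator_def)
    qed
    show "emeasure \<mu> {x<..} = emeasure \<nu> {x<..}" for x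
      using eq_gt[of x] eq_gt[of 0] red[of x] by (cases "x < 0") auto
  qed
  have "absolutely_continuous lborel (distr M borel E)"
    unfolding absolutely_continuous_def
  proof
    fix S :: "real set" assume S: "S \<in> null_sets lborel"
    have "absolutely_continuous lborel \<mu>"
      unfolding \<open>\<mu> = \<nu>\<close> \<nu>_def by (rule absolutely_continuousI_density) measurable
    hence "emeasure \<mu> S = 0" using S by (auto simp: absolutely_continuous_def)
    moreover have "S \<in> sets borel" using S by auto
    ultimately have "emeasure (distr M borel E) ({0<..} \<inter> S) = 0" by (simp add: \<mu>)
    moreover have "emeasure (distr M borel E) S = emeasure (distr M borel E) ({0<..} \<inter> S)"
    proof (rule emeasure_eq_AE)
      have "AE \<omega> in M. 0 < E \<omega>" using AE_pos by eventually_elim (use t in \<open>simp add: E_def\<close>)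
      hence "AE x in distr M borel E. 0 < x" by (subst AE_distr_iff) auto
      thus "AE x in distr M borel E. (x \<in> S) = (x \<in> {0<..} \<inter> S)" by eventually_elim auto
    qed (use S in auto)
    ultimately show "S \<in> null_sets (distr M borel E)" using S by (auto simp: null_sets_def)
  qed
  thus ?thesis using t by (intro exI[of _ "t powr \<beta>"]) (simp add: E_def[abs_def])
qed

section \<open>Absolute continuity of the hitting time\<close>

context hitting_setup
begin

text \<open>The events \<open>N a = k\<close> and \<open>N a' = k\<close> differ only if
  \<open>N\<close> jumps in between, which has probability
  \<open>1 - exp (- rate * (a' - a))\<close>. Averaging over the increment of \<open>A\<close>
  replaces \<open>rate\<close> by \<open>rate powr \<gamma>\<close>, and
  \<open>1 - exp (- z) \<le> z\<close> gives the Lipschitz constant.\<close>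

lemma K_prob_lipschitz:
  assumes x: "0 \<le> x" "x \<le> y"
  shows "\<bar>(\<integral>\<omega>. indicat_real {k} (K x \<omega>) \<partial>M) - (\<integral>\<omega>. indicat_real {k} (K y \<omega>) \<partial>M)\<bar> \<le> rate powr \<gamma> * (y - x)"
proof -
  define G where "G a = (\<integral>\<omega>. indicat_real {k} (N a \<omega>) \<partial>M)" for a
  have K_G: "(\<integral>\<omega>. indicat_real {k} (K z \<omega>) \<partial>M) = (\<integral>\<omega>. G (A z \<omega>) \<partial>M)" if "0 \<le> z" for z
    using subordinated_expectation[OF that, of "\<lambda>_. 1" "indicat_real {k}" 1 1]
    by (simp add: G_def prob_space indicator_def)
  have G_lip: "\<bar>G a - G a'\<bar> \<le> 1 - exp (- rate * (a' - a))" if a: "0 \<le> a" "a \<le> a'" for a a'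
  proof (cases "a = a'")
    case False
    hence "a < a'" using a by simp
    have [measurable]: "N a \<in> measurable M (count_space UNIV)" "N a' \<in> measurable M (count_space UNIV)"
      using a by (auto intro!: N_meas)
    have int: "integrable M (\<lambda>\<omega>. indicat_real S (N c \<omega>))" if "c \<ge> 0" for S c
    proof -
      have [measurable]: "N c \<in> measurable M (count_space UNIV)" by (rule N_meas[OF that])
      show ?thesis by (rule integrable_const_bound[of _ 1]) (auto simp: indicator_def)
    qed
    have "(\<lambda>\<omega>. indicat_real {0} (N a' \<omega> - N a \<omega>)) \<in> borel_measurable M" by measurable
    hence int': "integrable M (\<lambda>\<omega>. indicat_real {0} (N a' \<omega> - N a \<omega>))"
      by (rule integrable_const_bound[of _ 1, rotated]) (auto simp: indicator_def)
    have "\<bar>G a - G a'\<bar> = \<bar>\<integral>\<omega>. indicat_real {k} (N a \<omega>) - indicat_real {k} (N a' \<omega>) \<partial>M\<bar>"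
      unfolding G_def using int a by simp
    also have "\<dots> \<le> (\<integral>\<omega>. \<bar>indicat_real {k} (N a \<omega>) - indicat_real {k} (N a' \<omega>)\<bar> \<partial>M)"
      by (rule integral_abs_bound)
    also have "\<dots> \<le> (\<integral>\<omega>. 1 - indicat_real {0} (N a' \<omega> - N a \<omega>) \<partial>M)"
    proof (rule integral_mono)
      show "integrable M (\<lambda>\<omega>. \<bar>indicat_real {k} (N a \<omega>) - indicat_real {k} (N a' \<omega>)\<bar>)"
        using int a by (intro integrable_abs Bochner_Integration.integrable_diff) auto
      show "integrable M (\<lambda>\<omega>. 1 - indicat_real {0} (N a' \<omega> - N a \<omega>))"
        using int' by simp
      show "\<bar>indicat_real {k} (N a \<omega>) - indicat_real {k} (N a' \<omega>)\<bar> \<le> 1 - indicat_real {0} (N a' \<omega> - N a \<omega>)"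
        if "\<omega> \<in> space M" for \<omega>
        using N_mono[OF that a] by (auto simp: indicator_def)
    qed
    also have "\<dots> = 1 - (\<integral>\<omega>. indicat_real {0} (N a' \<omega> - N a \<omega>) \<partial>M)"
      using int' by (simp add: prob_space)
    also have "(\<integral>\<omega>. indicat_real {0} (N a' \<omega> - N a \<omega>) \<partial>M)
        = (\<integral>n. indicat_real {0} n \<partial>distr M (count_space UNIV) (\<lambda>\<omega>. N a' \<omega> - N a \<omega>))"
      by (subst integral_distr) auto
    also have "distr M (count_space UNIV) (\<lambda>\<omega>. N a' \<omega> - N a \<omega>) = measure_pmf (poisson_pmf (rate * (a' - a)))"
      using N a \<open>a < a'\<close> by (auto simp: poisson_process_def)
    also have "(\<integral>n. indicat_real {0} n \<partial>measure_pmf (poisson_pmf (rate * (a' - a)))) = pmf (poisson_pmf (rate * (a' - a))) 0"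
      by (simp add: pmf.rep_eq)
    also have "\<dots> = exp (- rate * (a' - a))"
      using rate \<open>a < a'\<close> by (subst pmf_poisson) auto
    finally show ?thesis .
  qed simp
  have G_meas: "(\<lambda>\<omega>. G (A z \<omega>)) \<in> borel_measurable M" "\<And>\<omega>. \<omega> \<in> space M \<Longrightarrow> \<bar>G (A z \<omega>)\<bar> \<le> 1" if z: "0 \<le> z" for z
  proof -
    have bd: "\<bar>G a\<bar> \<le> 1" for a
    proof -
      have "\<bar>G a\<bar> \<le> (\<integral>\<omega>. \<bar>indicat_real {k} (N a \<omega>)\<bar> \<partial>M)" unfolding G_def by (rule integral_abs_bound)
      also have "\<dots> \<le> (\<integral>\<omega>. 1 \<partial>M)" by (rule integral_mono') (auto simp: indicator_def)
      finally show ?thesis by (simp add: prob_space)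
    qed
    thus "\<And>\<omega>. \<omega> \<in> space M \<Longrightarrow> \<bar>G (A z \<omega>)\<bar> \<le> 1" by blast
    \<comment> \<open>Continuity serves the measurability of \<open>G\<close> composed with
      \<open>A z\<close>.\<close>
    have "continuous_on {0..} G"
      unfolding continuous_on_iff
    proof (intro ballI allI impI)
      fix a e :: real assume a: "a \<in> {0..}" and e: "e > 0"
      have lip: "\<bar>G c - G d\<bar> \<le> rate * \<bar>d - c\<bar>" if "0 \<le> c" "0 \<le> d" for c d
      proof -
        have *: "\<bar>G c - G d\<bar> \<le> rate * \<bar>d - c\<bar>" if "0 \<le> c" "c \<le> d" for c d
          using G_lip[OF that] exp_ge_add_one_self[of "- rate * (d - c)"] that by simp
        show ?thesis using *[of c d] *[of d c] that by (cases "c \<le> d") (auto simp: abs_minus_commute)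
      qed
      show "\<exists>d>0. \<forall>x'\<in>{0..}. dist x' a < d \<longrightarrow> dist (G x') (G a) < e"
      proof (intro exI conjI ballI impI)
        show "e / rate > 0" using e rate by simp
        fix x' assume "x' \<in> {0..}" "dist x' a < e / rate"
        thus "dist (G x') (G a) < e"
          using lip[of x' a] a rate by (auto simp: dist_real_def field_simps abs_minus_commute)
      qed
    qed
    hence "(\<lambda>a. if a \<in> {0..} then G a else 0) \<in> borel_measurable borel"
      by (intro borel_measurable_continuous_on_if) auto
    from measurable_compose[OF A_meas[OF z] this] have "(\<lambda>\<omega>. if A z \<omega> \<in> {0..} then G (A z \<omega>) else 0) \<in> borel_measurable M" .
    also have "?this \<longleftrightarrow> (\<lambda>\<omega>. G (A z \<omega>)) \<in> borel_measurable M"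
      using A_nonneg[OF _ z] by (intro measurable_cong) auto
    finally show "(\<lambda>\<omega>. G (A z \<omega>)) \<in> borel_measurable M" .
  qed
  have y: "0 \<le> y" using x by simp
  have int: "integrable M (\<lambda>\<omega>. G (A z \<omega>))" if "0 \<le> z" for z
    using G_meas[OF that] by (intro integrable_const_bound[of _ 1] AE_I2) auto
  have [measurable]: "A x \<in> borel_measurable M" "A y \<in> borel_measurable M" by (auto intro: A_meas x y)
  have int_exp: "integrable M (\<lambda>\<omega>. exp (- rate * (A y \<omega> - A x \<omega>)))"
    by (intro integrable_const_bound[of _ 1] AE_I2) (use rate A_mono[OF _ x] in auto)
  have "\<bar>(\<integral>\<omega>. G (A x \<omega>) \<partial>M) - (\<integral>\<omega>. G (A y \<omega>) \<partial>M)\<bar> = \<bar>\<integral>\<omega>. G (A x \<omega>) - G (A y \<omega>) \<partial>M\<bar>"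
    using int[OF x(1)] int[OF y] by simp
  also have "\<dots> \<le> (\<integral>\<omega>. \<bar>G (A x \<omega>) - G (A y \<omega>)\<bar> \<partial>M)" by (rule integral_abs_bound)
  also have "\<dots> \<le> (\<integral>\<omega>. 1 - exp (- rate * (A y \<omega> - A x \<omega>)) \<partial>M)"
    using int[OF x(1)] int[OF y] int_exp by (intro integral_mono G_lip A_nonneg A_mono x) auto
  also have "\<dots> = 1 - exp (- (y - x) * rate powr \<gamma>)"
    using int_exp A_exp[OF x, of rate] rate by (simp add: prob_space)
  also have "\<dots> \<le> rate powr \<gamma> * (y - x)"
  proof -
    have eq: "- (y - x) * rate powr \<gamma> = - (rate powr \<gamma> * (y - x))" by (simp add: algebra_simps)
    show ?thesis unfolding eq using exp_ge_add_one_self[of "- (rate powr \<gamma> * (y - x))"] by linarith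
  qed
  finally show ?thesis using K_G x y by simp
qed

text \<open>The event is split according to \<open>K x = k\<close>, and the subordinated expectation
  separates \<open>K x\<close> from \<open>B x\<close>. As \<open>b * B x\<close> is nonnegative and
  \<open>t < n\<close>, only \<open>k < n\<close> can occur.\<close>

lemma Y_prob_eq_sum:
  assumes x: "0 \<le> x" and t: "0 \<le> t" "t < real n"
  shows "prob {\<omega> \<in> space M. Y x \<omega> \<le> t}
    = (\<Sum>k<n. (\<integral>\<omega>. indicat_real {k} (K x \<omega>) \<partial>M) * prob {\<omega> \<in> space M. b * B x \<omega> \<le> t - real k})"
proof -
  have [measurable]: "K x \<in> measurable M (count_space UNIV)" "B x \<in> borel_measurable M" "Y x \<in> borel_measurable M"
    using x by (auto intro: K_meas B_meas Y_meas)
  have eq: "indicat_real {\<omega> \<in> space M. Y x \<omega> \<le> t} \<omega> = (\<Sum>k<n. indicat_real {k} (K x \<omega>) * indicat_real {..t - real k} (b * B x \<omega>))"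
    if "\<omega> \<in> space M" for \<omega>
  proof -
    have "0 \<le> b * B x \<omega>" using B_nonneg[OF that x] b by simp
    hence "Y x \<omega> \<le> t \<Longrightarrow> K x \<omega> < n" using t by (simp add: Y_def)
    moreover have "(\<Sum>k<n. indicat_real {k} (K x \<omega>) * indicat_real {..t - real k} (b * B x \<omega>))
        = (\<Sum>k<n. if k = K x \<omega> then indicat_real {..t - real k} (b * B x \<omega>) else 0)"
      by (intro sum.cong) (auto simp: indicator_def)
    ultimately show ?thesis using that by (auto simp: indicator_def Y_def)
  qed
  have int: "integrable M (\<lambda>\<omega>. indicat_real {k} (K x \<omega>) * indicat_real {..t - real k} (b * B x \<omega>))" for k
    by (rule integrable_const_bound[of _ 1]) (auto simp: indicator_def)
  have "prob {\<omega> \<in> space M. Y x \<omega> \<le> t} = (\<integral>\<omega>. indicat_real {\<omega> \<in> space M. Y x \<omega> \<le> t} \<omega> \<partial>M)" by simp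
  also have "\<dots> = (\<integral>\<omega>. (\<Sum>k<n. indicat_real {k} (K x \<omega>) * indicat_real {..t - real k} (b * B x \<omega>)) \<partial>M)"
    by (intro Bochner_Integration.integral_cong refl eq)
  also have "\<dots> = (\<Sum>k<n. (\<integral>\<omega>. indicat_real {k} (K x \<omega>) * indicat_real {..t - real k} (b * B x \<omega>) \<partial>M))"
    by (rule Bochner_Integration.integral_sum) (rule int)
  also have "\<dots> = (\<Sum>k<n. (\<integral>\<omega>. indicat_real {k} (K x \<omega>) \<partial>M) * prob {\<omega> \<in> space M. b * B x \<omega> \<le> t - real k})"
  proof (intro sum.cong refl)
    fix k
    have "(\<integral>\<omega>. indicat_real {k} (K x \<omega>) * indicat_real {..t - real k} (b * B x \<omega>) \<partial>M)
      = (\<integral>\<omega>. (\<integral>\<omega>'. indicat_real {k} (N (A x \<omega>) \<omega>') \<partial>M) \<partial>M) * (\<integral>\<omega>. indicat_real {..t - real k} (b * B x \<omega>) \<partial>M)"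
      by (rule subordinated_expectation[OF x, where C = 1 and D = 1 and r = "\<lambda>y. indicat_real {..t - real k} (b * y)"])
        (auto simp: indicator_def)
    also have "(\<integral>\<omega>. (\<integral>\<omega>'. indicat_real {k} (N (A x \<omega>) \<omega>') \<partial>M) \<partial>M) = (\<integral>\<omega>. indicat_real {k} (K x \<omega>) \<partial>M)"
      using subordinated_expectation[OF x, of "\<lambda>_. 1" "indicat_real {k}" 1 1]
      by (simp add: prob_space indicator_def)
    also have "(\<integral>\<omega>. indicat_real {..t - real k} (b * B x \<omega>) \<partial>M) = (\<integral>\<omega>. indicat_real {\<omega> \<in> space M. b * B x \<omega> \<le> t - real k} \<omega> \<partial>M)"
      by (intro Bochner_Integration.integral_cong) (auto simp: indicator_def)
    also have "\<dots> = prob {\<omega> \<in> space M. b * B x \<omega> \<le> t - real k}" by simp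
    finally show "(\<integral>\<omega>. indicat_real {k} (K x \<omega>) * indicat_real {..t - real k} (b * B x \<omega>) \<partial>M)
      = (\<integral>\<omega>. indicat_real {k} (K x \<omega>) \<partial>M) * prob {\<omega> \<in> space M. b * B x \<omega> \<le> t - real k}" .
  qed
  finally show ?thesis .
qed

text \<open>With \<open>p\<close> and \<open>F\<close> for the two factors of a summand, \<open>p x
  * F x - p y * F y = (p x - p y) * F x + p y * (F x - F y)\<close>. The first term is controlled by
  the Lipschitz bound, the second by \<open>F x - F y\<close>, since \<open>p y \<le> 1\<close> and
  \<open>F\<close> decreases.\<close>

lemma Y_prob_increment:
  assumes x: "0 \<le> x" "x \<le> y" and t: "0 \<le> t" "t < real n"
  shows "prob {\<omega> \<in> space M. Y x \<omega> \<le> t} - prob {\<omega> \<in> space M. Y y \<omega> \<le> t}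
    \<le> (\<Sum>k<n. rate powr \<gamma> * (y - x) + (prob {\<omega> \<in> space M. b * B x \<omega> \<le> t - real k} - prob {\<omega> \<in> space M. b * B y \<omega> \<le> t - real k}))"
proof -
  have y: "0 \<le> y" using x by simp
  have [measurable]: "B x \<in> borel_measurable M" by (rule B_meas[OF x(1)])
  define p where "p z k = (\<integral>\<omega>. indicat_real {k} (K z \<omega>) \<partial>M)" for z k
  define F where "F z k = prob {\<omega> \<in> space M. b * B z \<omega> \<le> t - real k}" for z k
  have "prob {\<omega> \<in> space M. Y x \<omega> \<le> t} - prob {\<omega> \<in> space M. Y y \<omega> \<le> t} = (\<Sum>k<n. p x k * F x k - p y k * F y k)"
    using Y_prob_eq_sum[OF x(1) t] Y_prob_eq_sum[OF y t] by (simp add: p_def F_def sum_subtractf)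
  also have "\<dots> \<le> (\<Sum>k<n. rate powr \<gamma> * (y - x) + (F x k - F y k))"
  proof (rule sum_mono)
    fix k
    have F01: "0 \<le> F x k" "F x k \<le> 1" by (auto simp: F_def)
    have "F y k \<le> F x k" unfolding F_def
    proof (rule finite_measure_mono)
      have "b * B x \<omega> \<le> b * B y \<omega>" if "\<omega> \<in> space M" for \<omega>
        using B_mono[OF that x] b by (rule mult_left_mono)
      thus "{\<omega> \<in> space M. b * B y \<omega> \<le> t - real k} \<subseteq> {\<omega> \<in> space M. b * B x \<omega> \<le> t - real k}"
        by (auto intro: order_trans)
    qed measurable
    moreover have p01: "0 \<le> p y k" "p y k \<le> 1"
    proof -
      show "0 \<le> p y k" unfolding p_def by simp
      have "p y k \<le> (\<integral>\<omega>. 1 \<partial>M)" unfolding p_def by (rule integral_mono') (auto simp: indicator_def)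
      thus "p y k \<le> 1" by (simp add: prob_space)
    qed
    ultimately have "p y k * (F x k - F y k) \<le> 1 * (F x k - F y k)" by (intro mult_right_mono) auto
    moreover have "(p x k - p y k) * F x k \<le> rate powr \<gamma> * (y - x)"
    proof -
      have "(p x k - p y k) * F x k \<le> \<bar>p x k - p y k\<bar> * 1" using F01 by (intro mult_mono) auto
      also have "\<dots> \<le> rate powr \<gamma> * (y - x)" using K_prob_lipschitz[OF x, of k] by (simp add: p_def)
      finally show ?thesis .
    qed
    ultimately show "p x k * F x k - p y k * F y k \<le> rate powr \<gamma> * (y - x) + (F x k - F y k)"
      by (simp add: algebra_simps)
  qed
  finally show ?thesis by (simp add: F_def)
qed

text \<open>Self-similarity, read off from the transforms at integers.\<close>

lemma B_scaling:
  assumes \<beta>1: "\<beta> < 1" and x: "x > 0"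
  shows "distr M borel (B x) = distr M borel (\<lambda>\<omega>. x powr (1 / \<beta>) * B 1 \<omega>)"
proof (rule laplace_unique_measure)
  have [measurable]: "B x \<in> borel_measurable M" "B 1 \<in> borel_measurable M" using x by (auto intro: B_meas)
  show "finite_measure (distr M borel (B x))" "finite_measure (distr M borel (\<lambda>\<omega>. x powr (1 / \<beta>) * B 1 \<omega>))"
    by (auto intro!: finite_measure_distr)
  show "AE t in distr M borel (B x). 0 \<le> t" "AE t in distr M borel (\<lambda>\<omega>. x powr (1 / \<beta>) * B 1 \<omega>). 0 \<le> t"
    using x B_nonneg by (auto simp: AE_distr_iff intro!: AE_I2)
  fix n :: nat
  have "(\<integral>t. exp (- real n * t) \<partial>distr M borel (B x)) = (\<integral>\<omega>. exp (- real n * B x \<omega>) \<partial>M)"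
    by (rule integral_distr) auto
  also have "\<dots> = exp (- x * real n powr \<beta>)" using x by (intro B_laplace) auto
  also have "\<dots> = exp (- 1 * (real n * x powr (1 / \<beta>)) powr \<beta>)"
    using x \<beta> by (simp add: powr_mult powr_powr mult.commute)
  also have "\<dots> = (\<integral>\<omega>. exp (- (real n * x powr (1 / \<beta>)) * B 1 \<omega>) \<partial>M)"
    using x by (intro B_laplace[symmetric]) auto
  also have "\<dots> = (\<integral>t. exp (- real n * t) \<partial>distr M borel (\<lambda>\<omega>. x powr (1 / \<beta>) * B 1 \<omega>))"
    by (subst integral_distr) (auto simp: mult.assoc)
  finally show "(\<integral>t. exp (- real n * t) \<partial>distr M borel (B x))
    = (\<integral>t. exp (- real n * t) \<partial>distr M borel (\<lambda>\<omega>. x powr (1 / \<beta>) * B 1 \<omega>))" .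
qed auto

lemma B_pos: "AE \<omega> in M. 0 < B 1 \<omega>"
  using B_less[of 0 1, OF order_refl zero_less_one] AE_space by eventually_elim (simp add: B_0)

text \<open>In the main case \<open>w\<close> is the density of the inverse of \<open>b * B\<close>
  at level \<open>s\<close>, whose law is that of
  \<open>(s / b) powr \<beta> * B 1 powr (- \<beta>)\<close>. If \<open>b = 0\<close> or
  \<open>s \<le> 0\<close>, the probabilities do not change with \<open>x > 0\<close>, and
  \<open>w = 0\<close> works.\<close>

lemma B_prob_density:
  assumes "b = 0 \<or> \<beta> < 1"
  shows "\<exists>w :: real \<Rightarrow> ennreal. w \<in> borel_measurable borel \<and> (\<integral>\<^sup>+r. w r \<partial>lborel) \<le> 1 \<and>
    (\<forall>x y. 0 < x \<longrightarrow> x \<le> y \<longrightarrow>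
      ennreal (prob {\<omega> \<in> space M. b * B x \<omega> \<le> s} - prob {\<omega> \<in> space M. b * B y \<omega> \<le> s})
        \<le> (\<integral>\<^sup>+r. w r * indicator {x..<y} r \<partial>lborel))"
proof (cases "b = 0 \<or> s \<le> 0")
  case True
  have "prob {\<omega> \<in> space M. b * B x \<omega> \<le> s} = prob {\<omega> \<in> space M. b * B y \<omega> \<le> s}" if "0 < x" "x \<le> y" for x y
  proof (cases "b = 0")
    case False
    hence b0: "b > 0" and s: "s \<le> 0" and \<beta>1: "\<beta> < 1" using b True assms by auto
    have "prob {\<omega> \<in> space M. b * B z \<omega> \<le> s} = 0" if z: "z > 0" for z
    proof -
      have [measurable]: "B z \<in> borel_measurable M" "B 1 \<in> borel_measurable M" using z by (auto intro: B_meas)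
      have "AE \<omega> in M. 0 < z powr (1 / \<beta>) * B 1 \<omega>" using B_pos by eventually_elim (use z in simp)
      hence "AE x in distr M borel (B z). 0 < x" unfolding B_scaling[OF \<beta>1 z] by (simp add: AE_distr_iff)
      hence "AE \<omega> in M. 0 < B z \<omega>" by (simp add: AE_distr_iff)
      hence "AE \<omega> in M. \<not> b * B z \<omega> \<le> s"
        by eventually_elim (use b0 s mult_pos_pos in \<open>force simp: not_le intro: le_less_trans\<close>)
      hence "emeasure M {\<omega> \<in> space M. b * B z \<omega> \<le> s} = 0" by (rule emeasure_eq_0_AE)
      thus ?thesis by (simp add: measure_def)
    qed
    thus ?thesis using that by simp
  qed simp
  thus ?thesis by (intro exI[of _ "\<lambda>_. 0"]) auto
next
  case False
  hence b0: "b > 0" and s: "s > 0" and \<beta>1: "\<beta> < 1" using b assms by auto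
  define E where "E \<omega> = B 1 \<omega> powr (- \<beta>)" for \<omega>
  have [measurable]: "B 1 \<in> borel_measurable M" by (rule B_meas) simp
  have [measurable]: "E \<in> borel_measurable M" unfolding E_def by measurable
  obtain c where c: "c > 0" and ac: "absolutely_continuous lborel (distr M borel (\<lambda>\<omega>. c * E \<omega>))"
    using inverse_stable_absolutely_continuous[OF \<beta>(1) \<beta>1 _ _ B_pos] B_nonneg B_laplace[of 1]
    unfolding E_def by auto
  define d where "d = (s / b) powr \<beta>"
  have d: "d > 0" using s b0 by (simp add: d_def)
  \<comment> \<open>Rescaling by \<open>d / c\<close> passes from the constant of the existence
    result to the one that belongs to the level \<open>s\<close>.\<close>
  have ac': "absolutely_continuous lborel (distr M borel (\<lambda>\<omega>. d * E \<omega>))"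
    using absolutely_continuous_cmult[OF _ _ ac, of "d / c"] c d by (simp add: mult.assoc[symmetric])
  define \<mu> where "\<mu> = distr M borel (\<lambda>\<omega>. d * E \<omega>)"
  define w where "w = RN_deriv lborel \<mu>"
  have w: "density lborel w = \<mu>"
    unfolding w_def using ac' by (intro sigma_finite_measure.density_RN_deriv sigma_finite_lborel) (auto simp: \<mu>_def)
  have [measurable]: "w \<in> borel_measurable borel" unfolding w_def using borel_measurable_RN_deriv[of lborel \<mu>] by simp
  have w_int: "(\<integral>\<^sup>+r. w r * indicator S r \<partial>lborel) = emeasure \<mu> S" if "S \<in> sets borel" for S
    unfolding w[symmetric] using that by (subst emeasure_density) auto
  have F: "prob {\<omega> \<in> space M. b * B x \<omega> \<le> s} = prob {\<omega> \<in> space M. x \<le> d * E \<omega>}" if x: "x > 0" for x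
  proof -
    have [measurable]: "B x \<in> borel_measurable M" using x by (auto intro: B_meas)
    have "prob {\<omega> \<in> space M. b * B x \<omega> \<le> s} = measure (distr M borel (B x)) {..s / b}"
      using b0 by (subst measure_distr) (auto intro!: arg_cong[where f = prob] simp: field_simps)
    also have "\<dots> = prob {\<omega> \<in> space M. x powr (1 / \<beta>) * B 1 \<omega> \<le> s / b}"
      unfolding B_scaling[OF \<beta>1 x] by (subst measure_distr) (auto intro!: arg_cong[where f = prob])
    also have "\<dots> = prob {\<omega> \<in> space M. x \<le> d * E \<omega>}"
    proof -
      have iff: "x powr (1 / \<beta>) * B 1 \<omega> \<le> s / b \<longleftrightarrow> x \<le> d * E \<omega>" if Z0: "0 < B 1 \<omega>" for \<omega>
      proof -
        have "x \<le> d * E \<omega> \<longleftrightarrow> x * B 1 \<omega> powr \<beta> \<le> d"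
          unfolding E_def powr_minus divide_inverse[symmetric]
          using Z0 by (intro pos_le_divide_eq) simp
        also have "x * B 1 \<omega> powr \<beta> = (x powr (1 / \<beta>) * B 1 \<omega>) powr \<beta>"
          using x Z0 \<beta> by (simp add: powr_mult powr_powr)
        also have "\<dots> \<le> d \<longleftrightarrow> x powr (1 / \<beta>) * B 1 \<omega> \<le> s / b"
          unfolding d_def by (rule powr_le_iff_base) (use x Z0 s b0 \<beta> in auto)
        finally show ?thesis by simp
      qed
      have "{\<omega> \<in> space M. x powr (1 / \<beta>) * B 1 \<omega> \<le> s / b} \<in> sets M" by measurable
      moreover have "{\<omega> \<in> space M. x \<le> d * E \<omega>} \<in> sets M" by measurable
      ultimately show ?thesis
        by (intro measure_eq_AE eventually_mono[OF B_pos]) (simp_all add: iff)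
    qed
    finally show ?thesis .
  qed
  show ?thesis
  proof (intro exI[of _ w] conjI allI impI)
    show "w \<in> borel_measurable borel" by measurable
    have "(\<integral>\<^sup>+r. w r \<partial>lborel) = emeasure \<mu> UNIV" using w_int[of UNIV] by simp
    also have "\<dots> \<le> 1" by (simp add: \<mu>_def emeasure_distr emeasure_le_1)
    finally show "(\<integral>\<^sup>+r. w r \<partial>lborel) \<le> 1" .
    fix x y :: real assume x: "0 < x" "x \<le> y"
    have "prob {\<omega> \<in> space M. b * B x \<omega> \<le> s} - prob {\<omega> \<in> space M. b * B y \<omega> \<le> s}
      = prob {\<omega> \<in> space M. x \<le> d * E \<omega>} - prob {\<omega> \<in> space M. y \<le> d * E \<omega>}"
      using F x by simp
    also have "\<dots> = prob ({\<omega> \<in> space M. x \<le> d * E \<omega>} - {\<omega> \<in> space M. y \<le> d * E \<omega>})"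
      using x by (intro finite_measure_Diff[symmetric]) auto
    also have "{\<omega> \<in> space M. x \<le> d * E \<omega>} - {\<omega> \<in> space M. y \<le> d * E \<omega>} = (\<lambda>\<omega>. d * E \<omega>) -` {x..<y} \<inter> space M"
      by auto
    finally have "ennreal (prob {\<omega> \<in> space M. b * B x \<omega> \<le> s} - prob {\<omega> \<in> space M. b * B y \<omega> \<le> s}) = emeasure \<mu> {x..<y}"
      by (simp add: \<mu>_def emeasure_distr emeasure_eq_measure)
    thus "ennreal (prob {\<omega> \<in> space M. b * B x \<omega> \<le> s} - prob {\<omega> \<in> space M. b * B y \<omega> \<le> s}) \<le> (\<integral>\<^sup>+r. w r * indicator {x..<y} r \<partial>lborel)"
      by (simp add: w_int)
  qed
qed

text \<open>If the hitting time is at most 0, almost surely \<open>Y x > t\<close> for every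
  \<open>x > 0\<close>. Markov's inequality for \<open>1 - exp (- Y x)\<close> bounds the
  probability by \<open>(1 - exp (- x * exponent 1)) / (1 - exp (- t))\<close>, which tends to 0
  with \<open>x\<close>.\<close>

lemma hit_positive:
  assumes t: "t > 0"
  shows "prob {\<omega> \<in> space M. hit t \<omega> \<le> 0} = 0"
proof -
  have "prob {\<omega> \<in> space M. hit t \<omega> \<le> 0} \<le> (1 - exp (- (1 / real (Suc n)) * exponent 1)) / (1 - exp (- t))" for n
  proof -
    define x where "x = 1 / real (Suc n)"
    have x: "x > 0" by (simp add: x_def)
    have [measurable]: "Y x \<in> borel_measurable M" using x by (intro Y_meas) simp
    have int: "integrable M (\<lambda>\<omega>. exp (- 1 * Y x \<omega>))"
      by (intro integrable_const_bound[of _ 1] AE_I2) (use x Y_nonneg in auto)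
    have "(1 - exp (- t)) * prob {\<omega> \<in> space M. hit t \<omega> \<le> 0} \<le> (1 - exp (- t)) * prob {\<omega> \<in> space M. t < Y x \<omega>}"
    proof (intro mult_left_mono finite_measure_mono_AE)
      show "AE \<omega> in M. \<omega> \<in> {\<omega> \<in> space M. hit t \<omega> \<le> 0} \<longrightarrow> \<omega> \<in> {\<omega> \<in> space M. t < Y x \<omega>}"
        using hit_properties
      proof eventually_elim
        case (elim \<omega>)
        hence "Y x \<omega> \<le> t \<longrightarrow> x \<le> hit t \<omega>" using x by auto
        thus ?case using x by auto
      qed
    qed (use t in auto)
    also have "\<dots> = (\<integral>\<omega>. (1 - exp (- t)) * indicat_real {\<omega> \<in> space M. t < Y x \<omega>} \<omega> \<partial>M)" by simp
    also have "\<dots> \<le> (\<integral>\<omega>. 1 - exp (- 1 * Y x \<omega>) \<partial>M)"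
    proof (rule integral_mono)
      show "integrable M (\<lambda>\<omega>. (1 - exp (- t)) * indicat_real {\<omega> \<in> space M. t < Y x \<omega>} \<omega>)"
        by (intro integrable_mult_right) (auto simp: emeasure_eq_measure)
      show "integrable M (\<lambda>\<omega>. 1 - exp (- 1 * Y x \<omega>))" using int by simp
      show "(1 - exp (- t)) * indicat_real {\<omega> \<in> space M. t < Y x \<omega>} \<omega> \<le> 1 - exp (- 1 * Y x \<omega>)" if "\<omega> \<in> space M" for \<omega>
        using Y_nonneg[OF that, of x] x by (auto simp: indicator_def)
    qed
    also have "\<dots> = 1 - exp (- x * exponent 1)"
      using int Y_laplace[of x 1] x by (simp add: prob_space)
    finally have "prob {\<omega> \<in> space M. hit t \<omega> \<le> 0} \<le> (1 - exp (- x * exponent 1)) / (1 - exp (- t))"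
      using t by (simp add: pos_le_divide_eq mult.commute)
    thus ?thesis by (simp only: x_def)
  qed
  moreover have "(\<lambda>n. (1 - exp (- (1 / real (Suc n)) * exponent 1)) / (1 - exp (- t))) \<longlonglongrightarrow> (1 - exp (- 0 * exponent 1)) / (1 - exp (- t))"
    using t by (intro tendsto_intros LIMSEQ_Suc[OF lim_1_over_n]) auto
  ultimately have "prob {\<omega> \<in> space M. hit t \<omega> \<le> 0} \<le> (1 - exp (- 0 * exponent 1)) / (1 - exp (- t))"
    using LIMSEQ_le_const by fastforce
  thus ?thesis by (simp add: antisym)
qed

text \<open>On intervals the law is dominated by a measure \<open>D\<close> with a Lebesgue density,
  built from the summands of \<open>Y_prob_increment\<close>, and the domination extends to Borel
  sets. Two facts shape the passage: the interval estimates hold to the right of 0, and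
  \<open>D\<close> has infinite total mass.\<close>

lemma hit_absolutely_continuous:
  assumes "b = 0 \<or> \<beta> < 1" and t: "t > 0"
  shows "absolutely_continuous lborel (law t)"
proof -
  obtain n :: nat where n: "t < real n" using reals_Archimedean2 by blast
  have "\<forall>k. \<exists>w. w \<in> borel_measurable borel \<and> (\<integral>\<^sup>+r. w r \<partial>lborel) \<le> 1 \<and> (\<forall>x y. 0 < x \<longrightarrow> x \<le> y \<longrightarrow>
      ennreal (prob {\<omega> \<in> space M. b * B x \<omega> \<le> t - real k} - prob {\<omega> \<in> space M. b * B y \<omega> \<le> t - real k})
        \<le> (\<integral>\<^sup>+r. w r * indicator {x..<y} r \<partial>lborel))"
    by (rule allI, rule B_prob_density[OF assms(1)])
  from choice[OF this] obtain w :: "nat \<Rightarrow> real \<Rightarrow> ennreal" where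
    *: "\<forall>k. w k \<in> borel_measurable borel \<and> (\<integral>\<^sup>+r. w k r \<partial>lborel) \<le> 1 \<and> (\<forall>x y. 0 < x \<longrightarrow> x \<le> y \<longrightarrow>
      ennreal (prob {\<omega> \<in> space M. b * B x \<omega> \<le> t - real k} - prob {\<omega> \<in> space M. b * B y \<omega> \<le> t - real k})
        \<le> (\<integral>\<^sup>+r. w k r * indicator {x..<y} r \<partial>lborel))" ..
  have [measurable]: "w k \<in> borel_measurable borel" for k using * by blast
  have w_int: "(\<integral>\<^sup>+r. w k r \<partial>lborel) \<le> 1" for k using * by blast
  have w: "ennreal (prob {\<omega> \<in> space M. b * B x \<omega> \<le> t - real k} - prob {\<omega> \<in> space M. b * B y \<omega> \<le> t - real k})
        \<le> (\<integral>\<^sup>+r. w k r * indicator {x..<y} r \<partial>lborel)" if "0 < x" "x \<le> y" for k x y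
    using * that by blast
  define v where "v r = (\<Sum>k<n. ennreal (rate powr \<gamma>) + w k r)" for r
  have [measurable]: "v \<in> borel_measurable borel" unfolding v_def by measurable
  define D where "D = density lborel v"
  have D: "emeasure D S = (\<Sum>k<n. ennreal (rate powr \<gamma>) * emeasure lborel S + (\<integral>\<^sup>+r. w k r * indicator S r \<partial>lborel))"
    if [measurable]: "S \<in> sets borel" for S
  proof -
    have "emeasure D S = (\<integral>\<^sup>+r. (\<Sum>k<n. ennreal (rate powr \<gamma>) * indicator S r + w k r * indicator S r) \<partial>lborel)"
      unfolding D_def v_def by (subst emeasure_density) (auto simp: sum_distrib_right distrib_right)
    also have "\<dots> = (\<Sum>k<n. (\<integral>\<^sup>+r. ennreal (rate powr \<gamma>) * indicator S r + w k r * indicator S r \<partial>lborel))"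
      by (rule nn_integral_sum) measurable
    also have "\<dots> = (\<Sum>k<n. ennreal (rate powr \<gamma>) * emeasure lborel S + (\<integral>\<^sup>+r. w k r * indicator S r \<partial>lborel))"
      by (intro sum.cong refl, subst nn_integral_add) (auto simp: nn_integral_cmult_indicator)
    finally show ?thesis .
  qed
  have D_fin: "emeasure D S < \<infinity>" if "S \<in> sets borel" "emeasure lborel S < \<infinity>" for S
  proof -
    have "(\<integral>\<^sup>+r. w k r * indicator S r \<partial>lborel) \<le> 1" for k
      by (rule order_trans[OF nn_integral_mono w_int[of k]]) (auto simp: indicator_def)
    hence "(\<integral>\<^sup>+r. w k r * indicator S r \<partial>lborel) < \<infinity>" for k by (rule le_less_trans) simp
    thus ?thesis using that by (simp add: D ennreal_mult_less_top)
  qed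
  have space_law: "space (law t) = UNIV" "sets (law t) = sets borel" by (simp_all add: law_def)
  interpret L: finite_measure "law t" unfolding law_def by (intro finite_measure_distr) simp
  have law_measure: "measure (law t) S = prob {\<omega> \<in> space M. hit t \<omega> \<in> S}" if "S \<in> sets borel" for S
    unfolding law_def using that by (subst measure_distr) (auto intro!: arg_cong[where f = prob])
  \<comment> \<open>Open intervals fit the sandwich: \<open>x < hit t\<close> forces
    \<open>Y x \<le> t\<close>, and \<open>hit t < y\<close> forces \<open>Y y > t\<close>, so the
    endpoints need not be examined.\<close>
  have open_le: "emeasure (law t) {x<..<y} \<le> emeasure D {x<..<y}" if x: "0 < x" "x \<le> y" for x y
  proof -
    have [measurable]: "Y x \<in> borel_measurable M" "Y y \<in> borel_measurable M" using x by (auto intro!: Y_meas)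
    have "measure (law t) {x<..<y} \<le> prob ({\<omega> \<in> space M. Y x \<omega> \<le> t} - {\<omega> \<in> space M. Y y \<omega> \<le> t})"
      unfolding law_measure[OF borel_open[OF open_greaterThanLessThan]]
    proof (rule finite_measure_mono_AE)
      show "AE \<omega> in M. \<omega> \<in> {\<omega> \<in> space M. hit t \<omega> \<in> {x<..<y}} \<longrightarrow> \<omega> \<in> {\<omega> \<in> space M. Y x \<omega> \<le> t} - {\<omega> \<in> space M. Y y \<omega> \<le> t}"
        using hit_properties
      proof eventually_elim
        case (elim \<omega>)
        hence "x < hit t \<omega> \<longrightarrow> Y x \<omega> \<le> t" "Y y \<omega> \<le> t \<longrightarrow> y \<le> hit t \<omega>" using x by auto
        thus ?case by auto
      qed
    qed measurable
    also have "\<dots> = prob {\<omega> \<in> space M. Y x \<omega> \<le> t} - prob {\<omega> \<in> space M. Y y \<omega> \<le> t}"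
    proof (rule finite_measure_Diff)
      have "Y x \<omega> \<le> Y y \<omega>" if "\<omega> \<in> space M" for \<omega> using Y_mono[OF that, of x y] x by simp
      thus "{\<omega> \<in> space M. Y y \<omega> \<le> t} \<subseteq> {\<omega> \<in> space M. Y x \<omega> \<le> t}" by (auto intro: order_trans)
    qed measurable
    also have "\<dots> \<le> (\<Sum>k<n. rate powr \<gamma> * (y - x) + (prob {\<omega> \<in> space M. b * B x \<omega> \<le> t - real k} - prob {\<omega> \<in> space M. b * B y \<omega> \<le> t - real k}))"
      using x t n by (intro Y_prob_increment) auto
    finally have "emeasure (law t) {x<..<y} \<le> ennreal (\<Sum>k<n. rate powr \<gamma> * (y - x) + (prob {\<omega> \<in> space M. b * B x \<omega> \<le> t - real k} - prob {\<omega> \<in> space M. b * B y \<omega> \<le> t - real k}))"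
      unfolding L.emeasure_eq_measure by (rule ennreal_leI)
    also have "\<dots> = (\<Sum>k<n. ennreal (rate powr \<gamma> * (y - x)) + ennreal (prob {\<omega> \<in> space M. b * B x \<omega> \<le> t - real k} - prob {\<omega> \<in> space M. b * B y \<omega> \<le> t - real k}))"
    proof -
      have mono: "prob {\<omega> \<in> space M. b * B y \<omega> \<le> t - real k} \<le> prob {\<omega> \<in> space M. b * B x \<omega> \<le> t - real k}" for k
      proof (rule finite_measure_mono)
        have [measurable]: "B x \<in> borel_measurable M" using x by (auto intro: B_meas)
        show "{\<omega> \<in> space M. b * B x \<omega> \<le> t - real k} \<in> sets M" by measurable
        have "b * B x \<omega> \<le> b * B y \<omega>" if "\<omega> \<in> space M" for \<omega>
          using B_mono[OF that, of x y] x b by (intro mult_left_mono) auto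
        thus "{\<omega> \<in> space M. b * B y \<omega> \<le> t - real k} \<subseteq> {\<omega> \<in> space M. b * B x \<omega> \<le> t - real k}"
          by (auto intro: order_trans)
      qed
      thus ?thesis using x by (subst sum_ennreal[symmetric]) (auto simp: ennreal_plus intro!: add_nonneg_nonneg)
    qed
    also have "\<dots> \<le> (\<Sum>k<n. ennreal (rate powr \<gamma>) * emeasure lborel {x<..<y} + (\<integral>\<^sup>+r. w k r * indicator {x<..<y} r \<partial>lborel))"
    proof (intro sum_mono add_mono)
      fix k
      show "ennreal (rate powr \<gamma> * (y - x)) \<le> ennreal (rate powr \<gamma>) * emeasure lborel {x<..<y}"
        using x by (simp add: ennreal_mult)
      have "(\<integral>\<^sup>+r. w k r * indicator {x..<y} r \<partial>lborel) = (\<integral>\<^sup>+r. w k r * indicator {x<..<y} r \<partial>lborel)"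
        by (intro nn_integral_cong_AE eventually_mono[OF AE_lborel_singleton[of x]]) (auto simp: indicator_def)
      thus "ennreal (prob {\<omega> \<in> space M. b * B x \<omega> \<le> t - real k} - prob {\<omega> \<in> space M. b * B y \<omega> \<le> t - real k})
        \<le> (\<integral>\<^sup>+r. w k r * indicator {x<..<y} r \<partial>lborel)"
        using w[OF x, of k] by simp
    qed
    also have "\<dots> = emeasure D {x<..<y}" by (rule D[symmetric]) simp
    finally show ?thesis .
  qed
  \<comment> \<open>Half-open intervals are what the comparison of distribution functions asks for;
    they are decreasing limits of open ones.\<close>
  have Ioc_le: "emeasure (law t) {x<..y} \<le> emeasure D {x<..y}" if x: "0 < x" "x \<le> y" for x y
  proof -
    define \<delta> where "\<delta> m = 1 / real (Suc m)" for m
    have \<delta>_pos: "\<delta> m > 0" for m by (simp add: \<delta>_def)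
    have \<delta>_dec: "\<delta> (Suc m) \<le> \<delta> m" for m unfolding \<delta>_def by (intro divide_left_mono) auto
    have \<delta>_small: "\<exists>m. \<delta> m < e" if "e > 0" for e
      using reals_Archimedean[OF that] by (auto simp: \<delta>_def inverse_eq_divide simp del: of_nat_Suc)
    have dec: "decseq (\<lambda>m. {x<..<y + \<delta> m})"
    proof (rule decseq_SucI, rule subsetI)
      fix m z assume "z \<in> {x<..<y + \<delta> (Suc m)}"
      thus "z \<in> {x<..<y + \<delta> m}" using \<delta>_dec[of m] by simp
    qed
    have Int: "(\<Inter>m. {x<..<y + \<delta> m}) = {x<..y}"
    proof (intro equalityI subsetI)
      fix z assume z: "z \<in> (\<Inter>m. {x<..<y + \<delta> m})"
      have z': "x < z" "z < y + \<delta> m" for m using INT_D[OF z, of m] by simp_all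
      have "z \<le> y"
      proof (rule ccontr)
        assume "\<not> z \<le> y"
        then obtain m where "\<delta> m < z - y" using \<delta>_small[of "z - y"] by auto
        thus False using z'(2)[of m] by simp
      qed
      thus "z \<in> {x<..y}" using z' by simp
    next
      fix z assume "z \<in> {x<..y}"
      hence "z \<in> {x<..<y + \<delta> m}" for m using \<delta>_pos[of m] by simp
      thus "z \<in> (\<Inter>m. {x<..<y + \<delta> m})" by (rule INT_I)
    qed
    have "(INF m. emeasure D {x<..<y + \<delta> m}) = emeasure D (\<Inter>m. {x<..<y + \<delta> m})"
    proof (rule INF_emeasure_decseq[OF _ dec])
      show "range (\<lambda>m. {x<..<y + \<delta> m}) \<subseteq> sets D" unfolding D_def by (rule image_subsetI) simp
      show "emeasure D {x<..<y + \<delta> m} \<noteq> \<infinity>" for m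
      proof -
        have "emeasure lborel {x<..<y + \<delta> m} < \<infinity>" using x \<delta>_pos[of m] by (subst emeasure_lborel_Ioo) auto
        thus ?thesis using D_fin[of "{x<..<y + \<delta> m}"] by simp
      qed
    qed
    hence "emeasure D {x<..y} = (INF m. emeasure D {x<..<y + \<delta> m})" unfolding Int by simp
    moreover have "emeasure (law t) {x<..y} \<le> emeasure D {x<..<y + \<delta> m}" for m
    proof -
      have "{x<..y} \<subseteq> {x<..<y + \<delta> m}" using \<delta>_pos[of m] by auto
      hence "emeasure (law t) {x<..y} \<le> emeasure (law t) {x<..<y + \<delta> m}"
        by (rule emeasure_mono) (simp add: space_law)
      also have "\<dots> \<le> emeasure D {x<..<y + \<delta> m}"
        using x \<delta>_pos[of m] by (intro open_le) auto
      finally show ?thesis .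
    qed
    ultimately show ?thesis by (simp add: INF_greatest)
  qed
  show ?thesis
    unfolding absolutely_continuous_def
  proof
    fix S :: "real set" assume "S \<in> null_sets lborel"
    hence S[measurable]: "S \<in> sets borel" and S0: "emeasure lborel S = 0" by auto
    \<comment> \<open>These intervals exhaust \<open>{0<..}\<close>; on each of them
      \<open>D\<close> is finite and the left endpoint is positive. The remaining half-line
      \<open>{..0}\<close> is null by \<open>hit_positive\<close>.\<close>
    define I where "I m = {1 / real (Suc m)<..real (Suc m)}" for m
    have [measurable]: "I m \<in> sets borel" for m by (simp add: I_def)
    have null: "emeasure (law t) (S \<inter> I m) = 0" for m
    proof -
      define \<mu> where "\<mu> = density (law t) (indicator (I m))"
      define \<rho> where "\<rho> = density D (indicator (I m))"
      have \<mu>: "emeasure \<mu> A = emeasure (law t) (A \<inter> I m)" and \<rho>: "emeasure \<rho> A = emeasure D (A \<inter> I m)"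
        if "A \<in> sets borel" for A
        unfolding \<mu>_def \<rho>_def Int_commute[of A] using that
        by (auto intro!: emeasure_restricted simp: space_law D_def I_def)
      have sets: "sets \<mu> = sets borel" "sets \<rho> = sets borel" by (simp_all add: \<mu>_def \<rho>_def D_def space_law)
      have sp: "space \<mu> = UNIV" "space \<rho> = UNIV"
        using sets_eq_imp_space_eq[OF sets(1)] sets_eq_imp_space_eq[OF sets(2)] by simp_all
      have fin: "finite_measure \<mu>" "finite_measure \<rho>"
      proof -
        show "finite_measure \<mu>" by (rule finite_measureI) (simp add: sp \<mu> L.emeasure_eq_measure)
        have "emeasure lborel (I m) < \<infinity>" unfolding I_def by (cases "1 / real (Suc m) \<le> real (Suc m)") auto
        hence "emeasure D (I m) < \<infinity>" by (intro D_fin) auto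
        thus "finite_measure \<rho>" by (intro finite_measureI) (simp add: sp \<rho>)
      qed
      have le: "measure \<mu> {x<..y} \<le> measure \<rho> {x<..y}" if "x \<le> y" for x y
      proof -
        define x' where "x' = max x (1 / real (Suc m))"
        define y' where "y' = min y (real (Suc m))"
        have eq: "{x<..y} \<inter> I m = {x'<..y'}" by (auto simp: I_def x'_def y'_def)
        have "emeasure (law t) {x'<..y'} \<le> emeasure D {x'<..y'}"
        proof (cases "x' \<le> y'")
          case True
          have "0 < 1 / real (Suc m)" by simp
          hence "0 < x'" unfolding x'_def by (rule less_le_trans) simp
          thus ?thesis using True by (rule Ioc_le)
        qed simp
        hence "emeasure \<mu> {x<..y} \<le> emeasure \<rho> {x<..y}" by (simp add: \<mu> \<rho> eq)
        thus ?thesis using fin by (simp add: finite_measure.emeasure_eq_measure)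
      qed
      have "emeasure \<mu> S \<le> emeasure \<rho> S"
        by (rule measure_le_of_intervals[OF fin(1) sets(1) fin(2) sets(2) le S])
      also have "\<dots> \<le> emeasure D S" unfolding \<rho>[OF S] by (rule emeasure_mono) (auto simp: D_def)
      also have "\<dots> = 0"
      proof -
        have "absolutely_continuous lborel D" unfolding D_def by (rule absolutely_continuousI_density) simp
        from absolutely_continuousD[OF this _ S0] show ?thesis by simp
      qed
      finally show ?thesis by (simp add: \<mu>)
    qed
    have neg: "emeasure (law t) {..0} = 0"
      using hit_positive[OF t] law_measure[of "{..0}"] by (simp add: L.emeasure_eq_measure)
    have "S \<subseteq> {..0} \<union> (\<Union>m. S \<inter> I m)"
    proof
      fix s assume s: "s \<in> S"
      show "s \<in> {..0} \<union> (\<Union>m. S \<inter> I m)"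
      proof (cases "s \<le> 0")
        case False
        obtain m1 where m1: "1 / real (Suc m1) < s"
          using reals_Archimedean[of s] False by (auto simp: inverse_eq_divide simp del: of_nat_Suc)
        obtain m2 :: nat where m2: "s \<le> real m2" using real_arch_simple by blast
        have "1 / real (Suc (max m1 m2)) \<le> 1 / real (Suc m1)" by (intro divide_left_mono) auto
        moreover have "real m2 \<le> real (Suc (max m1 m2))" by simp
        ultimately have "s \<in> I (max m1 m2)"
          using m1 m2 unfolding I_def greaterThanAtMost_iff by linarith
        thus ?thesis using s by auto
      qed simp
    qed
    moreover have "{..0} \<union> (\<Union>m. S \<inter> I m) \<in> null_sets (law t)"
      using neg null by (intro null_sets.Un null_sets_UN) (auto simp: space_law)
    ultimately show "S \<in> null_sets (law t)"
      by (rule null_sets_subset[rotated 2]) (auto simp: space_law)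
  qed
qed

lemma hit_density:
  assumes "b = 0 \<or> \<beta> < 1" and t: "t > 0"
  shows "\<exists>D :: real \<Rightarrow> real. distributed M lborel (hit t) (\<lambda>x. ennreal (D x))"
proof -
  have fin: "finite_measure (law t)" unfolding law_def by (intro finite_measure_distr) simp
  obtain D where D: "D \<in> borel_measurable lborel" "AE x in lborel. RN_deriv lborel (law t) x = ennreal (D x)"
    by (rule sigma_finite_measure.real_RN_deriv[OF sigma_finite_lborel fin hit_absolutely_continuous[OF assms]])
      (auto simp: law_def)
  have "distr M lborel (hit t) = law t" by (simp add: law_def cong: distr_cong)
  also have "\<dots> = density lborel (RN_deriv lborel (law t))"
    by (rule sigma_finite_measure.density_RN_deriv[OF sigma_finite_lborel hit_absolutely_continuous[OF assms], symmetric])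
      (simp add: law_def)
  also have "\<dots> = density lborel (\<lambda>x. ennreal (D x))"
    by (rule density_cong) (use D in auto)
  finally have "distributed M lborel (hit t) (\<lambda>x. ennreal (D x))"
    unfolding distributed_def using D(1) by (intro conjI) simp_all
  thus ?thesis by (rule exI[of _ D])
qed

end

theorem theorem7:
  fixes M :: "'a measure"
    and N :: "real \<Rightarrow> 'a \<Rightarrow> nat"
    and A B :: "real \<Rightarrow> 'a \<Rightarrow> real"
    and b \<beta> \<gamma> rate :: real
  assumes "prob_space M"
    and "b \<ge> 0"
    and "0 < \<beta>" "\<beta> \<le> 1"
    and "0 < \<gamma>" "\<gamma> \<le> 1"
    and "rate > 0"
    and "poisson_process M rate N"
    and "stable_subordinator M \<gamma> A"
    and "stable_subordinator M \<beta> B"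
    and "independent_processes M [\<lambda>t \<omega>. real (N t \<omega>), A, B]"
  shows
    "let H = hitting_time N A b B;
         law = (\<lambda>t. distr M borel (H t));
         solution = ibvp_solution b \<beta> \<gamma> rate (return borel 0) (boundary_value \<gamma> rate)
     in (b = 0 \<or> \<beta> < 1 \<longrightarrow>
           (\<exists>h :: real \<Rightarrow> real \<Rightarrow> real. \<forall>t>0. distributed M lborel (H t) (\<lambda>x. ennreal (h x t)))) \<and>
        solution law \<and>
        (\<forall>u. solution u \<longrightarrow> (\<forall>t\<ge>0. u t = law t))"
proof -
  interpret hitting_setup M b \<beta> \<gamma> rate N A B
    by (intro hitting_setup.intro hitting_setup_axioms.intro equation_parameters.intro assms)
  have law_eq: "(\<lambda>t. distr M borel (hit t)) = law" by (rule ext) (simp add: law_def)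
  show ?thesis
    unfolding Let_def law_eq
  proof (intro conjI impI allI)
    assume cases: "b = 0 \<or> \<beta> < 1"
    have "\<forall>t. \<exists>D :: real \<Rightarrow> real. t > 0 \<longrightarrow> distributed M lborel (hit t) (\<lambda>x. ennreal (D x))"
    proof
      fix t
      show "\<exists>D :: real \<Rightarrow> real. t > 0 \<longrightarrow> distributed M lborel (hit t) (\<lambda>x. ennreal (D x))"
        using hit_density[OF cases, of t] by (cases "t > 0") simp_all
    qed
    \<comment> \<open>A density is determined for each \<open>t\<close> separately and only up to
      null sets; \<open>h\<close> collects one choice per time.\<close>
    from choice[OF this] obtain D :: "real \<Rightarrow> real \<Rightarrow> real"
      where "\<forall>t. t > 0 \<longrightarrow> distributed M lborel (hit t) (\<lambda>x. ennreal (D t x))" ..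
    thus "\<exists>h :: real \<Rightarrow> real \<Rightarrow> real. \<forall>t>0. distributed M lborel (hit t) (\<lambda>x. ennreal (h x t))"
      by (rule exI[of _ "\<lambda>x t. D t x"])
  qed (rule law_solution, unfold law_def[symmetric], rule solution_unique)
qed

end
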